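(* Let $\mathbb X$ be a virtual equipment and let $j\colon A\to E$, $\ell\colon A\to C$ and $r\colon C\to E$ be tight-cells. The following data are equivalent, exhibiting a relative adjunction $\ell\dashv_j r$. (1) (Hom isomorphism) An isomorphism $\sharp\colon C(\ell,1)\cong E(j,r):\flat$ of loose-cells $C\nrightarrow A$. (2) (Universal arrow) A 2-cell $\eta\colon j\Rightarrow r\ell$ (the unit) and a 2-cell $\flat\colon E(j,r)\Rightarrow C(\ell,1)$ such that $\flat(1,\ell)\circ E(j,\eta)\circ\frown_j=\frown_\ell$ as 2-cells into $C(\ell,\ell)$, and $E(\eta,r)\circ\frown_r(\ell,1)\circ\flat=1_{E(j,r)}$. (3) (Unit--counit) A 2-cell $\eta\colon j\Rightarrow r\ell$ (the unit) and a 2-cell $\varepsilon\colon C(1,\ell),E(j,r)\Rightarrow C(1,1)$ (the counit) such that: (a) the 2-cell $C(1,\ell)\Rightarrow C(1,\ell)$ obtained by inserting $\frown_j\colon()\Rightarrow E(j,j)$ after $C(1,\ell)$, then applying $(1,E(j,\eta))$, then $\varepsilon(1,\ell)\colon C(1,\ell),E(j,r\ell)\Rightarrow C(1,\ell)$, is the identity; (b) the 2-cell $E(1,j),E(j,1),E(1,r)\Rightarrow E(1,r)$ given by $(E(1,\eta),1,1)$ followed by $(1_{E(1,r)},\varepsilon)\colon E(1,r),C(1,\ell),E(j,r)\Rightarrow E(1,r)$ (using $E(1,r\ell)\cong E(1,r)\odot C(1,\ell)$) equals $\smile_j(1,r)$. (4) (Couniversal arrow) A 2-cell $\sharp\colon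 C(\ell,1)\Rightarrow E(j,r)$ and a 2-cell $\varepsilon\colon C(1,\ell),E(j,r)\Rightarrow C(1,1)$ (the counit) such that: (a) $\varepsilon\circ(1,\sharp)=\smile_\ell\colon C(1,\ell),C(\ell,1)\Rightarrow C(1,1)$; (b) the 2-cell $E(j,r)\Rightarrow E(j,r)$ obtained by inserting $\frown_\ell\colon()\Rightarrow C(\ell,\ell)$ before $E(j,r)$ and then applying $(\sharp,\varepsilon)\colon C(\ell,1),C(1,\ell),E(j,r)\Rightarrow E(j,r)$ (using $C(\ell,\ell)\cong C(\ell,1)\odot C(1,\ell)$) is the identity. (5) A $j$-representation of $C(\ell,1)$ by $r$. (6) A corepresentation of $E(j,r)$ by $\ell$. (7) A loose-adjunction $C(1,\ell)\dashv E(j,r)$.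
   Context: Virtual equipments. A virtual double category has objects; a category of tight-cells $f\colon A\to B$ (the composite of $f\colon A\to B$ and $g\colon B\to C$ is $gf$); loose-cells $p\colon A\nrightarrow B$; and 2-cells, each having as frame a chain of loose-cells $p_1\colon A_1\nrightarrow A_0,\dots,p_n\colon A_n\nrightarrow A_{n-1}$ ($n\ge 0$; chains are always listed in this order), a loose-cell $q\colon B_n\nrightarrow B_0$, and tight-cells $f_0\colon A_0\to B_0$ (left) and $f_n\colon A_n\to B_n$ (right); 2-cells have identities and associative unital multicategory-style composition. $\phi\colon p_1,\dots,p_n\Rightarrow q$ denotes a 2-cell whose tight-cells are identities; $(\phi_1,\dots,\phi_n)$ denotes juxtaposition (followed, if the composite of the codomains exists, by the opcartesian 2-cell). A 2-cell $q_1,\dots,q_m\Rightarrow q$ is opcartesian if every 2-cell (with any tight-cells) with domain $p_1,\dots,p_l,q_1,\dots,q_m,r_1,\dots,r_n$ factors uniquely through it; then $q$ is the loose-composite $q_1\odot\cdots\odot q_m$ (the loose-identity $A(1,1)\colon A\nrightarrow A$ if $m=0$). A unary 2-cell from $p$ to $q$ with left $f$ and right $g$ is cartesian if every 2-cell into $q$ with left $ff'$ and right $gg'$ factors uniquely through it via a 2-cell with left $f'$ and right $g'$; then $p$ is the restriction $q(f,g)$. A virtual equipment has all loose-identities and restrictions. Write $E(f,g):=E(1,1)(f,g)$; for $f\colon D\to E$, $g\colon A\to E$ it is a loose-cell $A\nrightarrow D$. The canonical isomorphisms $q(f,g)\cong C(f,1)\odot q\odot B(1,g)$ are used implicitly.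 A 2-cell $f\Rightarrow g$ between tight-cells $A\to B$ is equivalently a 2-cell $B(1,f)\Rightarrow B(1,g)$, or $B(g,1)\Rightarrow B(f,1)$, or $()\Rightarrow B(f,g)$. Restriction is functorial in 2-cells (contravariantly in the first argument, covariantly in the second). For $f\colon A\to B$, $\frown_f\colon ()\Rightarrow B(f,f)$ (corresponding to $1_f$) and $\smile_f\colon B(1,f),B(f,1)\Rightarrow B(1,1)$ are the canonical 2-cells (unit and counit of $B(1,f)\dashv B(f,1)$). $\phi(f,g)$ denotes the 2-cell obtained from $\phi$ by restricting along $f$ on the left and $g$ on the right; e.g. $\frown_r(\ell,1)\colon C(\ell,1)\Rightarrow E(r\ell,r)$ is the action of $r$. A relative adjunction $\ell\dashv_j r$ consists of tight-cells $j\colon A\to E$ (root), $\ell\colon A\to C$, $r\colon C\to E$ and an isomorphism $\sharp\colon C(\ell,1)\cong E(j,r):\flat$. A loose-cell $p\colon A_1\nrightarrow A_0$ is $j$-represented by $i$, and $i$-corepresented by $j$ (for tight-cells $j\colon A_0\to B$, $i\colon A_1\to B$), when $B(j,i)$ forms the loose-composite of the one-element chain $p$, i.e. via an opcartesian 2-cell $p\Rightarrow B(j,i)$; prefixes are omitted when the tight-cell is an identity, so a corepresentation of $E(j,r)$ by $\ell$ is an opcartesian 2-cell $E(j,r)\Rightarrow C(\ell,1)$. A loose-adjunction $p\dashv q$ consists of loose-cells $p\colon A\nrightarrow C$ and $q\colon C\nrightarrow A$ admitting a composite $q\odot p$, a 2-cell $\eta\colon()\Rightarrow q\odot p$ and a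 2-cell $\varepsilon\colon p,q\Rightarrow C(1,1)$ satisfying the two zig-zag laws: $p\Rightarrow p$ (insert $\eta$ after $p$, then apply $\varepsilon$ to $p,q$) and $q\Rightarrow q$ (insert $\eta$ before $q$, then apply $\varepsilon$ to $p,q$) are identities. *)

theory Defs
  imports Main
begin

section \<open>Virtual double categories\<close>

text \<open>
  A loose-cell \<open>p : A -|-> B\<close> has \<open>ldom p = A\<close> and \<open>lcod p = B\<close>. The frame of a 2-cell is given by
  its chain of sources \<open>src = [p\<^sub>1, ..., p\<^sub>n]\<close> with \<open>p\<^sub>i : A\<^sub>i -|-> A\<^sub>i\<^sub>-\<^sub>1\<close>, its target
  \<open>tgt : B\<^sub>n -|-> B\<^sub>0\<close>, and its tight-cells \<open>lft : A\<^sub>0 \<rightarrow> B\<^sub>0\<close> and \<open>rgt : A\<^sub>n \<rightarrow> B\<^sub>n\<close>. The objects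
  \<open>A\<^sub>0\<close> and \<open>A\<^sub>n\<close> are read off as the domains of \<open>lft\<close> and \<open>rgt\<close>; this matters when \<open>n = 0\<close>.

  \<open>ccomp \<psi> f [\<phi>\<^sub>1, ..., \<phi>\<^sub>n]\<close> is the composite of \<open>\<psi>\<close> with the juxtaposable 2-cells \<open>\<phi>\<^sub>i\<close>, where \<open>f\<close>
  is the left tight-cell of the juxtaposition. For \<open>n > 0\<close> the argument \<open>f\<close> is determined
  (it is \<open>lft \<phi>\<^sub>1\<close>); for \<open>n = 0\<close> it is the tight-cell along which the nullary 2-cell \<open>\<psi>\<close> is
  precomposed.
\<close>

record ('o, 't, 'l, 'c) vdc =
  Obj :: "'o set"
  Tight :: "'t set"
  tdom :: "'t \<Rightarrow> 'o"
  tcod :: "'t \<Rightarrow> 'o"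
  tid :: "'o \<Rightarrow> 't"
  tcomp :: "'t \<Rightarrow> 't \<Rightarrow> 't"  (infixl "\<bullet>\<index>" 70)
  Loose :: "'l set"
  ldom :: "'l \<Rightarrow> 'o"
  lcod :: "'l \<Rightarrow> 'o"
  Cell :: "'c set"
  src :: "'c \<Rightarrow> 'l list"
  tgt :: "'c \<Rightarrow> 'l"
  lft :: "'c \<Rightarrow> 't"
  rgt :: "'c \<Rightarrow> 't"
  cid :: "'l \<Rightarrow> 'c"
  ccomp :: "'c \<Rightarrow> 't \<Rightarrow> 'c list \<Rightarrow> 'c"

fun chain :: "('o, 't, 'l, 'c, 'z) vdc_scheme \<Rightarrow> 'o \<Rightarrow> 'l list \<Rightarrow> 'o \<Rightarrow> bool" where
  "chain X A [] B \<longleftrightarrow> A \<in> Obj X \<and> A = B"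
| "chain X A (p # ps) B \<longleftrightarrow> p \<in> Loose X \<and> lcod X p = A \<and> chain X (ldom X p) ps B"

fun juxtaposable :: "('o, 't, 'l, 'c, 'z) vdc_scheme \<Rightarrow> 't \<Rightarrow> 'c list \<Rightarrow> 't \<Rightarrow> bool" where
  "juxtaposable X f [] g \<longleftrightarrow> f \<in> Tight X \<and> f = g"
| "juxtaposable X f (\<phi> # \<phi>s) g \<longleftrightarrow> \<phi> \<in> Cell X \<and> lft X \<phi> = f \<and> juxtaposable X (rgt X \<phi>) \<phi>s g"

definition composable ::
    "('o, 't, 'l, 'c, 'z) vdc_scheme \<Rightarrow> 'c \<Rightarrow> 't \<Rightarrow> 'c list \<Rightarrow> 't \<Rightarrow> bool" where
  "composable X \<psi> f \<phi>s g \<longleftrightarrow>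
     \<psi> \<in> Cell X \<and> juxtaposable X f \<phi>s g \<and> map (tgt X) \<phi>s = src X \<psi> \<and> tcod X f = tdom X (lft X \<psi>)"

text \<open>
  \<open>comps X f [\<psi>\<^sub>1, ..., \<psi>\<^sub>n] [\<phi>s\<^sub>1, ..., \<phi>s\<^sub>n]\<close> is the list of composites of \<open>\<psi>\<^sub>i\<close> with \<open>\<phi>s\<^sub>i\<close>. The left
  tight-cell is propagated, since some of the \<open>\<phi>s\<^sub>i\<close> may be empty.
\<close>

fun comps ::
    "('o, 't, 'l, 'c, 'z) vdc_scheme \<Rightarrow> 't \<Rightarrow> 'c list \<Rightarrow> 'c list list \<Rightarrow> 'c list" where
  "comps X f (\<psi> # \<psi>s) (\<phi>s # \<phi>ss) =
     ccomp X \<psi> f \<phi>s # comps X (if \<phi>s = [] then f else rgt X (last \<phi>s)) \<psi>s \<phi>ss"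
| "comps X f _ _ = []"

locale virtual_double_category =
  fixes X :: "('o, 't, 'l, 'c, 'z) vdc_scheme" (structure)
  assumes tdom_closed: "f \<in> Tight X \<Longrightarrow> tdom X f \<in> Obj X"
    and tcod_closed: "f \<in> Tight X \<Longrightarrow> tcod X f \<in> Obj X"
    and tid: "A \<in> Obj X \<Longrightarrow> tid X A \<in> Tight X \<and> tdom X (tid X A) = A \<and> tcod X (tid X A) = A"
    and tcomp: "\<lbrakk>f \<in> Tight X; g \<in> Tight X; tcod X f = tdom X g\<rbrakk> \<Longrightarrow>
      g \<bullet> f \<in> Tight X \<and> tdom X (g \<bullet> f) = tdom X f \<and> tcod X (g \<bullet> f) = tcod X g"
    and tcomp_assoc: "\<lbrakk>f \<in> Tight X; g \<in> Tight X; h \<in> Tight X;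
      tcod X f = tdom X g; tcod X g = tdom X h\<rbrakk> \<Longrightarrow> (h \<bullet> g) \<bullet> f = h \<bullet> (g \<bullet> f)"
    and tcomp_tid_left: "f \<in> Tight X \<Longrightarrow> tid X (tcod X f) \<bullet> f = f"
    and tcomp_tid_right: "f \<in> Tight X \<Longrightarrow> f \<bullet> tid X (tdom X f) = f"
    and ldom_closed: "p \<in> Loose X \<Longrightarrow> ldom X p \<in> Obj X"
    and lcod_closed: "p \<in> Loose X \<Longrightarrow> lcod X p \<in> Obj X"
    and cell_frame: "\<phi> \<in> Cell X \<Longrightarrow>
      lft X \<phi> \<in> Tight X \<and> rgt X \<phi> \<in> Tight X \<and> tgt X \<phi> \<in> Loose X \<and>
      lcod X (tgt X \<phi>) = tcod X (lft X \<phi>) \<and> ldom X (tgt X \<phi>) = tcod X (rgt X \<phi>) \<and>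
      chain X (tdom X (lft X \<phi>)) (src X \<phi>) (tdom X (rgt X \<phi>))"
    and cid: "p \<in> Loose X \<Longrightarrow>
      cid X p \<in> Cell X \<and> src X (cid X p) = [p] \<and> tgt X (cid X p) = p \<and>
      lft X (cid X p) = tid X (lcod X p) \<and> rgt X (cid X p) = tid X (ldom X p)"
    and ccomp: "composable X \<psi> f \<phi>s g \<Longrightarrow>
      ccomp X \<psi> f \<phi>s \<in> Cell X \<and> src X (ccomp X \<psi> f \<phi>s) = concat (map (src X) \<phi>s) \<and>
      tgt X (ccomp X \<psi> f \<phi>s) = tgt X \<psi> \<and>
      lft X (ccomp X \<psi> f \<phi>s) = lft X \<psi> \<bullet> f \<and> rgt X (ccomp X \<psi> f \<phi>s) = rgt X \<psi> \<bullet> g"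
    and ccomp_assoc: "\<lbrakk>composable X \<chi> f \<psi>s g; composable X (ccomp X \<chi> f \<psi>s) h (concat \<phi>ss) k;
      list_all2 (\<lambda>\<psi> \<phi>s. map (tgt X) \<phi>s = src X \<psi>) \<psi>s \<phi>ss\<rbrakk> \<Longrightarrow>
      ccomp X (ccomp X \<chi> f \<psi>s) h (concat \<phi>ss) = ccomp X \<chi> (f \<bullet> h) (comps X h \<psi>s \<phi>ss)"
    and ccomp_cid_left: "\<phi> \<in> Cell X \<Longrightarrow> ccomp X (cid X (tgt X \<phi>)) (lft X \<phi>) [\<phi>] = \<phi>"
    and ccomp_cid_right: "\<phi> \<in> Cell X \<Longrightarrow>
      ccomp X \<phi> (tid X (tdom X (lft X \<phi>))) (map (cid X) (src X \<phi>)) = \<phi>"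

context
  fixes X :: "('o, 't, 'l, 'c, 'z) vdc_scheme" (structure)
begin

text \<open>The 2-cells \<open>ps \<Rightarrow> q\<close>, that is, those whose tight-cells are identities.\<close>

definition cells :: "'l list \<Rightarrow> 'l \<Rightarrow> 'c set" where
  "cells ps q = {\<phi> \<in> Cell X. src X \<phi> = ps \<and> tgt X \<phi> = q \<and>
     lft X \<phi> = tid X (lcod X q) \<and> rgt X \<phi> = tid X (ldom X q)}"

text \<open>Composition with a nonempty juxtaposition.\<close>

definition vcomp :: "'c \<Rightarrow> 'c list \<Rightarrow> 'c" where
  "vcomp \<psi> \<phi>s = ccomp X \<psi> (lft X (hd \<phi>s)) \<phi>s"

definition opcart_factor :: "'c \<Rightarrow> 'l list \<Rightarrow> 'l list \<Rightarrow> 'c \<Rightarrow> 'c \<Rightarrow> bool" where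
  "opcart_factor \<psi> ps rs \<chi> \<chi>' \<longleftrightarrow>
     \<chi>' \<in> Cell X \<and> src X \<chi>' = ps @ tgt X \<psi> # rs \<and> tgt X \<chi>' = tgt X \<chi> \<and>
     lft X \<chi>' = lft X \<chi> \<and> rgt X \<chi>' = rgt X \<chi> \<and>
     ccomp X \<chi>' (tid X (tdom X (lft X \<chi>))) (map (cid X) ps @ \<psi> # map (cid X) rs) = \<chi>"

text \<open>
  The chain conditions follow from the frame of \<open>\<chi>\<close> except where \<open>src X \<psi>\<close> is empty, in which case
  they ensure that \<open>ps\<close> and \<open>rs\<close> meet at the object at which \<open>\<psi>\<close> lies.
\<close>

definition opcartesian :: "'c \<Rightarrow> bool" where
  "opcartesian \<psi> \<longleftrightarrow>
     \<psi> \<in> cells (src X \<psi>) (tgt X \<psi>) \<and>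
     (\<forall>ps rs \<chi>. \<chi> \<in> Cell X \<and> src X \<chi> = ps @ src X \<psi> @ rs \<and>
        chain X (tdom X (lft X \<chi>)) ps (lcod X (tgt X \<psi>)) \<and>
        chain X (ldom X (tgt X \<psi>)) rs (tdom X (rgt X \<chi>)) \<longrightarrow>
        (\<exists>!\<chi>'. opcart_factor \<psi> ps rs \<chi> \<chi>'))"

definition desc :: "'c \<Rightarrow> 'l list \<Rightarrow> 'l list \<Rightarrow> 'c \<Rightarrow> 'c" where
  "desc \<psi> ps rs \<chi> = (THE \<chi>'. opcart_factor \<psi> ps rs \<chi> \<chi>')"

definition cart_factor :: "'c \<Rightarrow> 't \<Rightarrow> 't \<Rightarrow> 'c \<Rightarrow> 'c \<Rightarrow> bool" where
  "cart_factor c f' g' \<chi> \<chi>' \<longleftrightarrow>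
     \<chi>' \<in> Cell X \<and> src X \<chi>' = src X \<chi> \<and> [tgt X \<chi>'] = src X c \<and>
     lft X \<chi>' = f' \<and> rgt X \<chi>' = g' \<and> ccomp X c f' [\<chi>'] = \<chi>"

definition cartesian :: "'c \<Rightarrow> bool" where
  "cartesian c \<longleftrightarrow>
     c \<in> Cell X \<and> (\<exists>p. src X c = [p]) \<and>
     (\<forall>\<chi> f' g'. \<chi> \<in> Cell X \<and> tgt X \<chi> = tgt X c \<and> f' \<in> Tight X \<and> g' \<in> Tight X \<and>
        tcod X f' = tdom X (lft X c) \<and> tcod X g' = tdom X (rgt X c) \<and>
        lft X \<chi> = lft X c \<bullet> f' \<and> rgt X \<chi> = rgt X c \<bullet> g' \<longrightarrow>
        (\<exists>!\<chi>'. cart_factor c f' g' \<chi> \<chi>'))"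

definition lift :: "'c \<Rightarrow> 't \<Rightarrow> 't \<Rightarrow> 'c \<Rightarrow> 'c" where
  "lift c f' g' \<chi> = (THE \<chi>'. cart_factor c f' g' \<chi> \<chi>')"

text \<open>Factorisation through a cartesian 2-cell via a 2-cell whose tight-cells are identities.\<close>

definition glift :: "'c \<Rightarrow> 'c \<Rightarrow> 'c" where
  "glift c \<chi> = lift c (tid X (tdom X (lft X c))) (tid X (tdom X (rgt X c))) \<chi>"

text \<open>
  For \<open>\<phi> : p\<^sub>1, ..., p\<^sub>n \<Rightarrow> q\<close> with \<open>n > 0\<close>, a list \<open>cs\<close> of unary 2-cells into the \<open>p\<^sub>i\<close> exhibiting the
  restriction of the chain along \<open>f\<close> on the left and \<open>g\<close> on the right, and a cartesian
  2-cell \<open>c\<close> exhibiting the restriction \<open>q(f, g)\<close>, this is the restricted 2-cell \<open>\<phi>(f, g)\<close>.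
\<close>

definition restrict_cell :: "'c \<Rightarrow> 'c list \<Rightarrow> 'c \<Rightarrow> 'c" where
  "restrict_cell \<phi> cs c = glift c (vcomp \<phi> cs)"

end


section \<open>Virtual equipments\<close>

text \<open>
  The loose-identities and restrictions are given by an arbitrary choice; no coherence is imposed
  on it. The 2-cell \<open>lidc A : () \<Rightarrow> lid A\<close> exhibits the loose-identity of \<open>A\<close>, and \<open>resc q f g\<close>
  exhibits the restriction \<open>res q f g = q(f, g)\<close>.
\<close>

record ('o, 't, 'l, 'c) equipment = "('o, 't, 'l, 'c) vdc" +
  lid :: "'o \<Rightarrow> 'l"
  lidc :: "'o \<Rightarrow> 'c"
  res :: "'l \<Rightarrow> 't \<Rightarrow> 't \<Rightarrow> 'l"
  resc :: "'l \<Rightarrow> 't \<Rightarrow> 't \<Rightarrow> 'c"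

locale virtual_equipment = virtual_double_category X
  for X :: "('o, 't, 'l, 'c, 'z) equipment_scheme" (structure) +
  assumes loose_identity: "A \<in> Obj X \<Longrightarrow>
      lcod X (lid X A) = A \<and> ldom X (lid X A) = A \<and>
      lidc X A \<in> cells X [] (lid X A) \<and> opcartesian X (lidc X A)"
    and restriction: "\<lbrakk>q \<in> Loose X; f \<in> Tight X; g \<in> Tight X;
      tcod X f = lcod X q; tcod X g = ldom X q\<rbrakk> \<Longrightarrow>
      src X (resc X q f g) = [res X q f g] \<and> tgt X (resc X q f g) = q \<and>
      lft X (resc X q f g) = f \<and> rgt X (resc X q f g) = g \<and> cartesian X (resc X q f g)"

context
  fixes X :: "('o, 't, 'l, 'c, 'z) equipment_scheme" (structure)
begin

text \<open>\<open>hom f g\<close> is the loose-cell \<open>E(f, g)\<close>, with cartesian 2-cell \<open>homc f g : E(f, g) \<Rightarrow> E(1, 1)\<close>.\<close>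

definition hom :: "'t \<Rightarrow> 't \<Rightarrow> 'l" where
  "hom f g = res X (lid X (tcod X f)) f g"

definition homc :: "'t \<Rightarrow> 't \<Rightarrow> 'c" where
  "homc f g = resc X (lid X (tcod X f)) f g"

text \<open>\<open>B(1, f)\<close> and \<open>B(f, 1)\<close> for \<open>f : A \<rightarrow> B\<close>.\<close>

definition companion :: "'t \<Rightarrow> 'l" where
  "companion f = hom (tid X (tcod X f)) f"

definition conjoint :: "'t \<Rightarrow> 'l" where
  "conjoint f = hom f (tid X (tcod X f))"

text \<open>
  The canonical cartesian 2-cell from \<open>E(f f', g g')\<close> to \<open>E(f, g)\<close>, with tight-cells \<open>f'\<close> and \<open>g'\<close>,
  exhibiting the former as the restriction \<open>E(f, g)(f', g')\<close>.
\<close>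

definition homr :: "'t \<Rightarrow> 't \<Rightarrow> 't \<Rightarrow> 't \<Rightarrow> 'c" where
  "homr f g f' g' = lift X (homc f g) f' g' (homc (f \<bullet> f') (g \<bullet> g'))"

text \<open>
  The canonical 2-cells \<open>q, B(1, 1) \<Rightarrow> q\<close> and \<open>A(1, 1), q \<Rightarrow> q\<close> for \<open>q : B -|-> A\<close>.
\<close>

definition runit :: "'l \<Rightarrow> 'c" where
  "runit q = desc X (lidc X (ldom X q)) [q] [] (cid X q)"

definition lunit :: "'l \<Rightarrow> 'c" where
  "lunit q = desc X (lidc X (lcod X q)) [] [q] (cid X q)"

text \<open>
  The canonical 2-cell \<open>E(f, g), B(1, h) \<Rightarrow> E(f, g h)\<close> exhibiting the
  isomorphism \<open>E(f, g h) \<cong> E(f, g) \<odot> B(1, h)\<close>, where \<open>g : B \<rightarrow> E\<close> and \<open>h : A \<rightarrow> B\<close>.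
\<close>

definition hom_comp :: "'t \<Rightarrow> 't \<Rightarrow> 't \<Rightarrow> 'c" where
  "hom_comp f g h = glift X (homr f g (tid X (tdom X f)) h)
     (vcomp X (runit (hom f g)) [cid X (hom f g), homc (tid X (tcod X h)) h])"

text \<open>The 2-cells \<open>\<frown>\<^sub>f : () \<Rightarrow> B(f, f)\<close> and \<open>\<smile>\<^sub>f : B(1, f), B(f, 1) \<Rightarrow> B(1, 1)\<close>.\<close>

definition cap :: "'t \<Rightarrow> 'c" where
  "cap f = glift X (homc f f) (ccomp X (lidc X (tcod X f)) f [])"

definition cup :: "'t \<Rightarrow> 'c" where
  "cup f = vcomp X (runit (lid X (tcod X f)))
     [homc (tid X (tcod X f)) f, homc f (tid X (tcod X f))]"

text \<open>
  A 2-cell \<open>f \<Rightarrow> g\<close> between parallel tight-cells \<open>A \<rightarrow> B\<close> is represented by the corresponding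
  2-cell \<open>() \<Rightarrow> B(f, g)\<close>.
\<close>

definition tight_cells :: "'t \<Rightarrow> 't \<Rightarrow> 'c set" where
  "tight_cells f g = cells X [] (hom f g)"

text \<open>
  The action of a 2-cell \<open>\<theta>\<close> on restrictions: \<open>hom_covar f g g' \<theta>\<close> is \<open>E(f, \<theta>) : E(f, g) \<Rightarrow> E(f, g')\<close>
  for \<open>\<theta> : g \<Rightarrow> g'\<close>, and \<open>hom_contravar f f' h \<theta>\<close> is \<open>E(\<theta>, h) : E(f', h) \<Rightarrow> E(f, h)\<close>
  for \<open>\<theta> : f \<Rightarrow> f'\<close>.
\<close>

definition hom_covar :: "'t \<Rightarrow> 't \<Rightarrow> 't \<Rightarrow> 'c \<Rightarrow> 'c" where
  "hom_covar f g g' \<theta> = glift X (homc f g')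
     (vcomp X (runit (lid X (tcod X f))) [homc f g, vcomp X (homc g g') [\<theta>]])"

definition hom_contravar :: "'t \<Rightarrow> 't \<Rightarrow> 't \<Rightarrow> 'c \<Rightarrow> 'c" where
  "hom_contravar f f' h \<theta> = glift X (homc f h)
     (vcomp X (runit (lid X (tcod X f))) [vcomp X (homc f f') [\<theta>], homc f' h])"

text \<open>
  \<open>hom_act r f g\<close> is \<open>\<frown>\<^sub>r(f, g) : C(f, g) \<Rightarrow> E(r f, r g)\<close> for \<open>r : C \<rightarrow> E\<close>: the restriction
  along \<open>f\<close> and \<open>g\<close> of the 2-cell \<open>C(1, 1) \<Rightarrow> E(r, r)\<close> corresponding to \<open>\<frown>\<^sub>r : () \<Rightarrow> E(r, r)\<close>.
\<close>

definition hom_act :: "'t \<Rightarrow> 't \<Rightarrow> 't \<Rightarrow> 'c" where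
  "hom_act r f g = restrict_cell X (desc X (lidc X (tdom X r)) [] [] (cap r))
     [homc f g] (homr r r f g)"


section \<open>Representability and loose-adjunctions\<close>

text \<open>
  The \<open>j\<close>-representations of \<open>p\<close> by \<open>i\<close>, equivalently the \<open>i\<close>-corepresentations of \<open>p\<close> by \<open>j\<close>.
\<close>

definition representations :: "'t \<Rightarrow> 'l \<Rightarrow> 't \<Rightarrow> 'c set" where
  "representations j p i = {\<phi> \<in> cells X [p] (hom j i). opcartesian X \<phi>}"

definition corepresentations :: "'t \<Rightarrow> 'l \<Rightarrow> 't \<Rightarrow> 'c set" where
  "corepresentations i p j = representations j p i"

text \<open>
  Loose-adjunctions \<open>p \<stileturn> q\<close> for \<open>p : A -|-> C\<close> and \<open>q : C -|-> A\<close>, with respect to an opcartesian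
  2-cell \<open>m\<close> exhibiting its target as the composite \<open>q \<odot> p\<close>.
\<close>

definition loose_adjunction :: "'l \<Rightarrow> 'l \<Rightarrow> 'c \<Rightarrow> 'c \<Rightarrow> 'c \<Rightarrow> bool" where
  "loose_adjunction p q m \<eta> \<epsilon> \<longleftrightarrow>
     p \<in> Loose X \<and> q \<in> Loose X \<and> ldom X q = lcod X p \<and> lcod X q = ldom X p \<and>
     opcartesian X m \<and> src X m = [q, p] \<and>
     \<eta> \<in> cells X [] (tgt X m) \<and> \<epsilon> \<in> cells X [p, q] (lid X (lcod X p)) \<and>
     vcomp X (desc X m [p] [] (vcomp X (lunit p) [\<epsilon>, cid X p])) [cid X p, \<eta>] = cid X p \<and>
     vcomp X (desc X m [] [q] (vcomp X (runit q) [cid X q, \<epsilon>])) [\<eta>, cid X q] = cid X q"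


section \<open>Presentations of relative adjunctions\<close>

text \<open>
  In each of the following, \<open>j : A \<rightarrow> E\<close>, \<open>l : A \<rightarrow> C\<close> and \<open>r : C \<rightarrow> E\<close>. Passing from a chain
  \<open>E(f, g), B(1, h), \<dots>\<close> to \<open>E(f, g h), \<dots>\<close> is factorisation through the opcartesian 2-cell
  \<open>hom_comp f g h\<close>. For example, \<open>(1, \<epsilon>) : E(1, r l), E(j, r) \<Rightarrow> E(1, r)\<close> is obtained by factoring
  the composite \<open>E(1, r), C(1, l), E(j, r) \<Rightarrow> E(1, r), C(1, 1) \<Rightarrow> E(1, r)\<close> in this way.
\<close>

definition relative_adjunction :: "'t \<Rightarrow> 't \<Rightarrow> 't \<Rightarrow> 'c \<Rightarrow> 'c \<Rightarrow> bool" where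
  "relative_adjunction j l r sharp flat \<longleftrightarrow>
     sharp \<in> cells X [conjoint l] (hom j r) \<and> flat \<in> cells X [hom j r] (conjoint l) \<and>
     vcomp X flat [sharp] = cid X (conjoint l) \<and> vcomp X sharp [flat] = cid X (hom j r)"

definition universal_arrow :: "'t \<Rightarrow> 't \<Rightarrow> 't \<Rightarrow> 'c \<Rightarrow> 'c \<Rightarrow> bool" where
  "universal_arrow j l r \<eta> flat \<longleftrightarrow>
     (let A = tdom X j; C = tcod X l in
     \<eta> \<in> tight_cells j (r \<bullet> l) \<and> flat \<in> cells X [hom j r] (conjoint l) \<and>
     vcomp X (restrict_cell X flat [homr j r (tid X A) l] (homr l (tid X C) (tid X A) l))
       [vcomp X (hom_covar j j (r \<bullet> l) \<eta>) [cap j]] = cap l \<and>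
     vcomp X (hom_contravar j (r \<bullet> l) r \<eta>) [vcomp X (hom_act r l (tid X C)) [flat]] =
       cid X (hom j r))"

definition unit_counit :: "'t \<Rightarrow> 't \<Rightarrow> 't \<Rightarrow> 'c \<Rightarrow> 'c \<Rightarrow> bool" where
  "unit_counit j l r \<eta> \<epsilon> \<longleftrightarrow>
     (let A = tdom X j; C = tcod X l; E = tcod X j in
     \<eta> \<in> tight_cells j (r \<bullet> l) \<and> \<epsilon> \<in> cells X [companion l, hom j r] (lid X C) \<and>
     vcomp X (restrict_cell X \<epsilon> [cid X (companion l), homr j r (tid X A) l] (homc (tid X C) l))
       [cid X (companion l), vcomp X (hom_covar j j (r \<bullet> l) \<eta>) [cap j]] = cid X (companion l) \<and>
     vcomp X
       (desc X (hom_comp (tid X E) r l) [] [hom j r]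
         (vcomp X (runit (companion r)) [cid X (companion r), \<epsilon>]))
       [hom_covar (tid X E) j (r \<bullet> l) \<eta>, hom_comp j (tid X E) r] =
     vcomp X
       (restrict_cell X (cup j) [cid X (companion j), homr j (tid X E) (tid X A) r]
         (homc (tid X E) r))
       [cid X (companion j), hom_comp j (tid X E) r])"

definition couniversal_arrow :: "'t \<Rightarrow> 't \<Rightarrow> 't \<Rightarrow> 'c \<Rightarrow> 'c \<Rightarrow> bool" where
  "couniversal_arrow j l r sharp \<epsilon> \<longleftrightarrow>
     (let C = tcod X l in
     sharp \<in> cells X [conjoint l] (hom j r) \<and> \<epsilon> \<in> cells X [companion l, hom j r] (lid X C) \<and>
     vcomp X \<epsilon> [cid X (companion l), sharp] = cup l \<and>
     vcomp X
       (desc X (hom_comp l (tid X C) l) [] [hom j r] (vcomp X (runit (hom j r)) [sharp, \<epsilon>]))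
       [cap l, cid X (hom j r)] = cid X (hom j r))"

text \<open>
  The passage between the presentations: the unit \<open>sharp(1, l) \<circ> \<frown>\<^sub>l : () \<Rightarrow> E(j, r l)\<close> associated
  to \<open>sharp : C(l, 1) \<Rightarrow> E(j, r)\<close>, and the counit \<open>\<smile>\<^sub>l \<circ> (1, flat) : C(1, l), E(j, r) \<Rightarrow> C(1, 1)\<close> associated
  to \<open>flat : E(j, r) \<Rightarrow> C(l, 1)\<close>.
\<close>

definition unit_of :: "'t \<Rightarrow> 't \<Rightarrow> 't \<Rightarrow> 'c \<Rightarrow> 'c" where
  "unit_of j l r sharp =
     (let A = tdom X j; C = tcod X l in
     vcomp X (restrict_cell X sharp [homr l (tid X C) (tid X A) l] (homr j r (tid X A) l)) [cap l])"

definition counit_of :: "'t \<Rightarrow> 'c \<Rightarrow> 'c" where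
  "counit_of l flat = vcomp X (cup l) [cid X (companion l), flat]"

end

end

(* A 2-cell into E(f, g) is the same as a 2-cell into E(1, 1) with tight-cells f and g, and such
   2-cells can be pasted side by side, associatively and unitally. Let k : () => C(l, 1) be the unit
   of the conjoint and kappa : C(l, 1) => C(1, 1) the cartesian 2-cell; write phi = kappa o flat.
   By the Yoneda lemma sharp is determined by the unit eta, that is by sharp o k, through
   rho o sharp = eta . r(kappa), and dually flat is determined by the counit mu . phi.
   Under these bijections every presentation reduces to the same two equations: flat o sharp = 1 is
   equivalent to phi o (sharp o k) = 1_l, and sharp o flat = 1 is equivalent to eta . r(phi) = rho.
   The presentations by loose-composites need in addition that E(f, g), B(1, h) => E(f, g h) is
   opcartesian; its inverse inserts the unit () => B(1, h). *)

theory Submission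
  imports Defs
begin

section \<open>Juxtaposition and composition\<close>

context virtual_double_category
begin

text \<open>Restrictions are chosen without coherence, so each canonical 2-cell in the statements
  (\<open>hom_act\<close>, \<open>hom_comp\<close>, \<open>restrict_cell\<close>) is a factorisation
  through some \<open>homr\<close>. Composing with \<open>homc\<close> down to a loose-identity
  removes all these choices at once, because \<open>homc\<close> absorbs \<open>homr\<close>. What
  remains is pasting and whiskering by \<open>tact r\<close>; their interchange law rests on
  \<open>lidc\<close> being opcartesian with arbitrary flanking chains and arbitrary tight-cells. A
  second obstacle is the nullary 2-cells (caps, units): an empty juxtaposition does not determine
  its left tight-cell, so associativity is used in forms that carry this tight-cell explicitly. The
  presentations differ in which half of each correspondence they record: the first four take one of
  \<open>sharp\<close>, \<open>\<eta>\<close> and one of \<open>flat\<close>,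
  \<open>\<epsilon>\<close> in all four ways. A representation or corepresentation keeps one member
  of an inverse pair, which determines the other. A loose-adjunction has again a unit and a counit
  as data once \<open>E(j, r l)\<close> is taken as the composite; any other composite is reached
  along a comparison isomorphism.\<close>

lemma tight_simps [simp]:
  "f \<in> Tight X \<Longrightarrow> tdom X f \<in> Obj X"
  "f \<in> Tight X \<Longrightarrow> tcod X f \<in> Obj X"
  "A \<in> Obj X \<Longrightarrow> tid X A \<in> Tight X"
  "A \<in> Obj X \<Longrightarrow> tdom X (tid X A) = A"
  "A \<in> Obj X \<Longrightarrow> tcod X (tid X A) = A"
  using tdom_closed tcod_closed tid by auto

lemma tcomp_simps [simp]:
  assumes "f \<in> Tight X" "g \<in> Tight X" "tcod X f = tdom X g"
  shows "g \<bullet> f \<in> Tight X" "tdom X (g \<bullet> f) = tdom X f" "tcod X (g \<bullet> f) = tcod X g"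
  using tcomp assms by auto

lemma tcomp_tid [simp]:
  "f \<in> Tight X \<Longrightarrow> tcod X f = B \<Longrightarrow> tid X B \<bullet> f = f"
  "f \<in> Tight X \<Longrightarrow> tdom X f = A \<Longrightarrow> f \<bullet> tid X A = f"
  using tcomp_tid_left tcomp_tid_right by auto

lemma loose_simps [simp]:
  assumes "p \<in> Loose X"
  shows "ldom X p \<in> Obj X" "lcod X p \<in> Obj X"
    "cid X p \<in> Cell X" "src X (cid X p) = [p]" "tgt X (cid X p) = p"
    "lft X (cid X p) = tid X (lcod X p)" "rgt X (cid X p) = tid X (ldom X p)"
  using ldom_closed lcod_closed cid assms by auto

lemma cell_simps [simp]:
  assumes "\<phi> \<in> Cell X"
  shows "lft X \<phi> \<in> Tight X" "rgt X \<phi> \<in> Tight X" "tgt X \<phi> \<in> Loose X"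
    "lcod X (tgt X \<phi>) = tcod X (lft X \<phi>)" "ldom X (tgt X \<phi>) = tcod X (rgt X \<phi>)"
  using cell_frame assms by auto

lemma cell_chain: "\<phi> \<in> Cell X \<Longrightarrow> chain X (tdom X (lft X \<phi>)) (src X \<phi>) (tdom X (rgt X \<phi>))"
  using cell_frame by auto

lemma cellsI:
  "\<lbrakk>\<phi> \<in> Cell X; src X \<phi> = ps; tgt X \<phi> = q; lft X \<phi> = tid X (lcod X q); rgt X \<phi> = tid X (ldom X q)\<rbrakk>
    \<Longrightarrow> \<phi> \<in> cells X ps q"
  by (simp add: cells_def)

lemma cellsD:
  assumes "\<phi> \<in> cells X ps q"
  shows "\<phi> \<in> Cell X" "src X \<phi> = ps" "tgt X \<phi> = q"
    "lft X \<phi> = tid X (lcod X q)" "rgt X \<phi> = tid X (ldom X q)"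
  using assms by (auto simp: cells_def)

section \<open>Chains and juxtapositions\<close>

lemma chain_append:
  "chain X A (ps @ qs) C \<longleftrightarrow> (\<exists>B. chain X A ps B \<and> chain X B qs C)"
proof (induction ps arbitrary: A)
  case Nil
  have "chain X A qs C \<Longrightarrow> A \<in> Obj X" for A
    by (cases qs) (auto simp: lcod_closed)
  then show ?case by auto
qed auto

lemma chain_Obj:
  "chain X A ps B \<Longrightarrow> A \<in> Obj X" "chain X A ps B \<Longrightarrow> B \<in> Obj X"
proof -
  show "chain X A ps B \<Longrightarrow> A \<in> Obj X" by (cases ps) auto
  show "chain X A ps B \<Longrightarrow> B \<in> Obj X" by (induction ps arbitrary: A) auto
qed

lemma chain_Loose: "chain X A ps B \<Longrightarrow> p \<in> set ps \<Longrightarrow> p \<in> Loose X"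
  by (induction ps arbitrary: A) auto

lemma juxtaposable_Tight:
  assumes "juxtaposable X f \<phi>s g"
  shows "f \<in> Tight X" "g \<in> Tight X"
proof -
  show "f \<in> Tight X" using assms by (cases \<phi>s) auto
  show "g \<in> Tight X" using assms by (induction \<phi>s arbitrary: f) auto
qed

lemma juxtaposable_append:
  "juxtaposable X f (\<phi>s @ \<psi>s) h \<longleftrightarrow> (\<exists>g. juxtaposable X f \<phi>s g \<and> juxtaposable X g \<psi>s h)"
  by (induction \<phi>s arbitrary: f) (auto dest: juxtaposable_Tight)

lemma juxtaposable_Cell: "juxtaposable X f \<phi>s g \<Longrightarrow> \<phi> \<in> set \<phi>s \<Longrightarrow> \<phi> \<in> Cell X"
  by (induction \<phi>s arbitrary: f) auto

lemma juxtaposable_end: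
  "juxtaposable X f \<phi>s g \<Longrightarrow> (if \<phi>s = [] then f else rgt X (last \<phi>s)) = g"
  by (induction \<phi>s arbitrary: f) (auto split: if_splits)

lemma juxtaposable_cid_tgt:
  "juxtaposable X f \<phi>s g \<Longrightarrow>
    juxtaposable X (tid X (tcod X f)) (map (\<lambda>\<phi>. cid X (tgt X \<phi>)) \<phi>s) (tid X (tcod X g))"
  by (induction \<phi>s arbitrary: f) auto

lemma juxtaposable_cid:
  "chain X A ps B \<Longrightarrow> juxtaposable X (tid X A) (map (cid X) ps) (tid X B)"
  by (induction ps arbitrary: A) auto

text \<open>The tight-cell handed on to the second half is the right end of the first half.
  Juxtaposability identifies it with \<open>g\<close>, also when some of the \<open>\<phi>ss\<close>
  are empty.\<close>

lemma comps_append: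
  assumes "length \<psi>s = length \<phi>ss" "juxtaposable X f (concat \<phi>ss) g"
  shows "comps X f (\<psi>s @ \<psi>s') (\<phi>ss @ \<phi>ss') = comps X f \<psi>s \<phi>ss @ comps X g \<psi>s' \<phi>ss'"
  using assms
proof (induction \<psi>s \<phi>ss arbitrary: f rule: list_induct2)
  case (Cons \<psi> \<psi>s \<phi>s \<phi>ss)
  then obtain h where h: "juxtaposable X f \<phi>s h" "juxtaposable X h (concat \<phi>ss) g"
    by (auto simp: juxtaposable_append)
  show ?case
    using juxtaposable_end[OF h(1)] Cons.IH[OF h(2)] by simp
qed simp

lemma comps_cid:
  "juxtaposable X f \<phi>s g \<Longrightarrow>
    comps X f (map (\<lambda>\<phi>. cid X (tgt X \<phi>)) \<phi>s) (map (\<lambda>\<phi>. [\<phi>]) \<phi>s) = \<phi>s"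
  by (induction \<phi>s arbitrary: f) (auto simp: ccomp_cid_left)

lemma map_tgt_concat:
  "list_all2 (\<lambda>\<psi> \<phi>s. map (tgt X) \<phi>s = src X \<psi>) \<psi>s \<phi>ss \<Longrightarrow>
    map (tgt X) (concat \<phi>ss) = concat (map (src X) \<psi>s)"
  by (induction rule: list_all2_induct) auto

lemma concat_src_cid_tgt:
  "juxtaposable X f \<phi>s g \<Longrightarrow> concat (map (\<lambda>\<phi>. src X (cid X (tgt X \<phi>))) \<phi>s) = map (tgt X) \<phi>s"
  by (induction \<phi>s arbitrary: f) auto

text \<open>The form of associativity used below: only the middle part \<open>\<alpha>s\<close> of the inner juxtaposition
  consists of 2-cells other than identities.\<close>

lemma ccomp_whisker:
  assumes \<chi>: "\<chi> \<in> Cell X" "src X \<chi> = map (tgt X) \<phi>s @ map (tgt X) \<alpha>s @ map (tgt X) \<psi>s"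
      "tcod X k = tdom X (lft X \<chi>)"
    and \<phi>s: "juxtaposable X k \<phi>s k1"
    and \<beta>ss: "juxtaposable X k1 (concat \<beta>ss) k2"
    and \<psi>s: "juxtaposable X k2 \<psi>s k3"
    and \<alpha>s: "juxtaposable X (tid X (tcod X k1)) \<alpha>s (tid X (tcod X k2))"
    and match: "list_all2 (\<lambda>\<alpha> \<beta>s. map (tgt X) \<beta>s = src X \<alpha>) \<alpha>s \<beta>ss"
  shows "ccomp X (ccomp X \<chi> (tid X (tcod X k))
        (map (cid X) (map (tgt X) \<phi>s) @ \<alpha>s @ map (cid X) (map (tgt X) \<psi>s)))
      k (\<phi>s @ concat \<beta>ss @ \<psi>s) = ccomp X \<chi> k (\<phi>s @ comps X k1 \<alpha>s \<beta>ss @ \<psi>s)"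
proof -
  \<comment> \<open>The identities \<open>?i\<close> on the flanks are matched with the singletons
    \<open>?s\<close>, so that associativity leaves the flanks unchanged and only
    \<open>\<alpha>s\<close> meets \<open>\<beta>ss\<close>.\<close>
  let ?i = "map (\<lambda>\<phi>. cid X (tgt X \<phi>))" and ?s = "map (\<lambda>\<phi>. [\<phi>])"
  let ?in = "?i \<phi>s @ \<alpha>s @ ?i \<psi>s" and ?out = "?s \<phi>s @ \<beta>ss @ ?s \<psi>s"
  note tight = juxtaposable_Tight[OF \<phi>s] juxtaposable_Tight[OF \<beta>ss] juxtaposable_Tight[OF \<psi>s]
  have cells: "\<phi> \<in> Cell X" if "\<phi> \<in> set \<phi>s \<union> set \<psi>s" for \<phi>
    using that juxtaposable_Cell[OF \<phi>s] juxtaposable_Cell[OF \<psi>s] by auto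
  have in_tgt: "map (tgt X) ?in = src X \<chi>"
    using cells \<chi>(2) by auto
  have c1: "composable X \<chi> (tid X (tcod X k)) ?in (tid X (tcod X k3))"
    unfolding composable_def juxtaposable_append
    using \<chi> in_tgt juxtaposable_cid_tgt[OF \<phi>s] juxtaposable_cid_tgt[OF \<psi>s] \<alpha>s tight by auto
  note cc = ccomp[OF c1]
  have out: "concat ?out = \<phi>s @ concat \<beta>ss @ \<psi>s"
    by simp
  have src: "src X (ccomp X \<chi> (tid X (tcod X k)) ?in) = map (tgt X) (concat ?out)"
    using cc match concat_src_cid_tgt[OF \<phi>s] concat_src_cid_tgt[OF \<psi>s]
    by (simp add: map_tgt_concat o_def)
  have c2: "composable X (ccomp X \<chi> (tid X (tcod X k)) ?in) k (concat ?out) k3"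
    unfolding composable_def juxtaposable_append out
    using cc src \<phi>s \<beta>ss \<psi>s tight \<chi> by auto
  have all: "list_all2 (\<lambda>\<alpha> \<beta>s. map (tgt X) \<beta>s = src X \<alpha>) ?in ?out"
    using match cells by (auto intro!: list_all2_appendI simp: list_all2_map1 list_all2_map2 list_all2_same)
  have "comps X k ?in ?out = \<phi>s @ comps X k1 (\<alpha>s @ ?i \<psi>s) (\<beta>ss @ ?s \<psi>s)"
    using comps_cid[OF \<phi>s] comps_append[of "?i \<phi>s" "?s \<phi>s" k k1] \<phi>s by simp
  moreover have "comps X k1 (\<alpha>s @ ?i \<psi>s) (\<beta>ss @ ?s \<psi>s) = comps X k1 \<alpha>s \<beta>ss @ \<psi>s"
    using comps_cid[OF \<psi>s] comps_append[OF list_all2_lengthD[OF match] \<beta>ss] by simp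
  ultimately show ?thesis
    using ccomp_assoc[OF c1 c2 all] out tight by (simp add: o_def)
qed

lemma ccomp_cids:
  "\<lbrakk>\<phi> \<in> Cell X; src X \<phi> = ps; tdom X (lft X \<phi>) = A\<rbrakk> \<Longrightarrow> ccomp X \<phi> (tid X A) (map (cid X) ps) = \<phi>"
  using ccomp_cid_right by auto

section \<open>Composites with one 2-cell, two 2-cells or none\<close>

abbreviation pcomp :: "'c \<Rightarrow> 'c list \<Rightarrow> 'c" (infixl "\<diamondop>" 75) where
  "\<psi> \<diamondop> \<phi>s \<equiv> vcomp X \<psi> \<phi>s"

lemma vcomp1_frame [simp]:
  assumes "\<psi> \<in> Cell X" "\<alpha> \<in> Cell X" "src X \<psi> = [tgt X \<alpha>]"
  shows "\<psi> \<diamondop> [\<alpha>] \<in> Cell X" "src X (\<psi> \<diamondop> [\<alpha>]) = src X \<alpha>" "tgt X (\<psi> \<diamondop> [\<alpha>]) = tgt X \<psi>"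
    "lft X (\<psi> \<diamondop> [\<alpha>]) = lft X \<psi> \<bullet> lft X \<alpha>" "rgt X (\<psi> \<diamondop> [\<alpha>]) = rgt X \<psi> \<bullet> rgt X \<alpha>"
    "composable X \<psi> (lft X \<alpha>) [\<alpha>] (rgt X \<alpha>)"
proof -
  show c: "composable X \<psi> (lft X \<alpha>) [\<alpha>] (rgt X \<alpha>)"
    using assms cell_chain[OF assms(1)] by (auto simp: composable_def)
  show "\<psi> \<diamondop> [\<alpha>] \<in> Cell X" "src X (\<psi> \<diamondop> [\<alpha>]) = src X \<alpha>" "tgt X (\<psi> \<diamondop> [\<alpha>]) = tgt X \<psi>"
    "lft X (\<psi> \<diamondop> [\<alpha>]) = lft X \<psi> \<bullet> lft X \<alpha>" "rgt X (\<psi> \<diamondop> [\<alpha>]) = rgt X \<psi> \<bullet> rgt X \<alpha>"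
    using ccomp[OF c] by (auto simp: vcomp_def)
qed

lemma vcomp2_frame [simp]:
  assumes "\<psi> \<in> Cell X" "\<alpha> \<in> Cell X" "\<beta> \<in> Cell X" "src X \<psi> = [tgt X \<alpha>, tgt X \<beta>]" "lft X \<beta> = rgt X \<alpha>"
  shows "\<psi> \<diamondop> [\<alpha>, \<beta>] \<in> Cell X" "src X (\<psi> \<diamondop> [\<alpha>, \<beta>]) = src X \<alpha> @ src X \<beta>"
    "tgt X (\<psi> \<diamondop> [\<alpha>, \<beta>]) = tgt X \<psi>"
    "lft X (\<psi> \<diamondop> [\<alpha>, \<beta>]) = lft X \<psi> \<bullet> lft X \<alpha>" "rgt X (\<psi> \<diamondop> [\<alpha>, \<beta>]) = rgt X \<psi> \<bullet> rgt X \<beta>"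
    "composable X \<psi> (lft X \<alpha>) [\<alpha>, \<beta>] (rgt X \<beta>)"
proof -
  show c: "composable X \<psi> (lft X \<alpha>) [\<alpha>, \<beta>] (rgt X \<beta>)"
    using assms cell_chain[OF assms(1)] by (auto simp: composable_def)
  show "\<psi> \<diamondop> [\<alpha>, \<beta>] \<in> Cell X" "src X (\<psi> \<diamondop> [\<alpha>, \<beta>]) = src X \<alpha> @ src X \<beta>"
    "tgt X (\<psi> \<diamondop> [\<alpha>, \<beta>]) = tgt X \<psi>"
    "lft X (\<psi> \<diamondop> [\<alpha>, \<beta>]) = lft X \<psi> \<bullet> lft X \<alpha>" "rgt X (\<psi> \<diamondop> [\<alpha>, \<beta>]) = rgt X \<psi> \<bullet> rgt X \<beta>"
    using ccomp[OF c] by (auto simp: vcomp_def)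
qed

lemma ccomp_nil_frame [simp]:
  assumes "\<psi> \<in> Cell X" "src X \<psi> = []" "f \<in> Tight X" "tcod X f = tdom X (lft X \<psi>)"
  shows "ccomp X \<psi> f [] \<in> Cell X" "src X (ccomp X \<psi> f []) = []" "tgt X (ccomp X \<psi> f []) = tgt X \<psi>"
    "lft X (ccomp X \<psi> f []) = lft X \<psi> \<bullet> f" "rgt X (ccomp X \<psi> f []) = rgt X \<psi> \<bullet> f"
    "composable X \<psi> f [] f"
proof -
  show c: "composable X \<psi> f [] f"
    using assms by (auto simp: composable_def)
  show "ccomp X \<psi> f [] \<in> Cell X" "src X (ccomp X \<psi> f []) = []" "tgt X (ccomp X \<psi> f []) = tgt X \<psi>"
    "lft X (ccomp X \<psi> f []) = lft X \<psi> \<bullet> f" "rgt X (ccomp X \<psi> f []) = rgt X \<psi> \<bullet> f"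
    using ccomp[OF c] by auto
qed

text \<open>The tight-cell \<open>h\<close> is explicit because \<open>\<phi>s\<close> may be empty,
  a case that \<open>vcomp\<close> cannot express.\<close>

lemma ccomp_vcomp1:
  assumes "\<psi> \<in> Cell X" "\<alpha> \<in> Cell X" "src X \<psi> = [tgt X \<alpha>]"
    and "juxtaposable X h \<phi>s k" "map (tgt X) \<phi>s = src X \<alpha>" "tcod X h = tdom X (lft X \<alpha>)"
  shows "ccomp X (\<psi> \<diamondop> [\<alpha>]) h \<phi>s = ccomp X \<psi> (lft X \<alpha> \<bullet> h) [ccomp X \<alpha> h \<phi>s]"
proof -
  have "tdom X (lft X \<psi>) = tcod X (lft X \<alpha>)"
    using assms cell_chain[OF assms(1)] by auto
  then have "composable X (\<psi> \<diamondop> [\<alpha>]) h (concat [\<phi>s]) k"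
    using assms by (simp add: composable_def)
  from ccomp_assoc[OF vcomp1_frame(6)[OF assms(1-3)], unfolded vcomp_def, OF this[unfolded vcomp_def list.sel]]
  show ?thesis using assms by (simp add: vcomp_def)
qed

lemma ccomp_vcomp2:
  assumes "\<psi> \<in> Cell X" "\<alpha> \<in> Cell X" "\<beta> \<in> Cell X" "src X \<psi> = [tgt X \<alpha>, tgt X \<beta>]" "lft X \<beta> = rgt X \<alpha>"
    and "juxtaposable X h \<phi>s k" "map (tgt X) \<phi>s = src X \<alpha>" "tcod X h = tdom X (lft X \<alpha>)"
    and "juxtaposable X k \<phi>s' k'" "map (tgt X) \<phi>s' = src X \<beta>"
  shows "ccomp X (\<psi> \<diamondop> [\<alpha>, \<beta>]) h (\<phi>s @ \<phi>s') =
    ccomp X \<psi> (lft X \<alpha> \<bullet> h) [ccomp X \<alpha> h \<phi>s, ccomp X \<beta> k \<phi>s']"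
proof -
  have "tdom X (lft X \<psi>) = tcod X (lft X \<alpha>)"
    using assms cell_chain[OF assms(1)] by auto
  then have "composable X (\<psi> \<diamondop> [\<alpha>, \<beta>]) h (concat [\<phi>s, \<phi>s']) k'"
    using assms by (auto simp add: composable_def juxtaposable_append)
  from ccomp_assoc[OF vcomp2_frame(6)[OF assms(1-5)], unfolded vcomp_def, OF this[unfolded vcomp_def list.sel]]
  show ?thesis using assms juxtaposable_end[OF assms(6)] by (simp add: vcomp_def)
qed

lemma ccomp_frame_hd:
  "\<psi> \<in> Cell X \<Longrightarrow> src X \<psi> = p # ps \<Longrightarrow> tdom X (lft X \<psi>) = lcod X p"
  using cell_chain[of \<psi>] by simp

lemma tdom_rgt:
  "\<psi> \<in> Cell X \<Longrightarrow> src X \<psi> = ps @ [p] \<Longrightarrow> tdom X (rgt X \<psi>) = ldom X p"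
  using cell_chain[of \<psi>] by (auto simp: chain_append)

lemma vcomp_assoc1:
  assumes "\<psi> \<in> Cell X" "\<alpha> \<in> Cell X" "\<phi> \<in> Cell X" "src X \<psi> = [tgt X \<alpha>]" "src X \<alpha> = [tgt X \<phi>]"
  shows "\<psi> \<diamondop> [\<alpha>] \<diamondop> [\<phi>] = \<psi> \<diamondop> [\<alpha> \<diamondop> [\<phi>]]"
  using ccomp_vcomp1[of \<psi> \<alpha> "lft X \<phi>" "[\<phi>]" "rgt X \<phi>"] assms ccomp_frame_hd[of \<alpha>]
  by (simp add: vcomp_def[of X _ "[\<alpha> \<diamondop> [\<phi>]]"]) (simp add: vcomp_def)

lemma vcomp_assoc12:
  assumes "\<psi> \<in> Cell X" "\<alpha> \<in> Cell X" "\<phi> \<in> Cell X" "\<phi>' \<in> Cell X" "src X \<psi> = [tgt X \<alpha>]"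
    "src X \<alpha> = [tgt X \<phi>, tgt X \<phi>']" "lft X \<phi>' = rgt X \<phi>"
  shows "\<psi> \<diamondop> [\<alpha>] \<diamondop> [\<phi>, \<phi>'] = \<psi> \<diamondop> [\<alpha> \<diamondop> [\<phi>, \<phi>']]"
  using ccomp_vcomp1[of \<psi> \<alpha> "lft X \<phi>" "[\<phi>, \<phi>']" "rgt X \<phi>'"] assms ccomp_frame_hd[of \<alpha>]
  by (simp add: vcomp_def[of X _ "[\<alpha> \<diamondop> [\<phi>, \<phi>']]"]) (simp add: vcomp_def)

lemma vcomp_assoc2:
  assumes "\<psi> \<in> Cell X" "\<alpha> \<in> Cell X" "\<beta> \<in> Cell X" "src X \<psi> = [tgt X \<alpha>, tgt X \<beta>]" "lft X \<beta> = rgt X \<alpha>"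
    and "\<phi> \<in> Cell X" "src X \<alpha> = [tgt X \<phi>]" "\<phi>' \<in> Cell X" "src X \<beta> = [tgt X \<phi>']" "lft X \<phi>' = rgt X \<phi>"
  shows "\<psi> \<diamondop> [\<alpha>, \<beta>] \<diamondop> [\<phi>, \<phi>'] = \<psi> \<diamondop> [\<alpha> \<diamondop> [\<phi>], \<beta> \<diamondop> [\<phi>']]"
  using ccomp_vcomp2[of \<psi> \<alpha> \<beta> "lft X \<phi>" "[\<phi>]" "rgt X \<phi>" "[\<phi>']" "rgt X \<phi>'"] assms ccomp_frame_hd[of \<alpha>]
  by (simp add: vcomp_def[of X _ "[\<alpha> \<diamondop> [\<phi>], \<beta> \<diamondop> [\<phi>']]"]) (simp add: vcomp_def)

lemma vcomp_cid_left [simp]: "\<phi> \<in> Cell X \<Longrightarrow> tgt X \<phi> = q \<Longrightarrow> cid X q \<diamondop> [\<phi>] = \<phi>"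
  using ccomp_cid_left by (auto simp: vcomp_def)

lemma vcomp_cid_right [simp]: "\<phi> \<in> Cell X \<Longrightarrow> src X \<phi> = [p] \<Longrightarrow> \<phi> \<diamondop> [cid X p] = \<phi>"
  using ccomp_cid_right[of \<phi>] cell_chain[of \<phi>] by (simp add: vcomp_def)

lemma vcomp_cid_right2 [simp]:
  "\<phi> \<in> Cell X \<Longrightarrow> src X \<phi> = [p, q] \<Longrightarrow> \<phi> \<diamondop> [cid X p, cid X q] = \<phi>"
  using ccomp_cid_right[of \<phi>] cell_chain[of \<phi>] by (simp add: vcomp_def)

lemma ccomp_cid [simp]:
  "\<phi> \<in> Cell X \<Longrightarrow> tgt X \<phi> = q \<Longrightarrow> lft X \<phi> = f \<Longrightarrow> ccomp X (cid X q) f [\<phi>] = \<phi>"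
  using ccomp_cid_left by auto

lemma ccomp_tid [simp]:
  "\<phi> \<in> Cell X \<Longrightarrow> src X \<phi> = [] \<Longrightarrow> tdom X (lft X \<phi>) = A \<Longrightarrow> ccomp X \<phi> (tid X A) [] = \<phi>"
  using ccomp_cid_right[of \<phi>] by auto

end

section \<open>Universal properties\<close>

context virtual_double_category
begin

text \<open>Factoring through an opcartesian 2-cell means composing with it between identities on
  both flanks; this is the associativity law for such composites.\<close>

lemma ccomp_whisker_cid:
  assumes \<chi>: "\<chi> \<in> Cell X" "src X \<chi> = ps @ map (tgt X) \<alpha>s @ rs" "tdom X (lft X \<chi>) = A"
    and ps: "chain X A ps A'" and rs: "chain X B' rs B"
    and \<beta>ss: "juxtaposable X (tid X A') (concat \<beta>ss) (tid X B')"
    and \<alpha>s: "juxtaposable X (tid X A') \<alpha>s (tid X B')"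
    and match: "list_all2 (\<lambda>\<alpha> \<beta>s. map (tgt X) \<beta>s = src X \<alpha>) \<alpha>s \<beta>ss"
  shows "ccomp X (ccomp X \<chi> (tid X A) (map (cid X) ps @ \<alpha>s @ map (cid X) rs))
      (tid X A) (map (cid X) ps @ concat \<beta>ss @ map (cid X) rs) =
    ccomp X \<chi> (tid X A) (map (cid X) ps @ comps X (tid X A') \<alpha>s \<beta>ss @ map (cid X) rs)"
proof -
  have tgt: "map (tgt X) (map (cid X) ps) = ps" "map (tgt X) (map (cid X) rs) = rs"
    using chain_Loose[OF ps] chain_Loose[OF rs] by (auto intro: map_idI)
  show ?thesis
    using ccomp_whisker[of \<chi> "map (cid X) ps" \<alpha>s "map (cid X) rs" "tid X A" "tid X A'" \<beta>ss "tid X B'" "tid X B"]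
      assms juxtaposable_cid[OF ps] juxtaposable_cid[OF rs] chain_Obj[OF ps] chain_Obj[OF rs]
    by (simp only: tgt) (simp add: tight_simps)
qed

lemma ccomp_whisker_frame:
  assumes \<chi>: "\<chi> \<in> Cell X" "src X \<chi> = ps @ map (tgt X) \<alpha>s @ rs" "tdom X (lft X \<chi>) = A" "tdom X (rgt X \<chi>) = B"
    and ps: "chain X A ps A'" and rs: "chain X B' rs B"
    and \<alpha>s: "juxtaposable X (tid X A') \<alpha>s (tid X B')"
  defines "\<xi> \<equiv> ccomp X \<chi> (tid X A) (map (cid X) ps @ \<alpha>s @ map (cid X) rs)"
  shows "\<xi> \<in> Cell X" "src X \<xi> = ps @ concat (map (src X) \<alpha>s) @ rs" "tgt X \<xi> = tgt X \<chi>"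
    "lft X \<xi> = lft X \<chi>" "rgt X \<xi> = rgt X \<chi>"
proof -
  have loose: "p \<in> Loose X" if "p \<in> set ps \<union> set rs" for p
    using that chain_Loose[OF ps] chain_Loose[OF rs] by auto
  have tgt: "map (tgt X) (map (cid X) ps) = ps" "map (tgt X) (map (cid X) rs) = rs"
    using loose by (auto intro: map_idI)
  have "concat (map (src X) (map (cid X) ps)) = ps" if "set ps \<subseteq> Loose X" for ps
    using that by (induction ps) auto
  then have src: "concat (map (src X) (map (cid X) ps)) = ps" "concat (map (src X) (map (cid X) rs)) = rs"
    using loose by (simp_all add: subset_iff)
  have "A \<in> Obj X" using chain_Obj[OF ps] by simp
  then have c: "composable X \<chi> (tid X A) (map (cid X) ps @ \<alpha>s @ map (cid X) rs) (tid X B)"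
    unfolding composable_def juxtaposable_append
    using \<chi> tgt juxtaposable_cid[OF ps] juxtaposable_cid[OF rs] \<alpha>s by (auto simp del: map_map)
  show "\<xi> \<in> Cell X" "src X \<xi> = ps @ concat (map (src X) \<alpha>s) @ rs" "tgt X \<xi> = tgt X \<chi>"
    "lft X \<xi> = lft X \<chi>" "rgt X \<xi> = rgt X \<chi>"
    unfolding \<xi>_def using ccomp[OF c] \<chi> src by (auto simp del: map_map)
qed

lemma opcart_frame:
  assumes "opcartesian X \<psi>"
  shows "\<psi> \<in> Cell X" "lft X \<psi> = tid X (lcod X (tgt X \<psi>))" "rgt X \<psi> = tid X (ldom X (tgt X \<psi>))"
proof -
  have "\<psi> \<in> cells X (src X \<psi>) (tgt X \<psi>)"
    using assms unfolding opcartesian_def by blast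
  note f = cellsD[OF this]
  show "\<psi> \<in> Cell X" "lft X \<psi> = tid X (lcod X (tgt X \<psi>))" "rgt X \<psi> = tid X (ldom X (tgt X \<psi>))"
    by (rule f(1,4,5))+
qed

text \<open>The descriptions of an end object by \<open>tgt X \<psi>\<close> and by
  \<open>lft X \<psi>\<close> refer to each other; naming the objects breaks this circle.\<close>

lemma opcart_objects:
  assumes "opcartesian X \<psi>"
  obtains A B where "A \<in> Obj X" "B \<in> Obj X" "lcod X (tgt X \<psi>) = A" "ldom X (tgt X \<psi>) = B"
    "lft X \<psi> = tid X A" "rgt X \<psi> = tid X B"
proof
  note f = opcart_frame[OF assms]
  show "lft X \<psi> = tid X (lcod X (tgt X \<psi>))" "rgt X \<psi> = tid X (ldom X (tgt X \<psi>))" by fact+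
  show "lcod X (tgt X \<psi>) \<in> Obj X" "ldom X (tgt X \<psi>) \<in> Obj X"
    using f(1) ldom_closed lcod_closed cell_simps(3) by blast+
qed (rule refl)+

lemma opcart_ex1:
  assumes "opcartesian X \<psi>" "\<chi> \<in> Cell X" "src X \<chi> = ps @ src X \<psi> @ rs"
    "chain X (tdom X (lft X \<chi>)) ps (lcod X (tgt X \<psi>))"
    "chain X (ldom X (tgt X \<psi>)) rs (tdom X (rgt X \<chi>))"
  shows "\<exists>!\<chi>'. opcart_factor X \<psi> ps rs \<chi> \<chi>'"
  using assms unfolding opcartesian_def by blast

lemma opcart_desc:
  assumes "opcartesian X \<psi>" "\<chi> \<in> Cell X" "src X \<chi> = ps @ src X \<psi> @ rs"
    "chain X (tdom X (lft X \<chi>)) ps (lcod X (tgt X \<psi>))"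
    "chain X (ldom X (tgt X \<psi>)) rs (tdom X (rgt X \<chi>))"
  shows "opcart_factor X \<psi> ps rs \<chi> (desc X \<psi> ps rs \<chi>)"
  unfolding desc_def by (rule theI'[OF opcart_ex1[OF assms]])

text \<open>If \<open>src X \<psi>\<close> is empty, the frame of \<open>\<chi>\<close> does not
  show where \<open>ps\<close> and \<open>rs\<close> meet. The chain conditions demanded by
  \<open>opcartesian\<close> are therefore read off from the frame of
  \<open>\<alpha>\<close>.\<close>

lemma opcart_ccomp_frame:
  assumes \<psi>: "opcartesian X \<psi>" and \<alpha>: "\<alpha> \<in> Cell X" "src X \<alpha> = ps @ tgt X \<psi> # rs" "tdom X (lft X \<alpha>) = A"
  defines "\<chi> \<equiv> ccomp X \<alpha> (tid X A) (map (cid X) ps @ \<psi> # map (cid X) rs)"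
  shows "\<chi> \<in> Cell X" "src X \<chi> = ps @ src X \<psi> @ rs" "tgt X \<chi> = tgt X \<alpha>"
    "lft X \<chi> = lft X \<alpha>" "rgt X \<chi> = rgt X \<alpha>"
    "chain X A ps (lcod X (tgt X \<psi>))" "chain X (ldom X (tgt X \<psi>)) rs (tdom X (rgt X \<alpha>))"
proof -
  note f = opcart_frame[OF \<psi>]
  have ch: "chain X A ps (lcod X (tgt X \<psi>))" "chain X (ldom X (tgt X \<psi>)) rs (tdom X (rgt X \<alpha>))"
    using cell_chain[OF \<alpha>(1)] \<alpha> by (auto simp: chain_append)
  obtain B B' where B: "B \<in> Obj X" "B' \<in> Obj X" "lcod X (tgt X \<psi>) = B" "ldom X (tgt X \<psi>) = B'"
    "lft X \<psi> = tid X B" "rgt X \<psi> = tid X B'"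
    by (rule opcart_objects[OF \<psi>])
  have "juxtaposable X (tid X (lcod X (tgt X \<psi>))) [\<psi>] (tid X (ldom X (tgt X \<psi>)))"
    using B f(1) by simp
  from ccomp_whisker_frame[OF \<alpha>(1) _ \<alpha>(3) refl ch this]
  show "\<chi> \<in> Cell X" "src X \<chi> = ps @ src X \<psi> @ rs" "tgt X \<chi> = tgt X \<alpha>"
    "lft X \<chi> = lft X \<alpha>" "rgt X \<chi> = rgt X \<alpha>"
    unfolding \<chi>_def using \<alpha> by simp_all
  show "chain X A ps (lcod X (tgt X \<psi>))" "chain X (ldom X (tgt X \<psi>)) rs (tdom X (rgt X \<alpha>))"
    by (rule ch)+
qed

text \<open>Both 2-cells are factorisations of one and the same composite, so uniqueness identifies
  them.\<close>

lemma opcart_cancel: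
  assumes "opcartesian X \<psi>" "\<alpha> \<in> Cell X" "src X \<alpha> = ps @ tgt X \<psi> # rs" "tdom X (lft X \<alpha>) = A"
    "\<beta> \<in> Cell X" "src X \<beta> = ps @ tgt X \<psi> # rs" "tgt X \<beta> = tgt X \<alpha>" "lft X \<beta> = lft X \<alpha>" "rgt X \<beta> = rgt X \<alpha>"
    "ccomp X \<alpha> (tid X A) (map (cid X) ps @ \<psi> # map (cid X) rs) =
      ccomp X \<beta> (tid X A) (map (cid X) ps @ \<psi> # map (cid X) rs)"
  shows "\<alpha> = \<beta>"
proof -
  define \<chi> where "\<chi> = ccomp X \<alpha> (tid X A) (map (cid X) ps @ \<psi> # map (cid X) rs)"
  have "\<exists>!\<chi>'. opcart_factor X \<psi> ps rs \<chi> \<chi>'"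
    using opcart_ccomp_frame[OF assms(1-4)] assms(4) unfolding \<chi>_def
    by (intro opcart_ex1[OF assms(1)]) simp_all
  moreover have "opcart_factor X \<psi> ps rs \<chi> \<alpha>" "opcart_factor X \<psi> ps rs \<chi> \<beta>"
    using opcart_ccomp_frame[OF assms(1-4)] assms unfolding opcart_factor_def \<chi>_def by auto
  ultimately show ?thesis by blast
qed

lemma opcart_cancel1:
  assumes "opcartesian X \<psi>" "\<alpha> \<in> Cell X" "src X \<alpha> = [tgt X \<psi>]"
    "\<beta> \<in> Cell X" "src X \<beta> = [tgt X \<psi>]" "tgt X \<beta> = tgt X \<alpha>" "lft X \<beta> = lft X \<alpha>" "rgt X \<beta> = rgt X \<alpha>"
    "\<alpha> \<diamondop> [\<psi>] = \<beta> \<diamondop> [\<psi>]"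
  shows "\<alpha> = \<beta>"
proof -
  obtain A where "A \<in> Obj X" "lcod X (tgt X \<psi>) = A" "lft X \<psi> = tid X A"
    by (rule opcart_objects[OF assms(1)])
  then show ?thesis
    using opcart_cancel[OF assms(1,2), of "[]" "[]" _ \<beta>] assms ccomp_frame_hd[of \<alpha>]
    by (simp add: vcomp_def)
qed

lemma opcart_cancel_left:
  assumes "opcartesian X \<psi>" "\<alpha> \<in> Cell X" "src X \<alpha> = [tgt X \<psi>, p]"
    "\<beta> \<in> Cell X" "src X \<beta> = [tgt X \<psi>, p]" "tgt X \<beta> = tgt X \<alpha>" "lft X \<beta> = lft X \<alpha>" "rgt X \<beta> = rgt X \<alpha>"
    "\<alpha> \<diamondop> [\<psi>, cid X p] = \<beta> \<diamondop> [\<psi>, cid X p]"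
  shows "\<alpha> = \<beta>"
proof -
  obtain A where "A \<in> Obj X" "lcod X (tgt X \<psi>) = A" "lft X \<psi> = tid X A"
    by (rule opcart_objects[OF assms(1)])
  then show ?thesis
    using opcart_cancel[OF assms(1,2), of "[]" "[p]" _ \<beta>] assms ccomp_frame_hd[of \<alpha>]
    by (simp add: vcomp_def)
qed

lemma opcart_cancel_right:
  assumes "opcartesian X \<psi>" "\<alpha> \<in> Cell X" "src X \<alpha> = [p, tgt X \<psi>]"
    "\<beta> \<in> Cell X" "src X \<beta> = [p, tgt X \<psi>]" "tgt X \<beta> = tgt X \<alpha>" "lft X \<beta> = lft X \<alpha>" "rgt X \<beta> = rgt X \<alpha>"
    "\<alpha> \<diamondop> [cid X p, \<psi>] = \<beta> \<diamondop> [cid X p, \<psi>]"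
  shows "\<alpha> = \<beta>"
  using opcart_cancel[OF assms(1,2), of "[p]" "[]" _ \<beta>] assms ccomp_frame_hd[of \<alpha>] cell_chain[OF assms(2)]
  by (simp add: vcomp_def)

lemma opcart_desc1:
  assumes m: "opcartesian X m" and \<chi>: "\<chi> \<in> Cell X" "src X \<chi> = src X m"
    "lcod X (tgt X m) = tdom X (lft X \<chi>)" "ldom X (tgt X m) = tdom X (rgt X \<chi>)"
  shows "desc X m [] [] \<chi> \<in> Cell X" "src X (desc X m [] [] \<chi>) = [tgt X m]"
    "tgt X (desc X m [] [] \<chi>) = tgt X \<chi>" "lft X (desc X m [] [] \<chi>) = lft X \<chi>"
    "rgt X (desc X m [] [] \<chi>) = rgt X \<chi>" "desc X m [] [] \<chi> \<diamondop> [m] = \<chi>"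
proof -
  have "opcart_factor X m [] [] \<chi> (desc X m [] [] \<chi>)"
    using \<chi> by (intro opcart_desc[OF m]) auto
  then show "desc X m [] [] \<chi> \<in> Cell X" "src X (desc X m [] [] \<chi>) = [tgt X m]"
    "tgt X (desc X m [] [] \<chi>) = tgt X \<chi>" "lft X (desc X m [] [] \<chi>) = lft X \<chi>"
    "rgt X (desc X m [] [] \<chi>) = rgt X \<chi>" "desc X m [] [] \<chi> \<diamondop> [m] = \<chi>"
    unfolding opcart_factor_def vcomp_def list.sel opcart_frame(2)[OF m] \<chi>(3) by simp_all
qed

lemma opcart_desc_left:
  assumes m: "opcartesian X m" and \<chi>: "\<chi> \<in> Cell X" "src X \<chi> = src X m @ [p]"
    "lcod X (tgt X m) = tdom X (lft X \<chi>)" "ldom X (tgt X m) = lcod X p"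
  shows "desc X m [] [p] \<chi> \<in> Cell X" "src X (desc X m [] [p] \<chi>) = [tgt X m, p]"
    "tgt X (desc X m [] [p] \<chi>) = tgt X \<chi>" "lft X (desc X m [] [p] \<chi>) = lft X \<chi>"
    "rgt X (desc X m [] [p] \<chi>) = rgt X \<chi>" "desc X m [] [p] \<chi> \<diamondop> [m, cid X p] = \<chi>"
proof -
  have "opcart_factor X m [] [p] \<chi> (desc X m [] [p] \<chi>)"
    using \<chi> cell_chain[OF \<chi>(1)] by (intro opcart_desc[OF m]) (auto simp: chain_append)
  then show "desc X m [] [p] \<chi> \<in> Cell X" "src X (desc X m [] [p] \<chi>) = [tgt X m, p]"
    "tgt X (desc X m [] [p] \<chi>) = tgt X \<chi>" "lft X (desc X m [] [p] \<chi>) = lft X \<chi>"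
    "rgt X (desc X m [] [p] \<chi>) = rgt X \<chi>" "desc X m [] [p] \<chi> \<diamondop> [m, cid X p] = \<chi>"
    unfolding opcart_factor_def vcomp_def list.sel opcart_frame(2)[OF m] \<chi>(3) by simp_all
qed

lemma opcart_desc_right:
  assumes m: "opcartesian X m" and \<chi>: "\<chi> \<in> Cell X" "src X \<chi> = p # src X m"
    "lcod X (tgt X m) = ldom X p" "ldom X (tgt X m) = tdom X (rgt X \<chi>)"
  shows "desc X m [p] [] \<chi> \<in> Cell X" "src X (desc X m [p] [] \<chi>) = [p, tgt X m]"
    "tgt X (desc X m [p] [] \<chi>) = tgt X \<chi>" "lft X (desc X m [p] [] \<chi>) = lft X \<chi>"
    "rgt X (desc X m [p] [] \<chi>) = rgt X \<chi>" "desc X m [p] [] \<chi> \<diamondop> [cid X p, m] = \<chi>"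
proof -
  have ch: "p \<in> Loose X" "lcod X p = tdom X (lft X \<chi>)"
    using cell_chain[OF \<chi>(1)] \<chi> by simp_all
  then have "opcart_factor X m [p] [] \<chi> (desc X m [p] [] \<chi>)"
    using \<chi> by (intro opcart_desc[OF m]) auto
  then show "desc X m [p] [] \<chi> \<in> Cell X" "src X (desc X m [p] [] \<chi>) = [p, tgt X m]"
    "tgt X (desc X m [p] [] \<chi>) = tgt X \<chi>" "lft X (desc X m [p] [] \<chi>) = lft X \<chi>"
    "rgt X (desc X m [p] [] \<chi>) = rgt X \<chi>" "desc X m [p] [] \<chi> \<diamondop> [cid X p, m] = \<chi>"
    unfolding opcart_factor_def using ch by (simp_all add: vcomp_def)
qed

section \<open>Factorisation through cartesian 2-cells\<close>

lemma cart_lift: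
  assumes "cartesian X c" "\<chi> \<in> Cell X" "tgt X \<chi> = tgt X c" "f' \<in> Tight X" "g' \<in> Tight X"
    "tcod X f' = tdom X (lft X c)" "tcod X g' = tdom X (rgt X c)"
    "lft X \<chi> = lft X c \<bullet> f'" "rgt X \<chi> = rgt X c \<bullet> g'"
  shows "lift X c f' g' \<chi> \<in> Cell X" "src X (lift X c f' g' \<chi>) = src X \<chi>"
    "tgt X (lift X c f' g' \<chi>) = hd (src X c)"
    "lft X (lift X c f' g' \<chi>) = f'" "rgt X (lift X c f' g' \<chi>) = g'"
    "c \<diamondop> [lift X c f' g' \<chi>] = \<chi>"
proof -
  have "\<exists>!\<chi>'. cart_factor X c f' g' \<chi> \<chi>'"
    using assms by (auto simp: cartesian_def)
  from theI'[OF this] show "lift X c f' g' \<chi> \<in> Cell X" "src X (lift X c f' g' \<chi>) = src X \<chi>"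
    "tgt X (lift X c f' g' \<chi>) = hd (src X c)"
    "lft X (lift X c f' g' \<chi>) = f'" "rgt X (lift X c f' g' \<chi>) = g'"
    "c \<diamondop> [lift X c f' g' \<chi>] = \<chi>"
    by (auto simp: lift_def cart_factor_def vcomp_def dest: arg_cong[of "[_]" _ hd])
qed

lemma cart_cancel:
  assumes "cartesian X c" "\<alpha> \<in> Cell X" "src X c = [tgt X \<alpha>]"
    "\<beta> \<in> Cell X" "tgt X \<beta> = tgt X \<alpha>" "lft X \<beta> = lft X \<alpha>" "rgt X \<beta> = rgt X \<alpha>"
    "c \<diamondop> [\<alpha>] = c \<diamondop> [\<beta>]"
  shows "\<alpha> = \<beta>"
proof -
  define \<chi> where "\<chi> = c \<diamondop> [\<alpha>]"
  have c: "c \<in> Cell X" using assms(1) by (simp add: cartesian_def)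
  note f = vcomp1_frame[OF c assms(2,3)] vcomp1_frame[OF c assms(4), unfolded assms(5,3)]
  have ch: "tdom X (lft X c) = tcod X (lft X \<alpha>)" "tdom X (rgt X c) = tcod X (rgt X \<alpha>)"
    using cell_chain[OF c] assms by auto
  have "\<exists>!\<chi>'. cart_factor X c (lft X \<alpha>) (rgt X \<alpha>) \<chi> \<chi>'"
    using assms f ch unfolding \<chi>_def cartesian_def by simp
  moreover have "cart_factor X c (lft X \<alpha>) (rgt X \<alpha>) \<chi> \<alpha>" "cart_factor X c (lft X \<alpha>) (rgt X \<alpha>) \<chi> \<beta>"
    using assms f ch unfolding cart_factor_def \<chi>_def by (auto simp: vcomp_def)
  ultimately show ?thesis by blast
qed

lemma cart_glift:
  assumes "cartesian X c" "\<chi> \<in> Cell X" "tgt X \<chi> = tgt X c" "lft X \<chi> = lft X c" "rgt X \<chi> = rgt X c"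
  shows "glift X c \<chi> \<in> Cell X" "src X (glift X c \<chi>) = src X \<chi>"
    "tgt X (glift X c \<chi>) = hd (src X c)"
    "lft X (glift X c \<chi>) = tid X (tdom X (lft X c))" "rgt X (glift X c \<chi>) = tid X (tdom X (rgt X c))"
    "c \<diamondop> [glift X c \<chi>] = \<chi>"
proof -
  have "c \<in> Cell X" using assms(1) by (simp add: cartesian_def)
  then show "glift X c \<chi> \<in> Cell X" "src X (glift X c \<chi>) = src X \<chi>"
    "tgt X (glift X c \<chi>) = hd (src X c)"
    "lft X (glift X c \<chi>) = tid X (tdom X (lft X c))" "rgt X (glift X c \<chi>) = tid X (tdom X (rgt X c))"
    "c \<diamondop> [glift X c \<chi>] = \<chi>"
    unfolding glift_def using assms by (auto intro!: cart_lift)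
qed

end

section \<open>The calculus of 2-cells into loose-identities\<close>

context virtual_equipment
begin

lemma lid_simps [simp]:
  assumes "A \<in> Obj X"
  shows "lid X A \<in> Loose X" "lcod X (lid X A) = A" "ldom X (lid X A) = A"
    "lidc X A \<in> Cell X" "src X (lidc X A) = []" "tgt X (lidc X A) = lid X A"
    "lft X (lidc X A) = tid X A" "rgt X (lidc X A) = tid X A" "opcartesian X (lidc X A)"
proof -
  note li = loose_identity[OF assms]
  then have "lidc X A \<in> cells X [] (lid X A)" by blast
  note f = cellsD[OF this]
  show "lcod X (lid X A) = A" "ldom X (lid X A) = A" "opcartesian X (lidc X A)"
    "lidc X A \<in> Cell X" "src X (lidc X A) = []" "tgt X (lidc X A) = lid X A"
    "lft X (lidc X A) = tid X A" "rgt X (lidc X A) = tid X A"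
    using li f by auto
  show "lid X A \<in> Loose X"
    using cell_simps(3)[OF f(1)] f(3) by simp
qed

lemma form_cod:
  assumes "\<alpha> \<in> Cell X" "tgt X \<alpha> = lid X B" "B \<in> Obj X"
  shows "tcod X (lft X \<alpha>) = B" "tcod X (rgt X \<alpha>) = B"
  using cell_simps(4,5)[OF assms(1)] assms by auto

text \<open>The identity of \<open>f\<close>, as a nullary 2-cell into the loose-identity of its
  codomain. It is neutral for pasting.\<close>

definition unitc :: "'t \<Rightarrow> 'c" where
  "unitc f = ccomp X (lidc X (tcod X f)) f []"

lemma unitc_frame [simp]:
  assumes "f \<in> Tight X"
  shows "unitc f \<in> Cell X" "src X (unitc f) = []" "tgt X (unitc f) = lid X (tcod X f)"
    "lft X (unitc f) = f" "rgt X (unitc f) = f"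
  using assms by (simp_all add: unitc_def)

text \<open>The action of \<open>g\<close> on loose-identities,
  \<open>A(1, 1) \<Rightarrow> B(1, 1)\<close> with both tight-cells \<open>g\<close>. Composing a
  2-cell into \<open>A(1, 1)\<close> with it is whiskering by \<open>g\<close>, written
  \<open>r(-)\<close> in the overview.\<close>

definition tact :: "'t \<Rightarrow> 'c" where
  "tact g = desc X (lidc X (tdom X g)) [] [] (unitc g)"

lemma tact_frame [simp]:
  assumes "g \<in> Tight X"
  shows "tact g \<in> Cell X" "src X (tact g) = [lid X (tdom X g)]" "tgt X (tact g) = lid X (tcod X g)"
    "lft X (tact g) = g" "rgt X (tact g) = g" "tact g \<diamondop> [lidc X (tdom X g)] = unitc g"
proof -
  have "opcart_factor X (lidc X (tdom X g)) [] [] (unitc g) (tact g)"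
    unfolding tact_def using assms by (intro opcart_desc) auto
  then show "tact g \<in> Cell X" "src X (tact g) = [lid X (tdom X g)]" "tgt X (tact g) = lid X (tcod X g)"
    "lft X (tact g) = g" "rgt X (tact g) = g" "tact g \<diamondop> [lidc X (tdom X g)] = unitc g"
    using assms by (auto simp: opcart_factor_def vcomp_def)
qed

lemma runit_frame [simp]:
  assumes "q \<in> Loose X"
  shows "runit X q \<in> Cell X" "src X (runit X q) = [q, lid X (ldom X q)]" "tgt X (runit X q) = q"
    "lft X (runit X q) = tid X (lcod X q)" "rgt X (runit X q) = tid X (ldom X q)"
    "runit X q \<diamondop> [cid X q, lidc X (ldom X q)] = cid X q"
proof -
  have "opcart_factor X (lidc X (ldom X q)) [q] [] (cid X q) (runit X q)"
    unfolding runit_def using assms by (intro opcart_desc) auto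
  then show "runit X q \<in> Cell X" "src X (runit X q) = [q, lid X (ldom X q)]" "tgt X (runit X q) = q"
    "lft X (runit X q) = tid X (lcod X q)" "rgt X (runit X q) = tid X (ldom X q)"
    "runit X q \<diamondop> [cid X q, lidc X (ldom X q)] = cid X q"
    using assms by (auto simp: opcart_factor_def vcomp_def)
qed

lemma lunit_frame [simp]:
  assumes "q \<in> Loose X"
  shows "lunit X q \<in> Cell X" "src X (lunit X q) = [lid X (lcod X q), q]" "tgt X (lunit X q) = q"
    "lft X (lunit X q) = tid X (lcod X q)" "rgt X (lunit X q) = tid X (ldom X q)"
    "lunit X q \<diamondop> [lidc X (lcod X q), cid X q] = cid X q"
proof -
  have "opcart_factor X (lidc X (lcod X q)) [] [q] (cid X q) (lunit X q)"
    unfolding lunit_def using assms by (intro opcart_desc) auto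
  then show "lunit X q \<in> Cell X" "src X (lunit X q) = [lid X (lcod X q), q]" "tgt X (lunit X q) = q"
    "lft X (lunit X q) = tid X (lcod X q)" "rgt X (lunit X q) = tid X (ldom X q)"
    "lunit X q \<diamondop> [lidc X (lcod X q), cid X q] = cid X q"
    using assms by (auto simp: opcart_factor_def vcomp_def)
qed

text \<open>For \<open>\<alpha>\<close> and \<open>\<beta>\<close> into \<open>E(1, 1)\<close> such that the right tight-cell of \<open>\<alpha>\<close> is the left one of \<open>\<beta>\<close>,
  \<open>\<alpha> \<cdot> \<beta>\<close> is their pasting. Every 2-cell into \<open>E(f, g)\<close> is the same as one into \<open>E(1, 1)\<close>, and
  this turns the equations between 2-cells into identities in a category.\<close>

definition mul :: "'c \<Rightarrow> 'c \<Rightarrow> 'c" (infixl "\<cdot>" 72) where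
  "\<alpha> \<cdot> \<beta> = runit X (tgt X \<alpha>) \<diamondop> [\<alpha>, \<beta>]"

text \<open>The mirror of \<open>\<cdot>\<close>: here the left factor ends in a loose-identity and
  the right factor may have any target. Both versions are needed, for \<open>conj_unit\<close> is
  pasted on the left of its restriction and \<open>comp_unit\<close> on the right.\<close>

definition lmul :: "'c \<Rightarrow> 'c \<Rightarrow> 'c" where
  "lmul \<alpha> \<beta> = lunit X (tgt X \<beta>) \<diamondop> [\<alpha>, \<beta>]"

lemma mul_frame [simp]:
  assumes "\<alpha> \<in> Cell X" "\<beta> \<in> Cell X" "tgt X \<beta> = lid X (tcod X (rgt X \<alpha>))" "lft X \<beta> = rgt X \<alpha>"
  shows "\<alpha> \<cdot> \<beta> \<in> Cell X" "src X (\<alpha> \<cdot> \<beta>) = src X \<alpha> @ src X \<beta>" "tgt X (\<alpha> \<cdot> \<beta>) = tgt X \<alpha>"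
    "lft X (\<alpha> \<cdot> \<beta>) = lft X \<alpha>" "rgt X (\<alpha> \<cdot> \<beta>) = rgt X \<beta>"
  using assms form_cod[OF assms(2,3)] by (simp_all add: mul_def)

lemma lmul_frame [simp]:
  assumes "\<alpha> \<in> Cell X" "\<beta> \<in> Cell X" "tgt X \<alpha> = lid X (tcod X (lft X \<beta>))" "lft X \<beta> = rgt X \<alpha>"
  shows "lmul \<alpha> \<beta> \<in> Cell X" "src X (lmul \<alpha> \<beta>) = src X \<alpha> @ src X \<beta>" "tgt X (lmul \<alpha> \<beta>) = tgt X \<beta>"
    "lft X (lmul \<alpha> \<beta>) = lft X \<alpha>" "rgt X (lmul \<alpha> \<beta>) = rgt X \<beta>"
proof -
  have "tcod X (lft X \<beta>) \<in> Obj X" using assms by simp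
  then have "tcod X (lft X \<alpha>) = tcod X (rgt X \<alpha>)"
    using form_cod[OF assms(1,3)] by simp
  then show "lmul \<alpha> \<beta> \<in> Cell X" "src X (lmul \<alpha> \<beta>) = src X \<alpha> @ src X \<beta>" "tgt X (lmul \<alpha> \<beta>) = tgt X \<beta>"
    "lft X (lmul \<alpha> \<beta>) = lft X \<alpha>" "rgt X (lmul \<alpha> \<beta>) = rgt X \<beta>"
    using assms by (simp_all add: lmul_def)
qed

lemma ccomp_mul:
  assumes "\<alpha> \<in> Cell X" "\<beta> \<in> Cell X" "tgt X \<beta> = lid X (tcod X (rgt X \<alpha>))" "lft X \<beta> = rgt X \<alpha>"
    and "juxtaposable X h \<phi>s k" "map (tgt X) \<phi>s = src X \<alpha>" "tcod X h = tdom X (lft X \<alpha>)"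
    and "juxtaposable X k \<phi>s' k'" "map (tgt X) \<phi>s' = src X \<beta>"
  shows "ccomp X (\<alpha> \<cdot> \<beta>) h (\<phi>s @ \<phi>s') = ccomp X \<alpha> h \<phi>s \<cdot> ccomp X \<beta> k \<phi>s'"
proof -
  have c: "composable X \<alpha> h \<phi>s k"
    using assms by (simp add: composable_def)
  show ?thesis
    unfolding mul_def using assms ccomp[OF c]
    by (subst ccomp_vcomp2[where k=k and k'=k']) (simp_all add: vcomp_def)
qed

lemma ccomp_lmul:
  assumes "\<alpha> \<in> Cell X" "\<beta> \<in> Cell X" "tgt X \<alpha> = lid X (tcod X (lft X \<beta>))" "lft X \<beta> = rgt X \<alpha>"
    and "juxtaposable X h \<phi>s k" "map (tgt X) \<phi>s = src X \<alpha>" "tcod X h = tdom X (lft X \<alpha>)"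
    and "juxtaposable X k \<phi>s' k'" "map (tgt X) \<phi>s' = src X \<beta>" "tcod X k = tdom X (lft X \<beta>)"
  shows "ccomp X (lmul \<alpha> \<beta>) h (\<phi>s @ \<phi>s') = lmul (ccomp X \<alpha> h \<phi>s) (ccomp X \<beta> k \<phi>s')"
proof -
  have c: "composable X \<alpha> h \<phi>s k" "composable X \<beta> k \<phi>s' k'"
    using assms by (simp_all add: composable_def)
  show ?thesis
    unfolding lmul_def using assms ccomp[OF c(1)] ccomp[OF c(2)]
    by (subst ccomp_vcomp2[where k=k and k'=k']) (simp_all add: vcomp_def)
qed

lemma mul_vcomp:
  assumes "\<alpha> \<in> Cell X" "\<beta> \<in> Cell X" "tgt X \<beta> = lid X (tcod X (rgt X \<alpha>))" "lft X \<beta> = rgt X \<alpha>"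
    "\<phi> \<in> Cell X" "\<psi> \<in> Cell X" "src X \<alpha> = [tgt X \<phi>]" "src X \<beta> = [tgt X \<psi>]" "lft X \<psi> = rgt X \<phi>"
  shows "(\<alpha> \<cdot> \<beta>) \<diamondop> [\<phi>, \<psi>] = (\<alpha> \<diamondop> [\<phi>]) \<cdot> (\<beta> \<diamondop> [\<psi>])"
  using ccomp_mul[of \<alpha> \<beta> "lft X \<phi>" "[\<phi>]" "rgt X \<phi>" "[\<psi>]" "rgt X \<psi>"] assms ccomp_frame_hd[of \<alpha>]
  by (simp add: vcomp_def)

text \<open>Precomposing the nullary \<open>\<alpha>\<close> would involve the left tight-cell of
  \<open>\<psi>\<close>; the last hypothesis makes this an identity, so that \<open>\<psi>\<close>
  meets only \<open>\<beta>\<close>.\<close>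

lemma mul_vcomp_nil:
  assumes "\<alpha> \<in> Cell X" "\<beta> \<in> Cell X" "tgt X \<beta> = lid X (tcod X (rgt X \<alpha>))" "lft X \<beta> = rgt X \<alpha>"
    "\<psi> \<in> Cell X" "src X \<alpha> = []" "src X \<beta> = [tgt X \<psi>]" "lft X \<psi> = tid X (tdom X (lft X \<alpha>))"
  shows "(\<alpha> \<cdot> \<beta>) \<diamondop> [\<psi>] = \<alpha> \<cdot> (\<beta> \<diamondop> [\<psi>])"
  using ccomp_mul[of \<alpha> \<beta> "lft X \<psi>" "[]" "lft X \<psi>" "[\<psi>]" "rgt X \<psi>"] assms
  by (simp add: vcomp_def)

lemma mul_unit_right [simp]:
  assumes "\<alpha> \<in> Cell X" "rgt X \<alpha> = f"
  shows "\<alpha> \<cdot> unitc f = \<alpha>"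
proof -
  let ?q = "tgt X \<alpha>" and ?B = "tcod X f"
  have f: "f \<in> Tight X" using assms by auto
  have "ccomp X (runit X ?q \<diamondop> [cid X ?q, lidc X ?B]) (lft X \<alpha>) ([\<alpha>] @ []) =
      ccomp X (runit X ?q) (tid X (tcod X (lft X \<alpha>)) \<bullet> lft X \<alpha>) [ccomp X (cid X ?q) (lft X \<alpha>) [\<alpha>], ccomp X (lidc X ?B) f []]"
    using assms f by (subst ccomp_vcomp2[where k=f and k'=f]) auto
  moreover have "runit X ?q \<diamondop> [cid X ?q, lidc X ?B] = cid X ?q"
    using runit_frame(6)[of ?q] assms by simp
  ultimately show ?thesis
    using assms by (simp add: mul_def vcomp_def unitc_def ccomp_cid_left)
qed

lemma lmul_unit_left [simp]:
  assumes "\<beta> \<in> Cell X" "lft X \<beta> = f"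
  shows "lmul (unitc f) \<beta> = \<beta>"
proof -
  let ?q = "tgt X \<beta>" and ?A = "tcod X f"
  have f: "f \<in> Tight X" using assms by auto
  have "ccomp X (lunit X ?q \<diamondop> [lidc X ?A, cid X ?q]) f ([] @ [\<beta>]) =
      ccomp X (lunit X ?q) (tid X ?A \<bullet> f) [ccomp X (lidc X ?A) f [], ccomp X (cid X ?q) f [\<beta>]]"
    using assms f by (subst ccomp_vcomp2[where k=f and k'="rgt X \<beta>"]) auto
  moreover have "lunit X ?q \<diamondop> [lidc X ?A, cid X ?q] = cid X ?q"
    using lunit_frame(6)[of ?q] assms by simp
  ultimately show ?thesis
    using assms f by (auto simp add: lmul_def vcomp_def unitc_def ccomp_cid_left)
qed

lemma unitc_tid: "A \<in> Obj X \<Longrightarrow> unitc (tid X A) = lidc X A"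
  by (simp add: unitc_def)

text \<open>The coincidence of the two unit constraints at the unit. \<open>lunit\<close> is
  characterised by undoing the insertion of \<open>lidc\<close> on the left, and
  \<open>runit\<close> does the same, because pasting \<open>lidc\<close> with itself gives
  \<open>lidc\<close> and \<open>lidc\<close> can be cancelled.\<close>

lemma lunit_lid:
  assumes A: "A \<in> Obj X"
  shows "lunit X (lid X A) = runit X (lid X A)"
proof -
  let ?I = "lid X A" and ?i = "lidc X A"
  have "runit X ?I \<diamondop> [?i, cid X ?I] = cid X ?I"
  proof (rule opcart_cancel1[of ?i])
    have "ccomp X (runit X ?I \<diamondop> [?i, cid X ?I]) (tid X A) ([] @ [?i]) = ?i \<cdot> ?i"
      using A by (subst ccomp_vcomp2[where k="tid X A" and k'="tid X A"]) (simp_all add: mul_def vcomp_def)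
    moreover have "?i \<cdot> ?i = ?i"
      using mul_unit_right[of ?i "tid X A"] A by (simp add: unitc_tid)
    ultimately show "runit X ?I \<diamondop> [?i, cid X ?I] \<diamondop> [?i] = cid X ?I \<diamondop> [?i]"
      using A by (simp add: vcomp_def ccomp_cid_left)
  qed (use A in auto)
  then show ?thesis
    using A lunit_frame(6)[of ?I] by (intro opcart_cancel_left[of ?i "lunit X ?I" ?I "runit X ?I"]) simp_all
qed

lemma lmul_form:
  assumes "\<alpha> \<in> Cell X" "\<beta> \<in> Cell X" "tgt X \<beta> = tgt X \<alpha>" "tgt X \<alpha> = lid X B" "B \<in> Obj X"
  shows "lmul \<alpha> \<beta> = \<alpha> \<cdot> \<beta>"
  using assms by (simp add: lmul_def mul_def lunit_lid)

lemma mul_unit_left [simp]: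
  assumes "\<beta> \<in> Cell X" "lft X \<beta> = f" "tgt X \<beta> = lid X (tcod X f)"
  shows "unitc f \<cdot> \<beta> = \<beta>"
proof -
  have "f \<in> Tight X" using assms by auto
  then show ?thesis using lmul_form[of "unitc f" \<beta> "tcod X f"] assms by simp
qed

lemma tact_tid [simp]:
  assumes "A \<in> Obj X"
  shows "tact (tid X A) = cid X (lid X A)"
  using assms tact_frame(6)[of "tid X A"]
  by (intro opcart_cancel1[of "lidc X A" "tact (tid X A)" "cid X (lid X A)"]) (simp_all add: unitc_tid)

lemma tact_unitc [simp]:
  assumes "f \<in> Tight X" "g \<in> Tight X" "tcod X f = tdom X g"
  shows "tact g \<diamondop> [unitc f] = unitc (g \<bullet> f)"
proof -
  have "ccomp X (tact g \<diamondop> [lidc X (tdom X g)]) f [] = tact g \<diamondop> [unitc f]"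
    using assms by (subst ccomp_vcomp1[where k=f]) (simp_all add: unitc_def vcomp_def)
  moreover have "ccomp X (unitc g) f [] = unitc (g \<bullet> f)"
    using assms unfolding unitc_def
    by (subst ccomp_assoc[where \<phi>ss="[]" and h=f and \<psi>s="[]" and k=f and g=g, simplified])
      (auto simp: composable_def)
  ultimately show ?thesis using assms by simp
qed

text \<open>Inserting \<open>lidc\<close> after \<open>q\<close> reduces both sides to
  \<open>\<chi>\<close>, and \<open>lidc\<close> is opcartesian. Absorbing a loose-identity before
  applying \<open>\<chi>\<close> thus amounts to whiskering it by the right tight-cell of
  \<open>\<chi>\<close> and pasting afterwards; the interchange laws follow from this.\<close>

lemma runit_natural:
  assumes "\<chi> \<in> Cell X" "src X \<chi> = ps @ [q]" "tdom X (lft X \<chi>) = A"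
  shows "ccomp X \<chi> (tid X A) (map (cid X) ps @ [runit X q]) = \<chi> \<cdot> tact (rgt X \<chi>)"
proof -
  let ?B = "ldom X q" and ?l = "ccomp X \<chi> (tid X A) (map (cid X) ps @ [runit X q])"
  have ch: "chain X A ps (lcod X q)" "q \<in> Loose X" "tdom X (rgt X \<chi>) = ?B"
    using cell_chain[OF assms(1)] assms by (auto simp: chain_append)
  have A: "A \<in> Obj X" using assms by auto
  note ids = juxtaposable_cid[OF ch(1)]
  have tgt: "map (tgt X) (map (cid X) ps) = ps"
    using chain_Loose[OF ch(1)] by (auto intro: map_idI)
  note f = ccomp_whisker_frame[of \<chi> ps "[runit X q]" "[]" A ?B "lcod X q" ?B]
  have id_\<chi>: "ccomp X \<chi> (tid X A) (map (cid X) ps @ [cid X q]) = \<chi>"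
    using ccomp_cids[OF assms] by simp
  show ?thesis
  proof (rule opcart_cancel[of "lidc X ?B" _ "ps @ [q]" "[]" A])
    have "ccomp X ?l (tid X A) (map (cid X) ps @ concat [[cid X q, lidc X ?B]] @ map (cid X) []) =
        ccomp X \<chi> (tid X A) (map (cid X) ps @ comps X (tid X (lcod X q)) [runit X q] [[cid X q, lidc X ?B]] @ map (cid X) [])"
      using ccomp_whisker_cid[of \<chi> ps "[runit X q]" "[]" A "lcod X q" ?B ?B "[[cid X q, lidc X ?B]]"] assms ch by simp
    also have "comps X (tid X (lcod X q)) [runit X q] [[cid X q, lidc X ?B]] = [cid X q]"
      using runit_frame(6)[OF ch(2)] ch(2) by (simp add: vcomp_def)
    finally have "ccomp X ?l (tid X A) (map (cid X) (ps @ [q]) @ lidc X ?B # map (cid X) []) = \<chi>"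
      using id_\<chi> by simp
    also have "\<chi> = ccomp X (\<chi> \<cdot> tact (rgt X \<chi>)) (tid X A) ((map (cid X) ps @ [cid X q]) @ [lidc X ?B])"
    proof -
      have "ccomp X (tact (rgt X \<chi>)) (tid X ?B) [lidc X ?B] = unitc (rgt X \<chi>)"
        using tact_frame(6)[of "rgt X \<chi>"] assms ch by (simp add: vcomp_def)
      then show ?thesis
        using assms ch A ids tgt
        by (subst ccomp_mul[where k="tid X ?B" and k'="tid X ?B"])
          (auto simp: id_\<chi> juxtaposable_append simp del: map_map)
    qed
    finally show "ccomp X ?l (tid X A) (map (cid X) (ps @ [q]) @ lidc X ?B # map (cid X) []) =
        ccomp X (\<chi> \<cdot> tact (rgt X \<chi>)) (tid X A) (map (cid X) (ps @ [q]) @ lidc X ?B # map (cid X) [])"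
      by simp
  qed (use assms f ch A in simp_all)
qed

lemma lunit_natural:
  assumes "\<chi> \<in> Cell X" "src X \<chi> = q # ps"
  shows "ccomp X \<chi> (tid X (lcod X q)) (lunit X q # map (cid X) ps) = lmul (tact (lft X \<chi>)) \<chi>"
proof -
  let ?A = "lcod X q" and ?l = "ccomp X \<chi> (tid X (lcod X q)) (lunit X q # map (cid X) ps)"
  let ?B = "tdom X (rgt X \<chi>)"
  have ch: "chain X (ldom X q) ps ?B" "q \<in> Loose X" "tdom X (lft X \<chi>) = ?A"
    using cell_chain[OF assms(1)] assms by auto
  have A: "?A \<in> Obj X" using ch(2) by simp
  note ids = juxtaposable_cid[OF ch(1)]
  have tgt: "map (tgt X) (map (cid X) ps) = ps"
    using chain_Loose[OF ch(1)] by (auto intro: map_idI)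
  note f = ccomp_whisker_frame[of \<chi> "[]" "[lunit X q]" ps ?A ?B ?A "ldom X q"]
  have id_\<chi>: "ccomp X \<chi> (tid X ?A) (cid X q # map (cid X) ps) = \<chi>"
    using ccomp_cids[OF assms ch(3)] by simp
  show ?thesis
  proof (rule opcart_cancel[of "lidc X ?A" _ "[]" "q # ps" ?A])
    have "ccomp X ?l (tid X ?A) (map (cid X) [] @ concat [[lidc X ?A, cid X q]] @ map (cid X) ps) =
        ccomp X \<chi> (tid X ?A) (map (cid X) [] @ comps X (tid X ?A) [lunit X q] [[lidc X ?A, cid X q]] @ map (cid X) ps)"
      using ccomp_whisker_cid[of \<chi> "[]" "[lunit X q]" ps ?A ?A "ldom X q" ?B "[[lidc X ?A, cid X q]]"] assms ch by simp
    also have "comps X (tid X ?A) [lunit X q] [[lidc X ?A, cid X q]] = [cid X q]"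
      using lunit_frame(6)[OF ch(2)] ch(2) by (simp add: vcomp_def)
    finally have "ccomp X ?l (tid X ?A) (map (cid X) [] @ lidc X ?A # map (cid X) (q # ps)) = \<chi>"
      using id_\<chi> by simp
    also have "\<chi> = ccomp X (lmul (tact (lft X \<chi>)) \<chi>) (tid X ?A) ([lidc X ?A] @ (cid X q # map (cid X) ps))"
    proof -
      have "ccomp X (tact (lft X \<chi>)) (tid X ?A) [lidc X ?A] = unitc (lft X \<chi>)"
        using tact_frame(6)[of "lft X \<chi>"] assms ch A by (simp add: vcomp_def)
      then show ?thesis
      using assms ch A ids tgt
      by (subst ccomp_lmul[where k="tid X ?A" and k'="tid X ?B"])
        (auto simp: id_\<chi> simp del: map_map)
    qed
    finally show "ccomp X ?l (tid X ?A) (map (cid X) [] @ lidc X ?A # map (cid X) (q # ps)) =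
        ccomp X (lmul (tact (lft X \<chi>)) \<chi>) (tid X ?A) (map (cid X) [] @ lidc X ?A # map (cid X) (q # ps))"
      by simp
  qed (use assms f ch A in simp_all)
qed

end

section \<open>Interchange of pasting with composition, and associativity of pasting\<close>

context virtual_equipment
begin

text \<open>Write \<open>\<alpha> \<cdot> \<beta>\<close> as \<open>runit\<close> after
  \<open>[\<alpha>, \<beta>]\<close>, move \<open>runit\<close> past \<open>\<chi>\<close> by
  \<open>runit_natural\<close>, then distribute over the factors. An empty and a one-element
  \<open>\<phi>s\<close> give the unary and the binary interchange law.\<close>

lemma ccomp_mul_natural:
  assumes "\<chi> \<in> Cell X" "src X \<chi> = map (tgt X) \<phi>s @ [tgt X \<alpha>]" "tcod X h = tdom X (lft X \<chi>)"
    and "juxtaposable X h \<phi>s (lft X \<alpha>)" "\<alpha> \<in> Cell X" "\<beta> \<in> Cell X"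
    and "tgt X \<beta> = lid X (tcod X (rgt X \<alpha>))" "lft X \<beta> = rgt X \<alpha>"
  shows "ccomp X \<chi> h (\<phi>s @ [\<alpha> \<cdot> \<beta>]) = ccomp X \<chi> h (\<phi>s @ [\<alpha>]) \<cdot> (tact (rgt X \<chi>) \<diamondop> [\<beta>])"
proof -
  have h: "h \<in> Tight X" using juxtaposable_Tight assms(4) by blast
  have rgt: "tdom X (rgt X \<chi>) = tcod X (rgt X \<alpha>)"
    using tdom_rgt[OF assms(1,2)] assms(5) by simp
  note c = form_cod[OF assms(6,7)]
  have e1: "ccomp X (ccomp X \<chi> (tid X (tcod X h)) (map (cid X) (map (tgt X) \<phi>s) @ [runit X (tgt X \<alpha>)])) h (\<phi>s @ [\<alpha>, \<beta>]) =
      ccomp X \<chi> h (\<phi>s @ [\<alpha> \<cdot> \<beta>])"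
    using ccomp_whisker[of \<chi> \<phi>s "[runit X (tgt X \<alpha>)]" "[]" h "lft X \<alpha>" "[[\<alpha>, \<beta>]]" "rgt X \<beta>" "rgt X \<beta>"] assms c
    by (simp add: mul_def vcomp_def)
  have e2: "ccomp X \<chi> (tid X (tcod X h)) (map (cid X) (map (tgt X) \<phi>s) @ [runit X (tgt X \<alpha>)]) =
      \<chi> \<cdot> tact (rgt X \<chi>)"
    using runit_natural[OF assms(1,2)] assms(3) by simp
  have e3: "ccomp X (\<chi> \<cdot> tact (rgt X \<chi>)) h ((\<phi>s @ [\<alpha>]) @ [\<beta>]) =
      ccomp X \<chi> h (\<phi>s @ [\<alpha>]) \<cdot> (tact (rgt X \<chi>) \<diamondop> [\<beta>])"
    using assms rgt by (subst ccomp_mul[where k="rgt X \<alpha>" and k'="rgt X \<beta>"])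
      (auto simp: juxtaposable_append vcomp_def)
  show ?thesis using e3 unfolding e1[unfolded e2, symmetric] by simp
qed

lemma vcomp_lmul_natural:
  assumes "\<chi> \<in> Cell X" "src X \<chi> = tgt X \<beta> # map (tgt X) \<phi>s"
    and "juxtaposable X (rgt X \<beta>) \<phi>s k" "\<alpha> \<in> Cell X" "\<beta> \<in> Cell X"
    and "tgt X \<alpha> = lid X (tcod X (lft X \<beta>))" "lft X \<beta> = rgt X \<alpha>"
  shows "\<chi> \<diamondop> (lmul \<alpha> \<beta> # \<phi>s) = lmul (tact (lft X \<chi>) \<diamondop> [\<alpha>]) (\<chi> \<diamondop> (\<beta> # \<phi>s))"
proof -
  have lft: "tdom X (lft X \<chi>) = tcod X (lft X \<beta>)"
    using ccomp_frame_hd[OF assms(1,2)] assms(5) by simp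
  have "tcod X (lft X \<beta>) \<in> Obj X" using assms by simp
  with form_cod[OF assms(4,6)] have c: "tcod X (lft X \<alpha>) = tcod X (rgt X \<alpha>)" by simp
  have l: "ccomp X (lunit X (tgt X \<beta>)) (lft X \<alpha>) [\<alpha>, \<beta>] = lmul \<alpha> \<beta>"
    by (simp add: lmul_def vcomp_def)
  have e1: "ccomp X (ccomp X \<chi> (tid X (lcod X (tgt X \<beta>))) (lunit X (tgt X \<beta>) # map (cid X) (map (tgt X) \<phi>s)))
      (lft X \<alpha>) ([\<alpha>, \<beta>] @ \<phi>s) = \<chi> \<diamondop> (lmul \<alpha> \<beta> # \<phi>s)"
    using ccomp_whisker[of \<chi> "[]" "[lunit X (tgt X \<beta>)]" \<phi>s "lft X \<alpha>" "lft X \<alpha>" "[[\<alpha>, \<beta>]]" "rgt X \<beta>" k] assms c lft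
    by (simp add: l) (simp add: vcomp_def)
  have e2: "ccomp X \<chi> (tid X (lcod X (tgt X \<beta>))) (lunit X (tgt X \<beta>) # map (cid X) (map (tgt X) \<phi>s)) =
      lmul (tact (lft X \<chi>)) \<chi>"
    using lunit_natural[OF assms(1,2)] by simp
  have e3: "ccomp X (lmul (tact (lft X \<chi>)) \<chi>) (lft X \<alpha>) ([\<alpha>] @ (\<beta> # \<phi>s)) =
      lmul (tact (lft X \<chi>) \<diamondop> [\<alpha>]) (\<chi> \<diamondop> (\<beta> # \<phi>s))"
    using assms lft c by (subst ccomp_lmul[where k="rgt X \<alpha>" and k'=k]) (simp_all add: vcomp_def)
  show ?thesis using e3 unfolding e1[unfolded e2, symmetric] by simp
qed

lemma vcomp_mul:
  assumes "\<chi> \<in> Cell X" "src X \<chi> = [tgt X \<alpha>]" "\<alpha> \<in> Cell X" "\<beta> \<in> Cell X"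
    and "tgt X \<beta> = lid X (tcod X (rgt X \<alpha>))" "lft X \<beta> = rgt X \<alpha>"
  shows "\<chi> \<diamondop> [\<alpha> \<cdot> \<beta>] = (\<chi> \<diamondop> [\<alpha>]) \<cdot> (tact (rgt X \<chi>) \<diamondop> [\<beta>])"
  using ccomp_mul_natural[of \<chi> "[]" \<alpha> "lft X \<alpha>" \<beta>] assms ccomp_frame_hd[of \<chi>]
  by (simp add: vcomp_def)

lemma vcomp2_mul:
  assumes "\<chi> \<in> Cell X" "src X \<chi> = [tgt X \<phi>, tgt X \<alpha>]" "\<phi> \<in> Cell X" "lft X \<alpha> = rgt X \<phi>"
    and "\<alpha> \<in> Cell X" "\<beta> \<in> Cell X" "tgt X \<beta> = lid X (tcod X (rgt X \<alpha>))" "lft X \<beta> = rgt X \<alpha>"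
  shows "\<chi> \<diamondop> [\<phi>, \<alpha> \<cdot> \<beta>] = (\<chi> \<diamondop> [\<phi>, \<alpha>]) \<cdot> (tact (rgt X \<chi>) \<diamondop> [\<beta>])"
  using ccomp_mul_natural[of \<chi> "[\<phi>]" \<alpha> "lft X \<phi>" \<beta>] assms ccomp_frame_hd[of \<chi>]
  by (simp add: vcomp_def)

lemma vcomp_lmul:
  assumes "\<chi> \<in> Cell X" "src X \<chi> = [tgt X \<beta>]" "\<alpha> \<in> Cell X" "\<beta> \<in> Cell X"
    and "tgt X \<alpha> = lid X (tcod X (lft X \<beta>))" "lft X \<beta> = rgt X \<alpha>"
  shows "\<chi> \<diamondop> [lmul \<alpha> \<beta>] = lmul (tact (lft X \<chi>) \<diamondop> [\<alpha>]) (\<chi> \<diamondop> [\<beta>])"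
  using vcomp_lmul_natural[of \<chi> \<beta> "[]" "rgt X \<beta>" \<alpha>] assms by simp

lemma vcomp2_lmul:
  assumes "\<chi> \<in> Cell X" "src X \<chi> = [tgt X \<beta>, tgt X \<phi>]" "\<phi> \<in> Cell X" "lft X \<phi> = rgt X \<beta>"
    and "\<alpha> \<in> Cell X" "\<beta> \<in> Cell X" "tgt X \<alpha> = lid X (tcod X (lft X \<beta>))" "lft X \<beta> = rgt X \<alpha>"
  shows "\<chi> \<diamondop> [lmul \<alpha> \<beta>, \<phi>] = lmul (tact (lft X \<chi>) \<diamondop> [\<alpha>]) (\<chi> \<diamondop> [\<beta>, \<phi>])"
  using vcomp_lmul_natural[of \<chi> \<beta> "[\<phi>]" "rgt X \<phi>" \<alpha>] assms by simp

text \<open>Interchange for \<open>runit X (tgt X \<alpha>)\<close> in the role of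
  \<open>\<chi>\<close>: its right tight-cell is an identity, hence so is the \<open>tact\<close>
  that whiskers \<open>\<gamma>\<close>.\<close>

lemma mul_assoc:
  assumes "\<alpha> \<in> Cell X" "\<beta> \<in> Cell X" "tgt X \<beta> = lid X (tcod X (rgt X \<alpha>))" "lft X \<beta> = rgt X \<alpha>"
    and "\<gamma> \<in> Cell X" "tgt X \<gamma> = tgt X \<beta>" "lft X \<gamma> = rgt X \<beta>"
  shows "(\<alpha> \<cdot> \<beta>) \<cdot> \<gamma> = \<alpha> \<cdot> (\<beta> \<cdot> \<gamma>)"
proof -
  have "tcod X (rgt X \<alpha>) \<in> Obj X" using assms by simp
  with form_cod[OF assms(2,3)] have c: "tcod X (rgt X \<beta>) = tcod X (rgt X \<alpha>)" by simp
  show ?thesis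
    unfolding mul_def[of \<alpha>] using assms c
    by (subst vcomp2_mul) (simp_all)
qed

section \<open>Restrictions of loose-identities\<close>

lemma homc_frame [simp]:
  assumes "f \<in> Tight X" "g \<in> Tight X" "tcod X g = tcod X f"
  shows "homc X f g \<in> Cell X" "src X (homc X f g) = [hom X f g]"
    "tgt X (homc X f g) = lid X (tcod X f)" "lft X (homc X f g) = f" "rgt X (homc X f g) = g"
    "cartesian X (homc X f g)"
  using restriction[of "lid X (tcod X f)" f g] assms by (auto simp: homc_def hom_def cartesian_def)

lemma hom_loose [simp]:
  assumes "f \<in> Tight X" "g \<in> Tight X" "tcod X g = tcod X f"
  shows "hom X f g \<in> Loose X" "lcod X (hom X f g) = tdom X f" "ldom X (hom X f g) = tdom X g"
  using cell_chain[of "homc X f g"] assms by auto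

lemma hom_cancel:
  assumes "f \<in> Tight X" "g \<in> Tight X" "tcod X g = tcod X f"
    "\<alpha> \<in> Cell X" "\<beta> \<in> Cell X" "tgt X \<alpha> = hom X f g" "tgt X \<beta> = hom X f g"
    "lft X \<beta> = lft X \<alpha>" "rgt X \<beta> = rgt X \<alpha>"
    "homc X f g \<diamondop> [\<alpha>] = homc X f g \<diamondop> [\<beta>]"
  shows "\<alpha> = \<beta>"
  using assms by (intro cart_cancel[of "homc X f g" \<alpha> \<beta>]) auto

text \<open>A factorisation of \<open>\<chi>\<close> through \<open>d\<close> is the same as one of
  \<open>c \<diamondop> [\<chi>]\<close> through \<open>c \<diamondop> [d]\<close>, because
  \<open>c\<close> can be cancelled. This makes \<open>homr\<close> cartesian, which the choice of
  restrictions does not give directly.\<close>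

lemma cartesian_factor:
  assumes c: "cartesian X c" and d: "d \<in> Cell X" "src X c = [tgt X d]" "src X d = [p]"
    and cd: "cartesian X (c \<diamondop> [d])"
  shows "cartesian X d"
  unfolding cartesian_def
proof (intro conjI allI impI)
  have cC: "c \<in> Cell X" using c by (simp add: cartesian_def)
  note fr = vcomp1_frame[OF cC d(1,2)]
  have tc: "tdom X (lft X c) = tcod X (lft X d)" "tdom X (rgt X c) = tcod X (rgt X d)"
    using cell_chain[OF cC] d by auto
  have p: "p \<in> Loose X" "lcod X p = tdom X (lft X d)" "ldom X p = tdom X (rgt X d)"
    using cell_chain[OF d(1)] d by auto
  show "d \<in> Cell X" "\<exists>p. src X d = [p]" using d by auto
  fix \<chi> f' g'
  assume "\<chi> \<in> Cell X \<and> tgt X \<chi> = tgt X d \<and> f' \<in> Tight X \<and> g' \<in> Tight X \<and>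
        tcod X f' = tdom X (lft X d) \<and> tcod X g' = tdom X (rgt X d) \<and>
        lft X \<chi> = lft X d \<bullet> f' \<and> rgt X \<chi> = rgt X d \<bullet> g'"
  then have \<chi>: "\<chi> \<in> Cell X" "tgt X \<chi> = tgt X d" "f' \<in> Tight X" "g' \<in> Tight X"
    "tcod X f' = tdom X (lft X d)" "tcod X g' = tdom X (rgt X d)"
    "lft X \<chi> = lft X d \<bullet> f'" "rgt X \<chi> = rgt X d \<bullet> g'" by auto
  have c\<chi>: "c \<diamondop> [\<chi>] \<in> Cell X" "src X (c \<diamondop> [\<chi>]) = src X \<chi>" "tgt X (c \<diamondop> [\<chi>]) = tgt X (c \<diamondop> [d])"
    "lft X (c \<diamondop> [\<chi>]) = lft X (c \<diamondop> [d]) \<bullet> f'" "rgt X (c \<diamondop> [\<chi>]) = rgt X (c \<diamondop> [d]) \<bullet> g'"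
    using cC \<chi> d tc fr by (simp_all add: tcomp_assoc)
  define \<xi> where "\<xi> = lift X (c \<diamondop> [d]) f' g' (c \<diamondop> [\<chi>])"
  have "tcod X f' = tdom X (lft X (c \<diamondop> [d]))" "tcod X g' = tdom X (rgt X (c \<diamondop> [d]))"
    using \<chi> fr cC d tc by auto
  note \<xi> = cart_lift[OF cd c\<chi>(1,3) \<chi>(3,4) this c\<chi>(4,5), folded \<xi>_def]
  have "tgt X \<xi> = p" using \<xi>(3) fr d by simp
  note \<xi> = \<xi>(1,2) this \<xi>(4-)
  have d\<xi>: "d \<diamondop> [\<xi>] = \<chi>"
  proof (rule cart_cancel[OF c])
    show "c \<diamondop> [d \<diamondop> [\<xi>]] = c \<diamondop> [\<chi>]"
      using \<xi> cC d by (simp flip: vcomp_assoc1)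
  qed (use \<xi> \<chi> d in auto)
  show "\<exists>!\<chi>'. cart_factor X d f' g' \<chi> \<chi>'"
  proof
    show "cart_factor X d f' g' \<chi> \<xi>"
      using \<xi> c\<chi> d d\<xi> by (auto simp: cart_factor_def vcomp_def)
    fix \<zeta>
    assume "cart_factor X d f' g' \<chi> \<zeta>"
    then have \<zeta>: "\<zeta> \<in> Cell X" "src X \<zeta> = src X \<chi>" "tgt X \<zeta> = p" "lft X \<zeta> = f'" "rgt X \<zeta> = g'" "d \<diamondop> [\<zeta>] = \<chi>"
      using d by (auto simp: cart_factor_def vcomp_def)
    show "\<zeta> = \<xi>"
    proof (rule cart_cancel[OF cd])
      show "c \<diamondop> [d] \<diamondop> [\<zeta>] = c \<diamondop> [d] \<diamondop> [\<xi>]"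
        using \<xi> \<zeta> cC d d\<xi> by (simp add: vcomp_assoc1)
    qed (use \<xi> \<zeta> fr d in auto)
  qed
qed

lemma homr_frame [simp]:
  assumes "f \<in> Tight X" "g \<in> Tight X" "tcod X g = tcod X f"
    "f' \<in> Tight X" "tcod X f' = tdom X f" "g' \<in> Tight X" "tcod X g' = tdom X g"
  shows "homr X f g f' g' \<in> Cell X" "src X (homr X f g f' g') = [hom X (f \<bullet> f') (g \<bullet> g')]"
    "tgt X (homr X f g f' g') = hom X f g" "lft X (homr X f g f' g') = f'" "rgt X (homr X f g f' g') = g'"
    "homc X f g \<diamondop> [homr X f g f' g'] = homc X (f \<bullet> f') (g \<bullet> g')"
    "cartesian X (homr X f g f' g')"
proof -
  show *: "homr X f g f' g' \<in> Cell X" "src X (homr X f g f' g') = [hom X (f \<bullet> f') (g \<bullet> g')]"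
    "tgt X (homr X f g f' g') = hom X f g" "lft X (homr X f g f' g') = f'" "rgt X (homr X f g f' g') = g'"
    "homc X f g \<diamondop> [homr X f g f' g'] = homc X (f \<bullet> f') (g \<bullet> g')"
    unfolding homr_def using assms cart_lift[of "homc X f g" "homc X (f \<bullet> f') (g \<bullet> g')" f' g'] by auto
  show "cartesian X (homr X f g f' g')"
    by (rule cartesian_factor[of "homc X f g"]) (use * assms in simp_all)
qed

lemma cap_frame [simp]:
  assumes "f \<in> Tight X"
  shows "cap X f \<in> Cell X" "src X (cap X f) = []" "tgt X (cap X f) = hom X f f"
    "lft X (cap X f) = tid X (tdom X f)" "rgt X (cap X f) = tid X (tdom X f)"
    "homc X f f \<diamondop> [cap X f] = unitc f"
  using cart_glift[of "homc X f f" "unitc f"] assms by (simp_all add: cap_def flip: unitc_def)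

section \<open>Units of conjoints and companions, and the Yoneda lemma\<close>

definition conj_unit :: "'t \<Rightarrow> 'c" where
  "conj_unit f = lift X (homc X f (tid X (tcod X f))) (tid X (tdom X f)) f (unitc f)"

lemma conj_unit_frame [simp]:
  assumes "f \<in> Tight X"
  shows "conj_unit f \<in> Cell X" "src X (conj_unit f) = []" "tgt X (conj_unit f) = hom X f (tid X (tcod X f))"
    "lft X (conj_unit f) = tid X (tdom X f)" "rgt X (conj_unit f) = f"
    "tcod X f = B \<Longrightarrow> homc X f (tid X B) \<diamondop> [conj_unit f] = unitc f"
  unfolding conj_unit_def using assms
    cart_lift[of "homc X f (tid X (tcod X f))" "unitc f" "tid X (tdom X f)" f] by auto

text \<open>Like \<open>conj_unit f\<close>, a lift of \<open>unitc f\<close>: the restriction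
  absorbs \<open>f\<close> on one side and leaves it as a tight-cell on the other.\<close>

definition comp_unit :: "'t \<Rightarrow> 'c" where
  "comp_unit f = lift X (homc X (tid X (tcod X f)) f) f (tid X (tdom X f)) (unitc f)"

lemma comp_unit_frame [simp]:
  assumes "f \<in> Tight X"
  shows "comp_unit f \<in> Cell X" "src X (comp_unit f) = []" "tgt X (comp_unit f) = hom X (tid X (tcod X f)) f"
    "lft X (comp_unit f) = f" "rgt X (comp_unit f) = tid X (tdom X f)"
    "tcod X f = B \<Longrightarrow> homc X (tid X B) f \<diamondop> [comp_unit f] = unitc f"
  unfolding comp_unit_def using assms
    cart_lift[of "homc X (tid X (tcod X f)) f" "unitc f" f "tid X (tdom X f)"] by auto

text \<open>One of the two equations of a conjoint. Composing with \<open>homc\<close> reduces it to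
  the other one, \<open>homc X f (tid X B) \<diamondop> [conj_unit f] = unitc f\<close>, and to the
  neutrality of \<open>unitc f\<close>.\<close>

lemma conj_unit_mul:
  assumes "f \<in> Tight X" "tcod X f = B"
  shows "conj_unit f \<cdot> homc X f (tid X B) = cid X (hom X f (tid X B))"
proof (rule hom_cancel[of f "tid X B"])
  show "homc X f (tid X B) \<diamondop> [conj_unit f \<cdot> homc X f (tid X B)] =
      homc X f (tid X B) \<diamondop> [cid X (hom X f (tid X B))]"
    using assms by (subst vcomp_mul) auto
qed (use assms in auto)

lemma lmul_comp_unit:
  assumes "f \<in> Tight X" "tcod X f = B"
  shows "lmul (homc X (tid X B) f) (comp_unit f) = cid X (hom X (tid X B) f)"
proof (rule hom_cancel[of "tid X B" f])
  show "homc X (tid X B) f \<diamondop> [lmul (homc X (tid X B) f) (comp_unit f)] =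
      homc X (tid X B) f \<diamondop> [cid X (hom X (tid X B) f)]"
    using assms by (subst vcomp_lmul) (auto simp: lmul_form)
qed (use assms in auto)

text \<open>Apply \<open>\<chi>\<close> to the identity of \<open>B(f, 1)\<close>, decomposed by
  \<open>conj_unit_mul\<close>, and interchange.\<close>

lemma conjoint_yoneda:
  assumes "f \<in> Tight X" "tcod X f = B" "\<chi> \<in> Cell X" "src X \<chi> = [hom X f (tid X B)]"
  shows "\<chi> = (\<chi> \<diamondop> [conj_unit f]) \<cdot> (tact (rgt X \<chi>) \<diamondop> [homc X f (tid X B)])"
  using vcomp_mul[of \<chi> "conj_unit f" "homc X f (tid X B)"] assms conj_unit_mul[of f B] tcod_closed[of f] by simp

text \<open>The dual argument, with a second loose-cell \<open>p\<close> carried along because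
  counits have a binary source.\<close>

lemma companion_yoneda:
  assumes "f \<in> Tight X" "tcod X f = B" "\<chi> \<in> Cell X" "src X \<chi> = [hom X (tid X B) f, p]"
  shows "\<chi> = lmul (tact (lft X \<chi>) \<diamondop> [homc X (tid X B) f]) (\<chi> \<diamondop> [comp_unit f, cid X p])"
  using vcomp2_lmul[of \<chi> "comp_unit f" "cid X p" "homc X (tid X B) f"] assms lmul_comp_unit[of f B]
    cell_chain[OF assms(3)] tcod_closed[of f] by simp

text \<open>Inserting \<open>comp_unit f\<close> for \<open>B(1, f)\<close> turns the left factor
  into the neutral \<open>unitc f\<close> and so recovers the right one. The source of the right
  factor is an arbitrary chain, since nullary, unary and binary factors all have to be
  compared.\<close>

lemma companion_mul_eq_iff:
  assumes f: "f \<in> Tight X" "tcod X f = B"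
    and \<alpha>: "\<alpha> \<in> Cell X" "tgt X \<alpha> = lid X B" "lft X \<alpha> = f"
    and \<beta>: "\<beta> \<in> Cell X" "tgt X \<beta> = lid X B" "lft X \<beta> = f" "src X \<beta> = src X \<alpha>"
  shows "homc X (tid X B) f \<cdot> \<alpha> = homc X (tid X B) f \<cdot> \<beta> \<longleftrightarrow> \<alpha> = \<beta>"
proof -
  have "ccomp X (homc X (tid X B) f \<cdot> \<gamma>) f ([comp_unit f] @ map (cid X) (src X \<gamma>)) = \<gamma>"
    if \<gamma>: "\<gamma> \<in> Cell X" "tgt X \<gamma> = lid X B" "lft X \<gamma> = f" for \<gamma>
  proof -
    have ids: "juxtaposable X (tid X (tdom X f)) (map (cid X) (src X \<gamma>)) (tid X (tdom X (rgt X \<gamma>)))"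
      using cell_chain[of \<gamma>] \<gamma> by (intro juxtaposable_cid) auto
    have tgt: "map (tgt X) (map (cid X) (src X \<gamma>)) = src X \<gamma>"
      using chain_Loose[OF cell_chain[OF \<gamma>(1)]] by (auto intro: map_idI)
    have u: "ccomp X (homc X (tid X B) f) f [comp_unit f] = unitc f"
      using comp_unit_frame(6)[OF f] f by (simp add: vcomp_def)
    show ?thesis
      using f \<gamma> ids tgt u ccomp_cids[of \<gamma>]
      by (subst ccomp_mul[where k="tid X (tdom X f)" and k'="tid X (tdom X (rgt X \<gamma>))"]) (auto simp del: map_map)
  qed
  from this[OF \<alpha>] this[OF \<beta>(1-3)] show ?thesis using \<beta>(4) by metis
qed

lemma hom_comp_frame [simp]:
  assumes "f \<in> Tight X" "g \<in> Tight X" "tcod X g = tcod X f" "h \<in> Tight X" "tcod X h = tdom X g"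
  shows "hom_comp X f g h \<in> Cell X" "src X (hom_comp X f g h) = [hom X f g, hom X (tid X (tdom X g)) h]"
    "tgt X (hom_comp X f g h) = hom X f (g \<bullet> h)" "lft X (hom_comp X f g h) = tid X (tdom X f)"
    "rgt X (hom_comp X f g h) = tid X (tdom X h)"
    "tdom X f = A \<Longrightarrow> homr X f g (tid X A) h \<diamondop> [hom_comp X f g h] = cid X (hom X f g) \<cdot> homc X (tid X (tdom X g)) h"
    "homc X f (g \<bullet> h) \<diamondop> [hom_comp X f g h] = homc X f g \<cdot> (tact g \<diamondop> [homc X (tid X (tdom X g)) h])"
proof -
  let ?R = "homr X f g (tid X (tdom X f)) h" and ?D = "cid X (hom X f g) \<cdot> homc X (tid X (tdom X g)) h"
  have hc: "hom_comp X f g h = glift X ?R ?D"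
    using assms by (simp add: hom_comp_def mul_def)
  have *: "hom_comp X f g h \<in> Cell X" "src X (hom_comp X f g h) = [hom X f g, hom X (tid X (tdom X g)) h]"
    "tgt X (hom_comp X f g h) = hom X f (g \<bullet> h)" "lft X (hom_comp X f g h) = tid X (tdom X f)"
    "rgt X (hom_comp X f g h) = tid X (tdom X h)" "?R \<diamondop> [hom_comp X f g h] = ?D"
    unfolding hc using assms cart_glift[of ?R ?D] by simp_all
  then show "hom_comp X f g h \<in> Cell X" "src X (hom_comp X f g h) = [hom X f g, hom X (tid X (tdom X g)) h]"
    "tgt X (hom_comp X f g h) = hom X f (g \<bullet> h)" "lft X (hom_comp X f g h) = tid X (tdom X f)"
    "rgt X (hom_comp X f g h) = tid X (tdom X h)" by auto
  from *(6) show "tdom X f = A \<Longrightarrow> homr X f g (tid X A) h \<diamondop> [hom_comp X f g h] = ?D" for A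
    by auto
  have "homc X f g \<diamondop> [?R \<diamondop> [hom_comp X f g h]] = homc X f (g \<bullet> h) \<diamondop> [hom_comp X f g h]"
    using * assms vcomp_assoc1[of "homc X f g" ?R "hom_comp X f g h"] by simp
  then show "homc X f (g \<bullet> h) \<diamondop> [hom_comp X f g h] = homc X f g \<cdot> (tact g \<diamondop> [homc X (tid X (tdom X g)) h])"
    using * assms by (simp add: vcomp_mul)
qed

end

section \<open>Opcartesianness of \<open>hom_comp\<close>, and the actions on restrictions seen in
  loose-identities\<close>

context virtual_equipment
begin

text \<open>The triangle identity: a loose-identity between \<open>q\<close> and \<open>p\<close>
  may be absorbed on either side, since inserting \<open>lidc\<close> there turns both composites
  into \<open>\<chi>\<close>.\<close>

lemma opcart_whisker_middle:
  assumes \<chi>: "\<chi> \<in> Cell X" "src X \<chi> = ps @ [q, p] @ rs" "tdom X (lft X \<chi>) = A"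
  shows "ccomp X \<chi> (tid X A) (map (cid X) ps @ [runit X q, cid X p] @ map (cid X) rs) =
    ccomp X \<chi> (tid X A) (map (cid X) ps @ [cid X q, lunit X p] @ map (cid X) rs)"
    (is "?L = ?R")
proof -
  let ?B = "ldom X q"
  have ch: "chain X A ps (lcod X q)" "q \<in> Loose X" "p \<in> Loose X" "lcod X p = ?B"
    "chain X (ldom X p) rs (tdom X (rgt X \<chi>))"
    using cell_chain[OF \<chi>(1)] \<chi> by (auto simp: chain_append)
  have A: "A \<in> Obj X" using \<chi> by auto
  note f = ccomp_whisker_frame[OF \<chi>(1) _ \<chi>(3) refl ch(1,5)]
  note f = f[of "[runit X q, cid X p]"] f[of "[cid X q, lunit X p]"]
  have id_\<chi>: "ccomp X \<chi> (tid X A) (map (cid X) ps @ [cid X q, cid X p] @ map (cid X) rs) = \<chi>"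
    using ccomp_cids[OF \<chi>] by simp
  note w = ccomp_whisker_cid[OF \<chi>(1) _ \<chi>(3) ch(1,5)]
  have "ccomp X ?L (tid X A) (map (cid X) ps @ concat [[cid X q, lidc X ?B], [cid X p]] @ map (cid X) rs) = \<chi>"
    using w[of "[runit X q, cid X p]" "[[cid X q, lidc X ?B], [cid X p]]"] \<chi> ch runit_frame(6)[OF ch(2)] id_\<chi>
    by (simp add: vcomp_def)
  moreover have "ccomp X ?R (tid X A) (map (cid X) ps @ concat [[cid X q], [lidc X ?B, cid X p]] @ map (cid X) rs) = \<chi>"
    using w[of "[cid X q, lunit X p]" "[[cid X q], [lidc X ?B, cid X p]]"] \<chi> ch lunit_frame(6)[OF ch(3)] id_\<chi>
    by (simp add: vcomp_def)
  ultimately show ?thesis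
    using f \<chi> ch A
    by (intro opcart_cancel[of "lidc X ?B" ?L "ps @ [q]" "p # rs" A ?R]) simp_all
qed

text \<open>The inverse of precomposition with \<open>hom_comp f g h\<close> inserts \<open>comp_unit h : () \<Rightarrow> B(1, h)\<close>.\<close>

lemma hom_comp_opcartesian:
  assumes fgh: "f \<in> Tight X" "g \<in> Tight X" "tcod X g = tcod X f" "h \<in> Tight X" "tcod X h = tdom X g"
  shows "opcartesian X (hom_comp X f g h)"
proof -
  let ?m = "hom_comp X f g h" and ?q = "hom X f g" and ?B = "tdom X g"
  let ?p = "hom X (tid X ?B) h" and ?R = "homr X f g (tid X (tdom X f)) h"
  let ?c = "homc X (tid X ?B) h" and ?u = "comp_unit h"
  let ?t = "hom X f (g \<bullet> h)"
  have t: "lcod X ?t = tdom X f" "ldom X ?t = tdom X h" "?t \<in> Loose X" using fgh by auto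
  note m = hom_comp_frame[OF fgh]
  have Ru: "?R \<cdot> unitc h = ?R" using fgh by simp
  \<comment> \<open>This half of the inverse law gives uniqueness. In the loose-identity
    \<open>?c\<close> meets \<open>?u\<close> and becomes the identity of \<open>h\<close>, which is
    neutral after whiskering by \<open>g\<close>.\<close>
  have mRu: "?m \<diamondop> [?R, ?u] = cid X ?t"
  proof (rule hom_cancel[of f "g \<bullet> h"])
    have "homc X f (g \<bullet> h) \<diamondop> [?m \<diamondop> [?R, ?u]] = (homc X f g \<cdot> (tact g \<diamondop> [?c])) \<diamondop> [?R, ?u]"
      using fgh m(7) by (simp flip: vcomp_assoc12)
    also have "\<dots> = homc X f (g \<bullet> h) \<cdot> (tact g \<diamondop> [?c \<diamondop> [?u]])"
      using fgh by (subst mul_vcomp) (simp_all add: vcomp_assoc1)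
    finally show "homc X f (g \<bullet> h) \<diamondop> [?m \<diamondop> [?R, ?u]] = homc X f (g \<bullet> h) \<diamondop> [cid X ?t]"
      using fgh by simp
  qed (use fgh in auto)
  have "\<exists>!\<chi>'. opcart_factor X ?m ps rs \<chi> \<chi>'"
    if \<chi>: "\<chi> \<in> Cell X" "src X \<chi> = ps @ src X ?m @ rs"
      and ps: "chain X (tdom X (lft X \<chi>)) ps (lcod X (tgt X ?m))"
      and rs: "chain X (ldom X (tgt X ?m)) rs (tdom X (rgt X \<chi>))" for ps rs \<chi>
  proof -
    define A where "A = tdom X (lft X \<chi>)"
    let ?D = "tdom X (rgt X \<chi>)" and ?ip = "map (cid X) ps" and ?ir = "map (cid X) rs"
    note ps = ps[unfolded m(3) t A_def[symmetric]] and rs = rs[unfolded m(3) t]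
    have A: "A \<in> Obj X" "tdom X (lft X \<chi>) = A" using \<chi> by (auto simp: A_def)
    have src\<chi>: "src X \<chi> = ps @ [?q, ?p] @ rs" using \<chi> m(2) by simp
    note w = ccomp_whisker_cid[OF _ _ _ ps rs]
    \<comment> \<open>The frames fit because \<open>?R\<close> has right tight-cell
      \<open>h\<close>, which is the left tight-cell of \<open>?u\<close>.\<close>
    define \<xi> where "\<xi> = ccomp X \<chi> (tid X A) (?ip @ [?R, ?u] @ ?ir)"
    have jux: "juxtaposable X (tid X (tdom X f)) [?R, ?u] (tid X (tdom X h))"
      using fgh by simp
    note \<xi> = ccomp_whisker_frame[OF \<chi>(1) _ A(2) refl ps rs jux, folded \<xi>_def]
    have src: "src X \<chi> = ps @ map (tgt X) [?R, ?u] @ rs"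
      using src\<chi> fgh by simp
    note \<xi> = \<xi>[OF src]
    have \<xi>src: "src X \<xi> = ps @ ?t # rs" using \<xi> fgh by simp
    have ex: "ccomp X \<xi> (tid X A) (?ip @ [?m] @ ?ir) = \<chi>"
    proof -
      \<comment> \<open>In \<open>?R \<diamondop> [?m]\<close> the 2-cell \<open>?c\<close> is
        absorbed into \<open>?q\<close> from the right. The triangle identity lets it be absorbed
        into the inserted unit \<open>?u\<close> instead, and \<open>lmul ?c ?u\<close> is an
        identity.\<close>
      define Z where "Z = ccomp X \<chi> (tid X A) (?ip @ [runit X ?q, cid X ?p] @ ?ir)"
      have Z': "Z = ccomp X \<chi> (tid X A) (?ip @ [cid X ?q, lunit X ?p] @ ?ir)"
        unfolding Z_def using opcart_whisker_middle[OF \<chi>(1) src\<chi> A(2)] .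
      have "ccomp X \<xi> (tid X A) (?ip @ concat [[?m], []] @ ?ir) =
          ccomp X \<chi> (tid X A) (?ip @ [?R \<diamondop> [?m], ?u] @ ?ir)"
        unfolding \<xi>_def using w[of \<chi> "[?R, ?u]" "[[?m], []]"] \<chi> src\<chi> A fgh by (simp add: vcomp_def)
      also have "?R \<diamondop> [?m] = runit X ?q \<diamondop> [cid X ?q, ?c]"
        using m(6)[OF refl] fgh by (simp add: mul_def)
      also have "ccomp X \<chi> (tid X A) (?ip @ [runit X ?q \<diamondop> [cid X ?q, ?c], ?u] @ ?ir) =
          ccomp X Z (tid X A) (?ip @ concat [[cid X ?q, ?c], [?u]] @ ?ir)"
        unfolding Z_def using w[of \<chi> "[runit X ?q, cid X ?p]" "[[cid X ?q, ?c], [?u]]"] \<chi> src\<chi> A fgh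
        by (simp add: vcomp_def)
      also have "\<dots> = ccomp X Z (tid X A) (?ip @ concat [[cid X ?q], [?c, ?u]] @ ?ir)"
        by simp
      also have "\<dots> = ccomp X \<chi> (tid X A) (?ip @ [cid X ?q, lmul ?c ?u] @ ?ir)"
        unfolding Z' using w[of \<chi> "[cid X ?q, lunit X ?p]" "[[cid X ?q], [?c, ?u]]"] \<chi> src\<chi> A fgh
        by (simp add: lmul_def vcomp_def)
      also have "\<dots> = \<chi>"
        using lmul_comp_unit[of h ?B] ccomp_cids[OF \<chi>(1) src\<chi> A(2)] fgh by simp
      finally show ?thesis by simp
    qed
    show ?thesis
    proof
      show "opcart_factor X ?m ps rs \<chi> \<xi>"
        unfolding opcart_factor_def using \<xi> \<xi>src ex A \<chi> fgh by simp
      fix \<zeta>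
      assume "opcart_factor X ?m ps rs \<chi> \<zeta>"
      then have \<zeta>: "\<zeta> \<in> Cell X" "src X \<zeta> = ps @ [?t] @ rs" "tdom X (lft X \<zeta>) = A"
        "ccomp X \<zeta> (tid X A) (?ip @ [?m] @ ?ir) = \<chi>"
        using A m by (auto simp: opcart_factor_def)
      have "\<xi> = ccomp X (ccomp X \<zeta> (tid X A) (?ip @ [?m] @ ?ir)) (tid X A) (?ip @ concat [[?R, ?u]] @ ?ir)"
        using \<zeta>(4) by (simp add: \<xi>_def)
      also have "\<dots> = ccomp X \<zeta> (tid X A) (?ip @ [?m \<diamondop> [?R, ?u]] @ ?ir)"
        using w[of \<zeta> "[?m]" "[[?R, ?u]]"] \<zeta> fgh by (simp add: vcomp_def)
      also have "\<dots> = \<zeta>"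
        unfolding mRu using ccomp_cids[OF \<zeta>(1-3)] by simp
      finally show "\<zeta> = \<xi>" by simp
    qed
  qed
  moreover have "?m \<in> cells X (src X ?m) (tgt X ?m)"
    using m t by (intro cellsI) auto
  ultimately show ?thesis
    unfolding opcartesian_def by blast
qed

lemma hom_covar_frame [simp]:
  assumes "f \<in> Tight X" "g \<in> Tight X" "tcod X g = tcod X f" "g' \<in> Tight X" "tcod X g' = tcod X f"
    "tdom X g' = tdom X g" "\<theta> \<in> tight_cells X g g'"
  shows "hom_covar X f g g' \<theta> \<in> Cell X" "src X (hom_covar X f g g' \<theta>) = [hom X f g]"
    "tgt X (hom_covar X f g g' \<theta>) = hom X f g'" "lft X (hom_covar X f g g' \<theta>) = tid X (tdom X f)"
    "rgt X (hom_covar X f g g' \<theta>) = tid X (tdom X g)"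
    "homc X f g' \<diamondop> [hom_covar X f g g' \<theta>] = homc X f g \<cdot> (homc X g g' \<diamondop> [\<theta>])"
proof -
  note \<theta> = cellsD[OF assms(7)[unfolded tight_cells_def]]
  have "hom_covar X f g g' \<theta> = glift X (homc X f g') (homc X f g \<cdot> (homc X g g' \<diamondop> [\<theta>]))"
    using assms by (simp add: hom_covar_def mul_def)
  then show "hom_covar X f g g' \<theta> \<in> Cell X" "src X (hom_covar X f g g' \<theta>) = [hom X f g]"
    "tgt X (hom_covar X f g g' \<theta>) = hom X f g'" "lft X (hom_covar X f g g' \<theta>) = tid X (tdom X f)"
    "rgt X (hom_covar X f g g' \<theta>) = tid X (tdom X g)"
    "homc X f g' \<diamondop> [hom_covar X f g g' \<theta>] = homc X f g \<cdot> (homc X g g' \<diamondop> [\<theta>])"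
    using cart_glift[of "homc X f g'" "homc X f g \<cdot> (homc X g g' \<diamondop> [\<theta>])"] assms \<theta> by simp_all
qed

lemma hom_contravar_frame [simp]:
  assumes "f \<in> Tight X" "f' \<in> Tight X" "tcod X f' = tcod X f" "h \<in> Tight X" "tcod X h = tcod X f"
    "tdom X f' = tdom X f" "\<theta> \<in> tight_cells X f f'"
  shows "hom_contravar X f f' h \<theta> \<in> Cell X" "src X (hom_contravar X f f' h \<theta>) = [hom X f' h]"
    "tgt X (hom_contravar X f f' h \<theta>) = hom X f h" "lft X (hom_contravar X f f' h \<theta>) = tid X (tdom X f)"
    "rgt X (hom_contravar X f f' h \<theta>) = tid X (tdom X h)"
    "homc X f h \<diamondop> [hom_contravar X f f' h \<theta>] = (homc X f f' \<diamondop> [\<theta>]) \<cdot> homc X f' h"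
proof -
  note \<theta> = cellsD[OF assms(7)[unfolded tight_cells_def]]
  have "hom_contravar X f f' h \<theta> = glift X (homc X f h) ((homc X f f' \<diamondop> [\<theta>]) \<cdot> homc X f' h)"
    using assms \<theta> by (simp add: hom_contravar_def mul_def)
  then show "hom_contravar X f f' h \<theta> \<in> Cell X" "src X (hom_contravar X f f' h \<theta>) = [hom X f' h]"
    "tgt X (hom_contravar X f f' h \<theta>) = hom X f h" "lft X (hom_contravar X f f' h \<theta>) = tid X (tdom X f)"
    "rgt X (hom_contravar X f f' h \<theta>) = tid X (tdom X h)"
    "homc X f h \<diamondop> [hom_contravar X f f' h \<theta>] = (homc X f f' \<diamondop> [\<theta>]) \<cdot> homc X f' h"
    using cart_glift[of "homc X f h" "(homc X f f' \<diamondop> [\<theta>]) \<cdot> homc X f' h"] assms \<theta> by simp_all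
qed

lemma hom_act_frame [simp]:
  assumes "r \<in> Tight X" "f \<in> Tight X" "g \<in> Tight X" "tcod X f = tdom X r" "tcod X g = tdom X r"
  shows "hom_act X r f g \<in> Cell X" "src X (hom_act X r f g) = [hom X f g]"
    "tgt X (hom_act X r f g) = hom X (r \<bullet> f) (r \<bullet> g)" "lft X (hom_act X r f g) = tid X (tdom X f)"
    "rgt X (hom_act X r f g) = tid X (tdom X g)"
    "homc X (r \<bullet> f) (r \<bullet> g) \<diamondop> [hom_act X r f g] = tact r \<diamondop> [homc X f g]"
proof -
  let ?I = "lidc X (tdom X r)"
  define D where "D = desc X ?I [] [] (cap X r)"
  have "opcart_factor X ?I [] [] (cap X r) D"
    unfolding D_def using assms by (intro opcart_desc) auto
  then have D: "D \<in> Cell X" "src X D = [lid X (tdom X r)]" "tgt X D = hom X r r"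
    "lft X D = tid X (tdom X r)" "rgt X D = tid X (tdom X r)" "D \<diamondop> [?I] = cap X r"
    using assms by (simp_all add: opcart_factor_def vcomp_def)
  \<comment> \<open>Both sides give \<open>unitc r\<close> along \<open>lidc\<close>, so the action
    built from \<open>cap X r\<close> is whiskering by \<open>r\<close>.\<close>
  have rD: "homc X r r \<diamondop> [D] = tact r"
    using assms D by (intro opcart_cancel1[of ?I "homc X r r \<diamondop> [D]" "tact r"]) (simp_all add: vcomp_assoc1)
  let ?h = "homr X r r f g" and ?x = "D \<diamondop> [homc X f g]"
  have a: "hom_act X r f g = glift X ?h ?x"
    by (simp add: hom_act_def restrict_cell_def D_def)
  show *: "hom_act X r f g \<in> Cell X" "src X (hom_act X r f g) = [hom X f g]"
    "tgt X (hom_act X r f g) = hom X (r \<bullet> f) (r \<bullet> g)" "lft X (hom_act X r f g) = tid X (tdom X f)"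
    "rgt X (hom_act X r f g) = tid X (tdom X g)"
    unfolding a using cart_glift[of ?h ?x] assms D by simp_all
  have "?h \<diamondop> [hom_act X r f g] = ?x"
    unfolding a using cart_glift[of ?h ?x] assms D by simp
  moreover have "homc X r r \<diamondop> [?h \<diamondop> [hom_act X r f g]] = homc X (r \<bullet> f) (r \<bullet> g) \<diamondop> [hom_act X r f g]"
    using * assms vcomp_assoc1[of "homc X r r" ?h "hom_act X r f g"] by simp
  moreover have "homc X r r \<diamondop> [?x] = tact r \<diamondop> [homc X f g]"
    using assms D rD vcomp_assoc1[of "homc X r r" D "homc X f g"] by simp
  ultimately show "homc X (r \<bullet> f) (r \<bullet> g) \<diamondop> [hom_act X r f g] = tact r \<diamondop> [homc X f g]"
    by simp
qed

lemma cup_eq: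
  "f \<in> Tight X \<Longrightarrow> tcod X f = B \<Longrightarrow> cup X f = homc X (tid X B) f \<cdot> homc X f (tid X B)"
  using tcod_closed[of f] by (simp add: cup_def mul_def)

end

section \<open>Relative adjunctions\<close>

context virtual_equipment
begin

lemma hom_eq_iff:
  assumes "f \<in> Tight X" "g \<in> Tight X" "tcod X g = tcod X f"
    "\<alpha> \<in> Cell X" "\<beta> \<in> Cell X" "tgt X \<alpha> = hom X f g" "tgt X \<beta> = hom X f g"
    "lft X \<beta> = lft X \<alpha>" "rgt X \<beta> = rgt X \<alpha>"
  shows "\<alpha> = \<beta> \<longleftrightarrow> homc X f g \<diamondop> [\<alpha>] = homc X f g \<diamondop> [\<beta>]"
  using hom_cancel[OF assms] by auto

end

locale relative_adjunction_data = virtual_equipment X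
  for X :: "('o, 't, 'l, 'c, 'z) equipment_scheme" (structure) +
  fixes A C E :: 'o and j l r :: 't
  assumes objects [simp]: "A \<in> Obj X" "C \<in> Obj X" "E \<in> Obj X"
    and j [simp]: "j \<in> Tight X" "tdom X j = A" "tcod X j = E"
    and l [simp]: "l \<in> Tight X" "tdom X l = A" "tcod X l = C"
    and r [simp]: "r \<in> Tight X" "tdom X r = C" "tcod X r = E"
begin

abbreviation "K \<equiv> hom X l (tid X C)"
abbreviation "L \<equiv> hom X (tid X C) l"
abbreviation "P \<equiv> hom X j r"
abbreviation "\<kappa> \<equiv> homc X l (tid X C)"
abbreviation "\<mu> \<equiv> homc X (tid X C) l"
abbreviation "\<rho> \<equiv> homc X j r"

text \<open>A unit \<open>\<eta> : () \<Rightarrow> E(j, r l)\<close>, viewed as a 2-cell into \<open>E(1, 1)\<close> and into \<open>E(j, r)\<close>.\<close>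

abbreviation "ue \<eta> \<equiv> homc X j (r \<bullet> l) \<diamondop> [\<eta>]"
abbreviation "up \<eta> \<equiv> homr X j r (tid X A) l \<diamondop> [\<eta>]"

lemma conjoint_eq [simp]: "conjoint X l = K"
  by (simp add: conjoint_def)

lemma companion_eq [simp]: "companion X l = L"
  by (simp add: companion_def)

lemma sharpD:
  assumes "sharp \<in> cells X [K] P"
  shows "sharp \<in> Cell X" "src X sharp = [K]" "tgt X sharp = P" "lft X sharp = tid X A" "rgt X sharp = tid X C"
  using cellsD[OF assms] by simp_all

lemma flatD:
  assumes "flat \<in> cells X [P] K"
  shows "flat \<in> Cell X" "src X flat = [P]" "tgt X flat = K" "lft X flat = tid X A" "rgt X flat = tid X C"
  using cellsD[OF assms] by simp_all

lemma unitD: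
  assumes "\<eta> \<in> tight_cells X j (r \<bullet> l)"
  shows "\<eta> \<in> Cell X" "src X \<eta> = []" "tgt X \<eta> = hom X j (r \<bullet> l)" "lft X \<eta> = tid X A" "rgt X \<eta> = tid X A"
  using cellsD[OF assms[unfolded tight_cells_def]] by simp_all

lemma counitD:
  assumes "\<epsilon> \<in> cells X [L, P] (lid X C)"
  shows "\<epsilon> \<in> Cell X" "src X \<epsilon> = [L, P]" "tgt X \<epsilon> = lid X C" "lft X \<epsilon> = tid X C" "rgt X \<epsilon> = tid X C"
  using cellsD[OF assms] by simp_all

lemma up_eq:
  assumes "\<eta> \<in> tight_cells X j (r \<bullet> l)"
  shows "\<rho> \<diamondop> [up \<eta>] = ue \<eta>"
  using unitD[OF assms] vcomp_assoc1[of \<rho> "homr X j r (tid X A) l" \<eta>] by simp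

text \<open>Both sides become \<open>unitc l\<close> in the loose-identity: moving the second
  \<open>l\<close> of \<open>C(l, l)\<close> out into a tight-cell turns the cap into the unit of
  the conjoint.\<close>

lemma homr_cap: "homr X l (tid X C) (tid X A) l \<diamondop> [cap X l] = conj_unit l"
  using vcomp_assoc1[of \<kappa> "homr X l (tid X C) (tid X A) l" "cap X l"]
  by (intro hom_cancel[of l "tid X C" "homr X l (tid X C) (tid X A) l \<diamondop> [cap X l]" "conj_unit l"]) simp_all

lemma unit_of:
  assumes "sharp \<in> cells X [K] P"
  shows "unit_of X j l r sharp \<in> tight_cells X j (r \<bullet> l)"
    "up (unit_of X j l r sharp) = sharp \<diamondop> [conj_unit l]"
proof -
  note s = sharpD[OF assms]
  let ?h = "homr X j r (tid X A) l" and ?h' = "homr X l (tid X C) (tid X A) l"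
  define G where "G = glift X ?h (sharp \<diamondop> [?h'])"
  have G: "G \<in> Cell X" "src X G = [hom X l l]" "tgt X G = hom X j (r \<bullet> l)" "lft X G = tid X A" "rgt X G = tid X A"
    "?h \<diamondop> [G] = sharp \<diamondop> [?h']"
    unfolding G_def using cart_glift[of ?h "sharp \<diamondop> [?h']"] s by simp_all
  have u: "unit_of X j l r sharp = G \<diamondop> [cap X l]"
    by (simp add: unit_of_def restrict_cell_def G_def)
  show "unit_of X j l r sharp \<in> tight_cells X j (r \<bullet> l)"
    unfolding u tight_cells_def using G by (intro cellsI) simp_all
  show "up (unit_of X j l r sharp) = sharp \<diamondop> [conj_unit l]"
    unfolding u using vcomp_assoc1[of ?h G "cap X l"] vcomp_assoc1[of sharp ?h' "cap X l"] G s homr_cap by simp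
qed

text \<open>The Yoneda lemma for \<open>\<rho> \<diamondop> [sharp]\<close>, whose right tight-cell
  is \<open>r\<close>; hence the whiskering of \<open>\<kappa>\<close> by \<open>r\<close>.\<close>

lemma unit_of_mul:
  assumes "sharp \<in> cells X [K] P"
  shows "ue (unit_of X j l r sharp) \<cdot> (tact r \<diamondop> [\<kappa>]) = \<rho> \<diamondop> [sharp]"
proof -
  note s = sharpD[OF assms] and u = unit_of[OF assms]
  have "ue (unit_of X j l r sharp) = \<rho> \<diamondop> [sharp] \<diamondop> [conj_unit l]"
    using up_eq[OF u(1)] u(2) s vcomp_assoc1[of \<rho> sharp "conj_unit l"] by simp
  then show ?thesis
    using conjoint_yoneda[of l C "\<rho> \<diamondop> [sharp]"] s by simp
qed

lemma bij_unit_of: "bij_betw (unit_of X j l r) (cells X [K] P) (tight_cells X j (r \<bullet> l))"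
proof -
  \<comment> \<open>The inverse is dictated by \<open>unit_of_mul\<close>, which prescribes
    \<open>\<rho> \<diamondop> [sharp]\<close>; as \<open>\<rho>\<close> is cartesian, this
    determines \<open>sharp\<close>.\<close>
  define g where "g \<eta> = glift X \<rho> (ue \<eta> \<cdot> (tact r \<diamondop> [\<kappa>]))" for \<eta>
  show ?thesis
  proof (rule bij_betw_byWitness[where f'=g])
    have g: "g \<eta> \<in> cells X [K] P" "\<rho> \<diamondop> [g \<eta>] = ue \<eta> \<cdot> (tact r \<diamondop> [\<kappa>])"
      if "\<eta> \<in> tight_cells X j (r \<bullet> l)" for \<eta>
      using unitD[OF that] cart_glift[of \<rho> "ue \<eta> \<cdot> (tact r \<diamondop> [\<kappa>])"]
      by (auto intro!: cellsI simp: g_def)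
    show "g ` tight_cells X j (r \<bullet> l) \<subseteq> cells X [K] P" using g by auto
    show "unit_of X j l r ` cells X [K] P \<subseteq> tight_cells X j (r \<bullet> l)" using unit_of by auto
    show "\<forall>s\<in>cells X [K] P. g (unit_of X j l r s) = s"
    proof
      fix s assume s: "s \<in> cells X [K] P"
      show "g (unit_of X j l r s) = s"
        using sharpD[OF s] sharpD[OF g(1)[OF unit_of(1)[OF s]]] g(2)[OF unit_of(1)[OF s]] unit_of_mul[OF s]
        by (intro hom_cancel[of j r "g (unit_of X j l r s)" s]) simp_all
    qed
    show "\<forall>\<eta>\<in>tight_cells X j (r \<bullet> l). unit_of X j l r (g \<eta>) = \<eta>"
    proof
      fix \<eta> assume \<eta>: "\<eta> \<in> tight_cells X j (r \<bullet> l)"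
      note s = sharpD[OF g(1)[OF \<eta>]] and u = unit_of[OF g(1)[OF \<eta>]] and e = unitD[OF \<eta>]
      have "ue (unit_of X j l r (g \<eta>)) = (ue \<eta> \<cdot> (tact r \<diamondop> [\<kappa>])) \<diamondop> [conj_unit l]"
        using up_eq[OF u(1)] u(2) s g(2)[OF \<eta>] vcomp_assoc1[of \<rho> "g \<eta>" "conj_unit l"] by simp
      \<comment> \<open>As \<open>\<eta>\<close> is nullary, \<open>conj_unit l\<close> meets only
        the second factor, where \<open>\<kappa>\<close> turns it into
        \<open>unitc l\<close>.\<close>
      also have "\<dots> = ue \<eta> \<cdot> (tact r \<diamondop> [\<kappa>] \<diamondop> [conj_unit l])"
        using e by (intro mul_vcomp_nil) simp_all
      also have "\<dots> = ue \<eta>"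
        using e vcomp_assoc1[of "tact r" \<kappa> "conj_unit l"] by simp
      finally show "unit_of X j l r (g \<eta>) = \<eta>"
        using e unitD[OF u(1)]
        by (intro hom_cancel[of j "r \<bullet> l" "unit_of X j l r (g \<eta>)" \<eta>]) simp_all
    qed
  qed
qed

lemma counit_of:
  assumes "flat \<in> cells X [P] K"
  shows "counit_of X l flat \<in> cells X [L, P] (lid X C)" "counit_of X l flat = \<mu> \<cdot> (\<kappa> \<diamondop> [flat])"
proof -
  note f = flatD[OF assms]
  show eq: "counit_of X l flat = \<mu> \<cdot> (\<kappa> \<diamondop> [flat])"
    using f mul_vcomp[of \<mu> \<kappa> "cid X L" flat] by (simp add: counit_of_def cup_eq[of l C])
  show "counit_of X l flat \<in> cells X [L, P] (lid X C)"
    unfolding eq using f by (intro cellsI) simp_all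
qed

text \<open>In the first slot \<open>\<mu>\<close> meets \<open>comp_unit l\<close> and becomes the
  neutral \<open>unitc l\<close>. This evaluation is what inverts \<open>counit_of\<close>.\<close>

lemma counit_of_unit:
  assumes "flat \<in> cells X [P] K"
  shows "counit_of X l flat \<diamondop> [comp_unit l, cid X P] = \<kappa> \<diamondop> [flat]"
  using flatD[OF assms] counit_of[OF assms] by (simp add: mul_vcomp)

lemma bij_counit_of: "bij_betw (counit_of X l) (cells X [P] K) (cells X [L, P] (lid X C))"
proof -
  define g where "g \<epsilon> = glift X \<kappa> (\<epsilon> \<diamondop> [comp_unit l, cid X P])" for \<epsilon>
  show ?thesis
  proof (rule bij_betw_byWitness[where f'=g])
    have g: "g \<epsilon> \<in> cells X [P] K" "\<kappa> \<diamondop> [g \<epsilon>] = \<epsilon> \<diamondop> [comp_unit l, cid X P]"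
      if "\<epsilon> \<in> cells X [L, P] (lid X C)" for \<epsilon>
      using counitD[OF that] cart_glift[of \<kappa> "\<epsilon> \<diamondop> [comp_unit l, cid X P]"]
      by (auto intro!: cellsI simp: g_def)
    show "g ` cells X [L, P] (lid X C) \<subseteq> cells X [P] K" using g by auto
    show "counit_of X l ` cells X [P] K \<subseteq> cells X [L, P] (lid X C)" using counit_of by auto
    show "\<forall>s\<in>cells X [P] K. g (counit_of X l s) = s"
    proof
      fix s assume s: "s \<in> cells X [P] K"
      show "g (counit_of X l s) = s"
        using flatD[OF s] flatD[OF g(1)[OF counit_of(1)[OF s]]] g(2)[OF counit_of(1)[OF s]] counit_of_unit[OF s]
        by (intro hom_cancel[of l "tid X C" "g (counit_of X l s)" s]) simp_all
    qed
    show "\<forall>\<epsilon>\<in>cells X [L, P] (lid X C). counit_of X l (g \<epsilon>) = \<epsilon>"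
    proof
      fix \<epsilon> assume \<epsilon>: "\<epsilon> \<in> cells X [L, P] (lid X C)"
      note e = counitD[OF \<epsilon>]
      have "\<epsilon> = lmul \<mu> (\<epsilon> \<diamondop> [comp_unit l, cid X P])"
        using companion_yoneda[of l C \<epsilon> P] e by simp
      \<comment> \<open>The Yoneda lemma produces \<open>lmul\<close>, which agrees with
        \<open>\<cdot>\<close> because both factors end in \<open>C(1, 1)\<close>.\<close>
      also have "\<dots> = \<mu> \<cdot> (\<kappa> \<diamondop> [g \<epsilon>])"
        using e g(2)[OF \<epsilon>] by (subst lmul_form[where B=C]) simp_all
      finally show "counit_of X l (g \<epsilon>) = \<epsilon>"
        using counit_of(2)[OF g(1)[OF \<epsilon>]] by simp
    qed
  qed
qed

text \<open>By the Yoneda lemma for the conjoint, a 2-cell out of \<open>C(l, 1)\<close> such as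
  \<open>\<kappa> \<diamondop> [flat] \<diamondop> [sharp]\<close> is tested on
  \<open>conj_unit l\<close>, where \<open>\<kappa>\<close> itself gives
  \<open>unitc l\<close>.\<close>

lemma flat_sharp_iff:
  assumes "sharp \<in> cells X [K] P" "flat \<in> cells X [P] K"
  shows "flat \<diamondop> [sharp] = cid X K \<longleftrightarrow> \<kappa> \<diamondop> [flat] \<diamondop> [up (unit_of X j l r sharp)] = unitc l"
proof -
  note s = sharpD[OF assms(1)] and f = flatD[OF assms(2)] and u = unit_of[OF assms(1)]
  let ?\<chi> = "\<kappa> \<diamondop> [flat] \<diamondop> [sharp]"
  have "?\<chi> \<diamondop> [conj_unit l] = \<kappa> \<diamondop> [flat] \<diamondop> [up (unit_of X j l r sharp)]"
    using u(2) s f vcomp_assoc1[of "\<kappa> \<diamondop> [flat]" sharp "conj_unit l"] by simp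
  moreover have "?\<chi> = \<kappa> \<longleftrightarrow> ?\<chi> \<diamondop> [conj_unit l] = unitc l"
    using conjoint_yoneda[of l C ?\<chi>] s f by auto
  moreover have "flat \<diamondop> [sharp] = cid X K \<longleftrightarrow> ?\<chi> = \<kappa>"
    using s f vcomp_assoc1[of \<kappa> flat sharp]
    by (subst hom_eq_iff[of l "tid X C"]) simp_all
  ultimately show ?thesis by simp
qed

text \<open>The source is now \<open>E(j, r)\<close>, to which the Yoneda lemma does not directly
  apply. Instead the formula for \<open>\<rho> \<diamondop> [sharp]\<close> is precomposed with
  \<open>flat\<close>, which passes the nullary unit and meets only \<open>\<kappa>\<close>.\<close>

lemma sharp_flat_iff:
  assumes "sharp \<in> cells X [K] P" "flat \<in> cells X [P] K"
  shows "sharp \<diamondop> [flat] = cid X P \<longleftrightarrow>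
    ue (unit_of X j l r sharp) \<cdot> (tact r \<diamondop> [\<kappa> \<diamondop> [flat]]) = \<rho>"
proof -
  note s = sharpD[OF assms(1)] and f = flatD[OF assms(2)] and u = unit_of[OF assms(1)]
  note e = unitD[OF u(1)]
  have "\<rho> \<diamondop> [sharp \<diamondop> [flat]] = (ue (unit_of X j l r sharp) \<cdot> (tact r \<diamondop> [\<kappa>])) \<diamondop> [flat]"
    using s f unit_of_mul[OF assms(1)] vcomp_assoc1[of \<rho> sharp flat] by simp
  also have "\<dots> = ue (unit_of X j l r sharp) \<cdot> (tact r \<diamondop> [\<kappa>] \<diamondop> [flat])"
    using e f by (intro mul_vcomp_nil) simp_all
  also have "tact r \<diamondop> [\<kappa>] \<diamondop> [flat] = tact r \<diamondop> [\<kappa> \<diamondop> [flat]]"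
    using f by (simp add: vcomp_assoc1)
  finally have "\<rho> \<diamondop> [sharp \<diamondop> [flat]] = ue (unit_of X j l r sharp) \<cdot> (tact r \<diamondop> [\<kappa> \<diamondop> [flat]])" .
  moreover have "sharp \<diamondop> [flat] = cid X P \<longleftrightarrow> \<rho> \<diamondop> [sharp \<diamondop> [flat]] = \<rho>"
    using s f by (subst hom_eq_iff[of j r]) simp_all
  ultimately show ?thesis by simp
qed

lemma relative_adjunction_iff:
  "relative_adjunction X j l r sharp flat \<longleftrightarrow>
    sharp \<in> cells X [K] P \<and> flat \<in> cells X [P] K \<and> flat \<diamondop> [sharp] = cid X K \<and> sharp \<diamondop> [flat] = cid X P"
  by (simp add: relative_adjunction_def)

text \<open>The two equations to which every presentation reduces, for a unit \<open>\<eta>\<close> and \<open>flat : E(j, r) \<Rightarrow> C(l, 1)\<close>.\<close>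

definition unit_law :: "'c \<Rightarrow> 'c \<Rightarrow> bool" where
  "unit_law \<eta> flat \<longleftrightarrow> \<kappa> \<diamondop> [flat] \<diamondop> [up \<eta>] = unitc l"

definition counit_law :: "'c \<Rightarrow> 'c \<Rightarrow> bool" where
  "counit_law \<eta> flat \<longleftrightarrow> ue \<eta> \<cdot> (tact r \<diamondop> [\<kappa> \<diamondop> [flat]]) = \<rho>"

lemma relative_adjunction_laws:
  "relative_adjunction X j l r sharp flat \<longleftrightarrow>
    sharp \<in> cells X [K] P \<and> flat \<in> cells X [P] K \<and>
    unit_law (unit_of X j l r sharp) flat \<and> counit_law (unit_of X j l r sharp) flat"
  unfolding relative_adjunction_iff unit_law_def counit_law_def
  using flat_sharp_iff sharp_flat_iff by blast

end

section \<open>Reduction of the presentations to the two laws\<close>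

context relative_adjunction_data
begin

text \<open>The cap is the identity of \<open>j\<close>, so composing with it evaluates
  \<open>E(j, \<eta>)\<close> at an identity; the detour through \<open>E(j, j)\<close> in the laws
  disappears.\<close>

lemma hom_covar_cap:
  assumes "\<eta> \<in> tight_cells X j (r \<bullet> l)"
  shows "hom_covar X j j (r \<bullet> l) \<eta> \<diamondop> [cap X j] = \<eta>"
proof -
  note e = unitD[OF assms]
  let ?h = "hom_covar X j j (r \<bullet> l) \<eta>"
  have h: "?h \<in> Cell X" "src X ?h = [hom X j j]" "tgt X ?h = hom X j (r \<bullet> l)" "lft X ?h = tid X A"
    "rgt X ?h = tid X A" "homc X j (r \<bullet> l) \<diamondop> [?h] = homc X j j \<cdot> ue \<eta>"
    using assms by simp_all
  have "ue (?h \<diamondop> [cap X j]) = (homc X j j \<cdot> ue \<eta>) \<diamondop> [cap X j]"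
    using h vcomp_assoc1[of "homc X j (r \<bullet> l)" ?h "cap X j"] by simp
  also have "\<dots> = ccomp X (homc X j j) (tid X A) [cap X j] \<cdot> ccomp X (ue \<eta>) (tid X A) []"
    using ccomp_mul[of "homc X j j" "ue \<eta>" "tid X A" "[cap X j]" "tid X A" "[]" "tid X A"] e
    by (simp add: vcomp_def[of X _ "[cap X j]"])
  also have "\<dots> = ue \<eta>"
    using e cap_frame(6)[of j] by (simp add: vcomp_def[of X _ "[cap X j]"])
  finally show ?thesis
    using e h by (intro hom_cancel[of j "r \<bullet> l" "?h \<diamondop> [cap X j]" \<eta>]) simp_all
qed

lemma universal_arrow_iff:
  "universal_arrow X j l r \<eta> flat \<longleftrightarrow>
    \<eta> \<in> tight_cells X j (r \<bullet> l) \<and> flat \<in> cells X [P] K \<and> unit_law \<eta> flat \<and> counit_law \<eta> flat"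
\<comment> \<open>If the data do not have the right frames, both sides are false.\<close>
proof (cases "\<eta> \<in> tight_cells X j (r \<bullet> l) \<and> flat \<in> cells X [P] K")
  case True
  then have \<eta>: "\<eta> \<in> tight_cells X j (r \<bullet> l)" and flat: "flat \<in> cells X [P] K" by auto
  note e = unitD[OF \<eta>] and f = flatD[OF flat]
  let ?h = "homr X j r (tid X A) l" and ?h' = "homr X l (tid X C) (tid X A) l"
  define G where "G = restrict_cell X flat [?h] ?h'"
  have G: "G \<in> Cell X" "src X G = [hom X j (r \<bullet> l)]" "tgt X G = hom X l l" "lft X G = tid X A" "rgt X G = tid X A"
    "?h' \<diamondop> [G] = flat \<diamondop> [?h]"
    unfolding G_def restrict_cell_def using cart_glift[of ?h' "flat \<diamondop> [?h]"] f by simp_all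
  \<comment> \<open>First law: \<open>G\<close> is \<open>flat(1, l)\<close>, and
    \<open>\<kappa>\<close> after \<open>?h'\<close> removes the restriction that defines
    it.\<close>
  have "homc X l l \<diamondop> [G \<diamondop> [\<eta>]] = \<kappa> \<diamondop> [?h' \<diamondop> [G \<diamondop> [\<eta>]]]"
    using G e vcomp_assoc1[of \<kappa> ?h' "G \<diamondop> [\<eta>]"] by simp
  also have "?h' \<diamondop> [G \<diamondop> [\<eta>]] = flat \<diamondop> [up \<eta>]"
    using G e f vcomp_assoc1[of ?h' G \<eta>] vcomp_assoc1[of flat ?h \<eta>] by simp
  also have "\<kappa> \<diamondop> [flat \<diamondop> [up \<eta>]] = \<kappa> \<diamondop> [flat] \<diamondop> [up \<eta>]"
    using e f vcomp_assoc1[of \<kappa> flat "up \<eta>"] by simp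
  finally have 1: "G \<diamondop> [\<eta>] = cap X l \<longleftrightarrow> unit_law \<eta> flat"
    unfolding unit_law_def using G e by (subst hom_eq_iff[of l l]) simp_all
  define c where "c = hom_contravar X j (r \<bullet> l) r \<eta>"
  define a where "a = hom_act X r l (tid X C)"
  have c: "c \<in> Cell X" "src X c = [hom X (r \<bullet> l) r]" "tgt X c = P" "lft X c = tid X A"
    "rgt X c = tid X C" "\<rho> \<diamondop> [c] = ue \<eta> \<cdot> homc X (r \<bullet> l) r"
    unfolding c_def using \<eta> by simp_all
  have a: "a \<in> Cell X" "src X a = [K]" "tgt X a = hom X (r \<bullet> l) r" "lft X a = tid X A"
    "rgt X a = tid X C" "homc X (r \<bullet> l) r \<diamondop> [a] = tact r \<diamondop> [\<kappa>]"
    unfolding a_def using hom_act_frame(6)[of r l "tid X C"] by simp_all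
  \<comment> \<open>Second law: \<open>c\<close> pastes \<open>\<eta>\<close> on the left,
    \<open>a\<close> whiskers \<open>\<kappa>\<close> by \<open>r\<close>, and \<open>flat\<close>
    passes the nullary \<open>\<eta>\<close>.\<close>
  have "\<rho> \<diamondop> [c \<diamondop> [a \<diamondop> [flat]]] = (ue \<eta> \<cdot> homc X (r \<bullet> l) r) \<diamondop> [a \<diamondop> [flat]]"
    unfolding c(6)[symmetric] using c(1-5) a(1-5) f by (intro vcomp_assoc1[symmetric]) simp_all
  also have "\<dots> = ue \<eta> \<cdot> (homc X (r \<bullet> l) r \<diamondop> [a \<diamondop> [flat]])"
    using e a f by (intro mul_vcomp_nil) simp_all
  also have "homc X (r \<bullet> l) r \<diamondop> [a \<diamondop> [flat]] = tact r \<diamondop> [\<kappa> \<diamondop> [flat]]"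
    using a f vcomp_assoc1[of "homc X (r \<bullet> l) r" a flat] vcomp_assoc1[of "tact r" \<kappa> flat] by simp
  finally have 2: "c \<diamondop> [a \<diamondop> [flat]] = cid X P \<longleftrightarrow> counit_law \<eta> flat"
    unfolding counit_law_def using c a f by (subst hom_eq_iff[of j r]) simp_all
  show ?thesis
    using 1 2 \<eta> flat unfolding universal_arrow_def Let_def
    by (simp add: hom_covar_cap G_def c_def a_def)
qed (auto simp: universal_arrow_def Let_def)

text \<open>The counit is \<open>\<mu>\<close> pasted with
  \<open>\<kappa> \<diamondop> [flat]\<close>, and \<open>\<mu>\<close> can be cancelled. Both the
  unit-counit presentation and the loose-adjunction have a zig-zag law ending in
  \<open>C(1, l)\<close>, and each comes down to this equation.\<close>

lemma counit_up:
  assumes "\<eta> \<in> tight_cells X j (r \<bullet> l)" "flat \<in> cells X [P] K"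
  shows "counit_of X l flat \<diamondop> [cid X L, up \<eta>] = \<mu> \<longleftrightarrow> unit_law \<eta> flat"
proof -
  note e = unitD[OF assms(1)] and f = flatD[OF assms(2)]
  let ?\<phi> = "\<kappa> \<diamondop> [flat] \<diamondop> [up \<eta>]"
  have "counit_of X l flat \<diamondop> [cid X L, up \<eta>] = \<mu> \<cdot> ?\<phi>"
    using e f counit_of(2)[OF assms(2)] by (simp add: mul_vcomp)
  moreover have "\<mu> \<cdot> ?\<phi> = \<mu> \<cdot> unitc l \<longleftrightarrow> ?\<phi> = unitc l"
    using e f by (intro companion_mul_eq_iff) simp_all
  ultimately show ?thesis
    by (simp add: unit_law_def)
qed

lemma tact_counit:
  assumes "flat \<in> cells X [P] K"
  shows "tact r \<diamondop> [counit_of X l flat] = (tact r \<diamondop> [\<mu>]) \<cdot> (tact r \<diamondop> [\<kappa> \<diamondop> [flat]])"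
  using flatD[OF assms] counit_of(2)[OF assms] by (simp add: vcomp_mul)

text \<open>Restricting to counits of the form \<open>counit_of X l flat\<close> loses nothing,
  because \<open>bij_counit_of\<close> shows that every counit arises in this way.\<close>

lemma unit_counit_iff:
  assumes flat: "flat \<in> cells X [P] K"
  shows "unit_counit X j l r \<eta> (counit_of X l flat) \<longleftrightarrow>
    \<eta> \<in> tight_cells X j (r \<bullet> l) \<and> unit_law \<eta> flat \<and> counit_law \<eta> flat"
proof (cases "\<eta> \<in> tight_cells X j (r \<bullet> l)")
  case \<eta>: True
  note e = unitD[OF \<eta>] and f = flatD[OF flat] and \<epsilon> = counitD[OF counit_of(1)[OF flat]]
  let ?\<epsilon> = "counit_of X l flat" and ?\<phi> = "tact r \<diamondop> [\<kappa> \<diamondop> [flat]]"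
  let ?h = "homr X j r (tid X A) l"
  define G where "G = restrict_cell X ?\<epsilon> [cid X L, ?h] \<mu>"
  have G: "G \<in> Cell X" "src X G = [L, hom X j (r \<bullet> l)]" "tgt X G = L" "lft X G = tid X C" "rgt X G = tid X A"
    "\<mu> \<diamondop> [G] = ?\<epsilon> \<diamondop> [cid X L, ?h]"
    unfolding G_def restrict_cell_def using cart_glift[of \<mu> "?\<epsilon> \<diamondop> [cid X L, ?h]"] \<epsilon> by simp_all
  have "\<mu> \<diamondop> [G \<diamondop> [cid X L, \<eta>]] = ?\<epsilon> \<diamondop> [cid X L, up \<eta>]"
    using G e \<epsilon> vcomp_assoc12[of \<mu> G "cid X L" \<eta>] by (simp add: vcomp_assoc2)
  then have 1: "G \<diamondop> [cid X L, \<eta>] = cid X L \<longleftrightarrow> unit_law \<eta> flat"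
    using counit_up[OF \<eta> flat] G e by (subst hom_eq_iff[of "tid X C" l]) simp_all
  let ?M = "hom X (tid X E) r" and ?\<mu>r = "homc X (tid X E) r"
  let ?J = "hom X (tid X E) j" and ?\<mu>j = "homc X (tid X E) j" and ?\<mu>rl = "homc X (tid X E) (r \<bullet> l)"
  define m where "m = hom_comp X (tid X E) r l"
  define c where "c = hom_comp X j (tid X E) r"
  define hc where "hc = hom_covar X (tid X E) j (r \<bullet> l) \<eta>"
  define D where "D = desc X m [] [P] (cid X ?M \<cdot> ?\<epsilon>)"
  have m: "src X m = [?M, L]" "tgt X m = hom X (tid X E) (r \<bullet> l)" "lft X m = tid X E" "rgt X m = tid X A"
    "m \<in> Cell X" "?\<mu>rl \<diamondop> [m] = ?\<mu>r \<cdot> (tact r \<diamondop> [\<mu>])"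
    unfolding m_def by simp_all
  have c: "src X c = [hom X j (tid X E), ?M]" "tgt X c = P" "lft X c = tid X A" "rgt X c = tid X C"
    "c \<in> Cell X"
    unfolding c_def by simp_all
  have hc: "src X hc = [?J]" "tgt X hc = hom X (tid X E) (r \<bullet> l)" "lft X hc = tid X E"
    "rgt X hc = tid X A" "hc \<in> Cell X" "?\<mu>rl \<diamondop> [hc] = ?\<mu>j \<cdot> ue \<eta>"
    unfolding hc_def using \<eta> by simp_all
  have mo: "opcartesian X m" and co: "opcartesian X c"
    unfolding m_def c_def by (rule hom_comp_opcartesian; simp)+
  have D: "D \<in> Cell X" "src X D = [hom X (tid X E) (r \<bullet> l), P]" "tgt X D = ?M" "lft X D = tid X E" "rgt X D = tid X C"
    "D \<diamondop> [m, cid X P] = cid X ?M \<cdot> ?\<epsilon>"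
    unfolding D_def using opcart_desc_left[OF mo, of "cid X ?M \<cdot> ?\<epsilon>" P] \<epsilon> m by simp_all
  \<comment> \<open>\<open>D\<close> is known only through the opcartesian \<open>m\<close>.
    Precomposed with \<open>m\<close>, both sides are the triple pasting of \<open>?\<mu>r\<close>,
    whiskered \<open>\<mu>\<close> and \<open>?\<phi>\<close>, bracketed differently.\<close>
  have \<mu>D: "?\<mu>r \<diamondop> [D] = ?\<mu>rl \<cdot> ?\<phi>"
  proof (rule opcart_cancel_left[OF mo, of _ P])
    have "?\<mu>r \<diamondop> [D] \<diamondop> [m, cid X P] = ?\<mu>r \<diamondop> [cid X ?M \<cdot> ?\<epsilon>]"
      using D m by (simp add: vcomp_assoc12)
    also have "\<dots> = ?\<mu>r \<cdot> ((tact r \<diamondop> [\<mu>]) \<cdot> ?\<phi>)"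
      using \<epsilon> tact_counit[OF flat] by (simp add: vcomp_mul)
    also have "\<dots> = (?\<mu>r \<cdot> (tact r \<diamondop> [\<mu>])) \<cdot> ?\<phi>"
      using f by (simp add: mul_assoc)
    also have "\<dots> = (?\<mu>rl \<cdot> ?\<phi>) \<diamondop> [m, cid X P]"
      using f m by (simp add: mul_vcomp)
    finally show "?\<mu>r \<diamondop> [D] \<diamondop> [m, cid X P] = (?\<mu>rl \<cdot> ?\<phi>) \<diamondop> [m, cid X P]" .
  qed (use D f m in simp_all)
  have lhs: "?\<mu>r \<diamondop> [D \<diamondop> [hc, c]] = ?\<mu>j \<cdot> ((ue \<eta> \<cdot> ?\<phi>) \<diamondop> [c])"
  proof -
    have "?\<mu>r \<diamondop> [D \<diamondop> [hc, c]] = (?\<mu>rl \<cdot> ?\<phi>) \<diamondop> [hc, c]"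
      using D hc c \<mu>D vcomp_assoc12[of ?\<mu>r D hc c] by simp
    also have "\<dots> = (?\<mu>rl \<diamondop> [hc]) \<cdot> (?\<phi> \<diamondop> [c])"
      using hc c f by (intro mul_vcomp) simp_all
    also have "\<dots> = ?\<mu>j \<cdot> (ue \<eta> \<cdot> (?\<phi> \<diamondop> [c]))"
      using hc c f e by (simp add: mul_assoc)
    also have "ue \<eta> \<cdot> (?\<phi> \<diamondop> [c]) = (ue \<eta> \<cdot> ?\<phi>) \<diamondop> [c]"
      using c f e by (intro mul_vcomp_nil[symmetric]) simp_all
    finally show ?thesis .
  qed
  let ?hj = "homr X j (tid X E) (tid X A) r"
  define R where "R = restrict_cell X (cup X j) [cid X ?J, ?hj] ?\<mu>r"
  have cup: "cup X j \<diamondop> [cid X ?J, ?hj] = ?\<mu>j \<cdot> \<rho>"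
    by (simp add: cup_eq[of j E] mul_vcomp)
  have R: "R \<in> Cell X" "src X R = [?J, P]" "tgt X R = ?M" "lft X R = tid X E" "rgt X R = tid X C"
    "?\<mu>r \<diamondop> [R] = ?\<mu>j \<cdot> \<rho>"
    unfolding R_def restrict_cell_def cup using cart_glift[of ?\<mu>r "?\<mu>j \<cdot> \<rho>"] by simp_all
  have rhs: "?\<mu>r \<diamondop> [R \<diamondop> [cid X ?J, c]] = ?\<mu>j \<cdot> (\<rho> \<diamondop> [c])"
    using R c vcomp_assoc12[of ?\<mu>r R "cid X ?J" c] by (simp add: mul_vcomp)
  \<comment> \<open>Both sides of the law are \<open>?\<mu>j\<close> pasted with a 2-cell
    precomposed with \<open>c\<close>. The factor \<open>?\<mu>j\<close> cancels by inserting a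
    companion unit, and \<open>c\<close>, the passage from \<open>E(j, 1), E(1, r)\<close> to
    \<open>E(j, r)\<close>, cancels because it is opcartesian.\<close>
  have "D \<diamondop> [hc, c] = R \<diamondop> [cid X ?J, c] \<longleftrightarrow> ?\<mu>j \<cdot> ((ue \<eta> \<cdot> ?\<phi>) \<diamondop> [c]) = ?\<mu>j \<cdot> (\<rho> \<diamondop> [c])"
    unfolding lhs[symmetric] rhs[symmetric]
    using D R hc c by (intro hom_eq_iff[of "tid X E" r]) simp_all
  also have "\<dots> \<longleftrightarrow> (ue \<eta> \<cdot> ?\<phi>) \<diamondop> [c] = \<rho> \<diamondop> [c]"
    using e f c by (intro companion_mul_eq_iff) simp_all
  also have "\<dots> \<longleftrightarrow> ue \<eta> \<cdot> ?\<phi> = \<rho>"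
    using opcart_cancel1[OF co, of "ue \<eta> \<cdot> ?\<phi>" \<rho>] e f c by auto
  finally have 2: "D \<diamondop> [hc, c] = R \<diamondop> [cid X ?J, c] \<longleftrightarrow> counit_law \<eta> flat"
    by (simp add: counit_law_def)
  have comp: "companion X r = ?M" "companion X j = ?J"
    by (simp_all add: companion_def)
  have D': "D = desc X m [] [P] (runit X ?M \<diamondop> [cid X ?M, ?\<epsilon>])"
    by (simp add: D_def mul_def)
  show ?thesis
    using 1 2 \<eta> counit_of(1)[OF flat] unfolding unit_counit_def Let_def
    by (simp add: comp hom_covar_cap D' G_def R_def m_def c_def hc_def)
qed (simp add: unit_counit_def Let_def)

lemma couniversal_arrow_iff:
  assumes flat: "flat \<in> cells X [P] K"
  shows "couniversal_arrow X j l r sharp (counit_of X l flat) \<longleftrightarrow>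
    sharp \<in> cells X [K] P \<and> unit_law (unit_of X j l r sharp) flat \<and> counit_law (unit_of X j l r sharp) flat"
proof (cases "sharp \<in> cells X [K] P")
  case sharp: True
  note s = sharpD[OF sharp] and f = flatD[OF flat] and \<epsilon> = counitD[OF counit_of(1)[OF flat]]
  note \<eta> = unit_of[OF sharp]
  let ?\<eta> = "unit_of X j l r sharp"
  note e = unitD[OF \<eta>(1)]
  let ?\<epsilon> = "counit_of X l flat" and ?\<phi> = "tact r \<diamondop> [\<kappa> \<diamondop> [flat]]"
  \<comment> \<open>The first law is \<open>flat \<diamondop> [sharp] = cid X K\<close> in disguise:
    \<open>cup X l\<close> is \<open>\<mu> \<cdot> \<kappa>\<close>, and both \<open>\<mu>\<close>
    and \<open>\<kappa>\<close> cancel.\<close>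
  have "?\<epsilon> \<diamondop> [cid X L, sharp] = \<mu> \<cdot> (\<kappa> \<diamondop> [flat] \<diamondop> [sharp])"
    using s f counit_of(2)[OF flat] by (simp add: mul_vcomp)
  then have "?\<epsilon> \<diamondop> [cid X L, sharp] = cup X l \<longleftrightarrow> \<mu> \<cdot> (\<kappa> \<diamondop> [flat] \<diamondop> [sharp]) = \<mu> \<cdot> \<kappa>"
    by (simp only: cup_eq[OF l(1,3)])
  also have "\<dots> \<longleftrightarrow> \<kappa> \<diamondop> [flat] \<diamondop> [sharp] = \<kappa>"
    using s f by (intro companion_mul_eq_iff) simp_all
  also have "\<dots> \<longleftrightarrow> flat \<diamondop> [sharp] = cid X K"
    using s f vcomp_assoc1[of \<kappa> flat sharp] by (subst hom_eq_iff[of l "tid X C"]) simp_all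
  also have "\<dots> \<longleftrightarrow> unit_law ?\<eta> flat"
    using flat_sharp_iff[OF sharp flat] by (simp add: unit_law_def)
  finally have 1: "?\<epsilon> \<diamondop> [cid X L, sharp] = cup X l \<longleftrightarrow> unit_law ?\<eta> flat" .
  let ?m = "hom_comp X l (tid X C) l" and ?h = "homr X l (tid X C) (tid X A) l"
  let ?s = "\<rho> \<diamondop> [sharp]"
  define D where "D = desc X ?m [] [P] (sharp \<cdot> ?\<epsilon>)"
  have m: "src X ?m = [K, L]" "tgt X ?m = hom X l l" "lft X ?m = tid X A" "rgt X ?m = tid X A"
    "?m \<in> Cell X" "?h \<diamondop> [?m] = cid X K \<cdot> \<mu>"
    by simp_all
  have mo: "opcartesian X ?m"
    by (rule hom_comp_opcartesian; simp)
  have D: "D \<in> Cell X" "src X D = [hom X l l, P]" "tgt X D = P" "lft X D = tid X A" "rgt X D = tid X C"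
    "D \<diamondop> [?m, cid X P] = sharp \<cdot> ?\<epsilon>"
    unfolding D_def using opcart_desc_left[OF mo, of "sharp \<cdot> ?\<epsilon>" P] \<epsilon> m s by simp_all
  \<comment> \<open>\<open>?s \<diamondop> [?h]\<close> is \<open>sharp(1, l)\<close> seen in the
    loose-identity; inserting \<open>cap X l\<close> below turns it into the unit.\<close>
  have \<rho>D: "\<rho> \<diamondop> [D] = (?s \<diamondop> [?h]) \<cdot> ?\<phi>"
  proof (rule opcart_cancel_left[OF mo, of _ P])
    have "\<rho> \<diamondop> [D] \<diamondop> [?m, cid X P] = \<rho> \<diamondop> [sharp \<cdot> ?\<epsilon>]"
      using D m by (simp add: vcomp_assoc12)
    also have "\<dots> = ?s \<cdot> ((tact r \<diamondop> [\<mu>]) \<cdot> ?\<phi>)"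
      using \<epsilon> s tact_counit[OF flat] by (simp add: vcomp_mul)
    also have "\<dots> = (?s \<cdot> (tact r \<diamondop> [\<mu>])) \<cdot> ?\<phi>"
      using f s by (simp add: mul_assoc)
    also have "?s \<cdot> (tact r \<diamondop> [\<mu>]) = ?s \<diamondop> [cid X K \<cdot> \<mu>]"
      using s by (simp add: vcomp_mul)
    also have "\<dots> = ?s \<diamondop> [?h] \<diamondop> [?m]"
      using s m vcomp_assoc1[of ?s ?h ?m] by simp
    also have "(?s \<diamondop> [?h] \<diamondop> [?m]) \<cdot> ?\<phi> = ((?s \<diamondop> [?h]) \<cdot> ?\<phi>) \<diamondop> [?m, cid X P]"
      using f m s by (subst mul_vcomp) simp_all
    finally show "\<rho> \<diamondop> [D] \<diamondop> [?m, cid X P] = ((?s \<diamondop> [?h]) \<cdot> ?\<phi>) \<diamondop> [?m, cid X P]" .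
  qed (use D f m s in simp_all)
  have "\<rho> \<diamondop> [D \<diamondop> [cap X l, cid X P]] = ((?s \<diamondop> [?h]) \<cdot> ?\<phi>) \<diamondop> [cap X l, cid X P]"
    using D \<rho>D vcomp_assoc12[of \<rho> D "cap X l" "cid X P"] by simp
  also have "\<dots> = (?s \<diamondop> [?h \<diamondop> [cap X l]]) \<cdot> ?\<phi>"
    using f s vcomp_assoc1[of ?s ?h "cap X l"] by (subst mul_vcomp) simp_all
  also have "?s \<diamondop> [?h \<diamondop> [cap X l]] = ue ?\<eta>"
    using s up_eq[OF \<eta>(1)] \<eta>(2) homr_cap vcomp_assoc1[of \<rho> sharp "conj_unit l"] by simp
  finally have "\<rho> \<diamondop> [D \<diamondop> [cap X l, cid X P]] = ue ?\<eta> \<cdot> ?\<phi>" .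
  then have 2: "D \<diamondop> [cap X l, cid X P] = cid X P \<longleftrightarrow> counit_law ?\<eta> flat"
    unfolding counit_law_def using D by (subst hom_eq_iff[of j r]) simp_all
  show ?thesis
    using 1 2 sharp counit_of(1)[OF flat] s unfolding couniversal_arrow_def Let_def
    by (simp add: D_def mul_def)
qed (simp add: couniversal_arrow_def Let_def)

text \<open>With \<open>hom_comp\<close> exhibiting \<open>E(j, r l)\<close> as the composite of
  \<open>E(j, r)\<close> and \<open>C(1, l)\<close>, a unit of the loose-adjunction is again a
  2-cell \<open>j \<Rightarrow> r l\<close>, and the two zig-zag laws become the two laws one by
  one.\<close>

lemma loose_adjunction_iff:
  assumes flat: "flat \<in> cells X [P] K"
  shows "loose_adjunction X L P (hom_comp X j r l) \<eta> (counit_of X l flat) \<longleftrightarrow>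
    \<eta> \<in> tight_cells X j (r \<bullet> l) \<and> unit_law \<eta> flat \<and> counit_law \<eta> flat"
proof -
  let ?m = "hom_comp X j r l"
  have m: "src X ?m = [P, L]" "tgt X ?m = hom X j (r \<bullet> l)" "lft X ?m = tid X A" "rgt X ?m = tid X A"
    "?m \<in> Cell X" "homc X j (r \<bullet> l) \<diamondop> [?m] = \<rho> \<cdot> (tact r \<diamondop> [\<mu>])"
    "homr X j r (tid X A) l \<diamondop> [?m] = cid X P \<cdot> \<mu>"
    by simp_all
  have mo: "opcartesian X ?m"
    by (rule hom_comp_opcartesian; simp)
  show ?thesis
  proof (cases "\<eta> \<in> tight_cells X j (r \<bullet> l)")
    case \<eta>: True
    note e = unitD[OF \<eta>] and f = flatD[OF flat] and \<epsilon> = counitD[OF counit_of(1)[OF flat]]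
    let ?\<epsilon> = "counit_of X l flat" and ?\<phi> = "tact r \<diamondop> [\<kappa> \<diamondop> [flat]]"
    let ?h = "homr X j r (tid X A) l" and ?\<rho> = "homc X j (r \<bullet> l)"
    define D where "D = desc X ?m [L] [] (lmul ?\<epsilon> (cid X L))"
    have D: "D \<in> Cell X" "src X D = [L, hom X j (r \<bullet> l)]" "tgt X D = L" "lft X D = tid X C" "rgt X D = tid X A"
      "D \<diamondop> [cid X L, ?m] = lmul ?\<epsilon> (cid X L)"
      unfolding D_def using opcart_desc_right[OF mo, of "lmul ?\<epsilon> (cid X L)" L] \<epsilon> m by simp_all
    \<comment> \<open>Precomposed with the opcartesian \<open>?m\<close>, each side becomes the
      counit pasted with \<open>\<mu>\<close>.\<close>
    have \<mu>D: "\<mu> \<diamondop> [D] = ?\<epsilon> \<diamondop> [cid X L, ?h]"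
    proof (rule opcart_cancel_right[OF mo, of _ L])
      have "\<mu> \<diamondop> [D] \<diamondop> [cid X L, ?m] = \<mu> \<diamondop> [lmul ?\<epsilon> (cid X L)]"
        using D m by (simp add: vcomp_assoc12)
      also have "\<dots> = ?\<epsilon> \<cdot> \<mu>"
        using \<epsilon> by (simp add: vcomp_lmul lmul_form)
      also have "\<dots> = ?\<epsilon> \<diamondop> [cid X L, cid X P \<cdot> \<mu>]"
        using \<epsilon> by (simp add: vcomp2_mul)
      also have "\<dots> = ?\<epsilon> \<diamondop> [cid X L, ?h] \<diamondop> [cid X L, ?m]"
        using \<epsilon> m by (simp add: vcomp_assoc2)
      finally show "\<mu> \<diamondop> [D] \<diamondop> [cid X L, ?m] = ?\<epsilon> \<diamondop> [cid X L, ?h] \<diamondop> [cid X L, ?m]" .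
    qed (use D \<epsilon> m in simp_all)
    have "\<mu> \<diamondop> [D \<diamondop> [cid X L, \<eta>]] = ?\<epsilon> \<diamondop> [cid X L, up \<eta>]"
      using D e \<mu>D \<epsilon> vcomp_assoc12[of \<mu> D "cid X L" \<eta>] by (simp add: vcomp_assoc2)
    then have 1: "D \<diamondop> [cid X L, \<eta>] = cid X L \<longleftrightarrow> unit_law \<eta> flat"
      using counit_up[OF \<eta> flat] D e by (subst hom_eq_iff[of "tid X C" l]) simp_all
    define D' where "D' = desc X ?m [] [P] (cid X P \<cdot> ?\<epsilon>)"
    have D': "D' \<in> Cell X" "src X D' = [hom X j (r \<bullet> l), P]" "tgt X D' = P" "lft X D' = tid X A" "rgt X D' = tid X C"
      "D' \<diamondop> [?m, cid X P] = cid X P \<cdot> ?\<epsilon>"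
      unfolding D'_def using opcart_desc_left[OF mo, of "cid X P \<cdot> ?\<epsilon>" P] \<epsilon> m by simp_all
    \<comment> \<open>The computation is that of the second unit-counit law, with \<open>j\<close>
      in place of the identity of \<open>E\<close>.\<close>
    have \<rho>D: "\<rho> \<diamondop> [D'] = ?\<rho> \<cdot> ?\<phi>"
    proof (rule opcart_cancel_left[OF mo, of _ P])
      have "\<rho> \<diamondop> [D'] \<diamondop> [?m, cid X P] = \<rho> \<diamondop> [cid X P \<cdot> ?\<epsilon>]"
        using D' m by (simp add: vcomp_assoc12)
      also have "\<dots> = \<rho> \<cdot> ((tact r \<diamondop> [\<mu>]) \<cdot> ?\<phi>)"
        using \<epsilon> tact_counit[OF flat] by (simp add: vcomp_mul)
      also have "\<dots> = (\<rho> \<cdot> (tact r \<diamondop> [\<mu>])) \<cdot> ?\<phi>"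
        using f by (simp add: mul_assoc)
      also have "\<dots> = (?\<rho> \<cdot> ?\<phi>) \<diamondop> [?m, cid X P]"
        using f m by (simp add: mul_vcomp)
      finally show "\<rho> \<diamondop> [D'] \<diamondop> [?m, cid X P] = (?\<rho> \<cdot> ?\<phi>) \<diamondop> [?m, cid X P]" .
    qed (use D' f m in simp_all)
    have "\<rho> \<diamondop> [D' \<diamondop> [\<eta>, cid X P]] = ue \<eta> \<cdot> ?\<phi>"
      using D' e f \<rho>D vcomp_assoc12[of \<rho> D' \<eta> "cid X P"] by (simp add: mul_vcomp)
    then have 2: "D' \<diamondop> [\<eta>, cid X P] = cid X P \<longleftrightarrow> counit_law \<eta> flat"
      unfolding counit_law_def using D' e by (subst hom_eq_iff[of j r]) simp_all
    show ?thesis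
      using 1 2 \<eta> mo m counit_of(1)[OF flat] \<epsilon> unfolding loose_adjunction_def tight_cells_def
      by (simp add: D_def D'_def mul_def lmul_def)
  qed (use m in \<open>simp add: loose_adjunction_def tight_cells_def\<close>)
qed

end

text \<open>Since \<open>u\<close> and \<open>c\<close> act on the components separately and reach
  all data with the right frames, a presentation \<open>Q\<close> only has to be compared with
  \<open>R\<close> on pairs \<open>(u s, c t)\<close>.\<close>

lemma bij_betw_pairs:
  assumes "bij_betw u S U" "bij_betw c T V"
    and "\<And>s t. R s t \<Longrightarrow> s \<in> S \<and> t \<in> T" "\<And>a b. Q a b \<Longrightarrow> a \<in> U \<and> b \<in> V"
    and iff: "\<And>s t. s \<in> S \<Longrightarrow> t \<in> T \<Longrightarrow> Q (u s) (c t) \<longleftrightarrow> R s t"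
  shows "bij_betw (\<lambda>(s, t). (u s, c t)) {(s, t). R s t} {(a, b). Q a b}"
  unfolding bij_betw_def
proof
  show "inj_on (\<lambda>(s, t). (u s, c t)) {(s, t). R s t}"
    using assms(1-3) by (auto simp: inj_on_def bij_betw_def)
  show "(\<lambda>(s, t). (u s, c t)) ` {(s, t). R s t} = {(a, b). Q a b}"
  proof (intro equalityI subsetI)
    fix x assume "x \<in> {(a, b). Q a b}"
    then obtain a b where ab: "x = (a, b)" "Q a b" by auto
    then obtain s t where "s \<in> S" "a = u s" "t \<in> T" "b = c t"
      using assms(1,2,4) by (metis bij_betw_imp_surj_on imageE)
    then show "x \<in> (\<lambda>(s, t). (u s, c t)) ` {(s, t). R s t}"
      using ab iff by force
  qed (use assms(3) iff in auto)
qed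

section \<open>Isomorphisms, unary opcartesian 2-cells, and comparison of composites\<close>

context virtual_double_category
begin

lemma cells_unary:
  assumes "\<phi> \<in> cells X [p] q"
  shows "p \<in> Loose X" "q \<in> Loose X" "lcod X q = lcod X p" "ldom X q = ldom X p"
proof -
  note f = cellsD[OF assms]
  show q: "q \<in> Loose X" using f by auto
  show "p \<in> Loose X" "lcod X q = lcod X p" "ldom X q = ldom X p"
    using cell_chain[OF f(1)] f q by auto
qed

text \<open>Factoring the identity of \<open>p\<close> through \<open>\<phi>\<close> produces an
  inverse; conversely, an inverse inserted in the slot of \<open>p\<close> produces the unique
  factorisations. Representations and corepresentations are thereby isomorphisms.\<close>

lemma opcart_iff_iso:
  assumes \<phi>: "\<phi> \<in> cells X [p] q"
  shows "opcartesian X \<phi> \<longleftrightarrow> (\<exists>\<psi> \<in> cells X [q] p. \<psi> \<diamondop> [\<phi>] = cid X p \<and> \<phi> \<diamondop> [\<psi>] = cid X q)"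
proof
  note pq = cells_unary[OF \<phi>] and f = cellsD[OF \<phi>, unfolded cells_unary(3,4)[OF \<phi>]]
  {
    assume oc: "opcartesian X \<phi>"
    define \<psi> where "\<psi> = desc X \<phi> [] [] (cid X p)"
    have \<psi>: "\<psi> \<in> Cell X" "src X \<psi> = [q]" "tgt X \<psi> = p" "lft X \<psi> = tid X (lcod X p)"
      "rgt X \<psi> = tid X (ldom X p)" "\<psi> \<diamondop> [\<phi>] = cid X p"
      unfolding \<psi>_def using opcart_desc1[OF oc, of "cid X p"] f pq by (simp_all del: cell_simps(4,5))
    have "\<phi> \<diamondop> [\<psi>] = cid X q"
    proof (rule opcart_cancel1[OF oc])
      show "\<phi> \<diamondop> [\<psi>] \<diamondop> [\<phi>] = cid X q \<diamondop> [\<phi>]"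
        using \<psi> f pq by (simp add: vcomp_assoc1)
    qed (use \<psi> f pq in simp_all)
    moreover have "\<psi> \<in> cells X [q] p"
      using \<psi> by (intro cellsI) auto
    ultimately show "\<exists>\<psi> \<in> cells X [q] p. \<psi> \<diamondop> [\<phi>] = cid X p \<and> \<phi> \<diamondop> [\<psi>] = cid X q"
      using \<psi>(6) by auto
  }
  assume "\<exists>\<psi> \<in> cells X [q] p. \<psi> \<diamondop> [\<phi>] = cid X p \<and> \<phi> \<diamondop> [\<psi>] = cid X q"
  then obtain \<psi> where \<psi>': "\<psi> \<in> cells X [q] p" and inv: "\<psi> \<diamondop> [\<phi>] = cid X p" "\<phi> \<diamondop> [\<psi>] = cid X q"
    by auto
  note \<psi> = cellsD[OF \<psi>']
  have "\<exists>!\<chi>'. opcart_factor X \<phi> ps rs \<chi> \<chi>'"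
    if \<chi>: "\<chi> \<in> Cell X" "src X \<chi> = ps @ [p] @ rs"
      and ps: "chain X (tdom X (lft X \<chi>)) ps (lcod X p)"
      and rs: "chain X (ldom X p) rs (tdom X (rgt X \<chi>))" for ps rs \<chi>
  proof -
    define A where "A = tdom X (lft X \<chi>)"
    let ?D = "tdom X (rgt X \<chi>)" and ?ip = "map (cid X) ps" and ?ir = "map (cid X) rs"
    note ps = ps[folded A_def]
    have A: "A \<in> Obj X" "tdom X (lft X \<chi>) = A" using \<chi> by (auto simp: A_def)
    note w = ccomp_whisker_cid[OF _ _ _ ps rs]
    define \<xi> where "\<xi> = ccomp X \<chi> (tid X A) (?ip @ [\<psi>] @ ?ir)"
    have jux: "juxtaposable X (tid X (lcod X p)) [\<psi>] (tid X (ldom X p))"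
      using \<psi> pq by simp
    have src: "src X \<chi> = ps @ map (tgt X) [\<psi>] @ rs"
      using \<chi> \<psi> by simp
    note \<xi> = ccomp_whisker_frame[OF \<chi>(1) src A(2) refl ps rs jux, folded \<xi>_def]
    have \<xi>src: "src X \<xi> = ps @ q # rs" using \<xi> \<psi> by simp
    have "ccomp X \<xi> (tid X A) (?ip @ concat [[\<phi>]] @ ?ir) = ccomp X \<chi> (tid X A) (?ip @ [\<psi> \<diamondop> [\<phi>]] @ ?ir)"
      unfolding \<xi>_def using w[of \<chi> "[\<psi>]" "[[\<phi>]]"] \<chi> A \<psi> f pq by (simp add: vcomp_def)
    then have ex: "ccomp X \<xi> (tid X A) (?ip @ [\<phi>] @ ?ir) = \<chi>"
      unfolding inv using ccomp_cids[OF \<chi> A(2)] by simp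
    show ?thesis
    proof
      show "opcart_factor X \<phi> ps rs \<chi> \<xi>"
        unfolding opcart_factor_def using \<xi> \<xi>src ex A \<chi> f by simp
      fix \<zeta>
      assume "opcart_factor X \<phi> ps rs \<chi> \<zeta>"
      then have \<zeta>: "\<zeta> \<in> Cell X" "src X \<zeta> = ps @ [q] @ rs" "tdom X (lft X \<zeta>) = A"
        "ccomp X \<zeta> (tid X A) (?ip @ [\<phi>] @ ?ir) = \<chi>"
        using A f by (auto simp: opcart_factor_def)
      have "\<xi> = ccomp X (ccomp X \<zeta> (tid X A) (?ip @ [\<phi>] @ ?ir)) (tid X A) (?ip @ concat [[\<psi>]] @ ?ir)"
        using \<zeta>(4) by (simp add: \<xi>_def)
      also have "\<dots> = ccomp X \<zeta> (tid X A) (?ip @ [\<phi> \<diamondop> [\<psi>]] @ ?ir)"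
        using w[of \<zeta> "[\<phi>]" "[[\<psi>]]"] \<zeta> \<psi> f pq by (simp add: vcomp_def)
      also have "\<dots> = \<zeta>"
        unfolding inv using ccomp_cids[OF \<zeta>(1-3)] by simp
      finally show "\<zeta> = \<xi>" by simp
    qed
  qed
  then show "opcartesian X \<phi>"
    unfolding opcartesian_def using \<phi> cellsD(2,3)[OF \<phi>] pq by simp
qed

lemma inverse_unique:
  assumes "\<phi> \<in> cells X [p] q" "\<psi> \<in> cells X [q] p" "\<psi>' \<in> cells X [q] p"
    "\<psi> \<diamondop> [\<phi>] = cid X p" "\<phi> \<diamondop> [\<psi>'] = cid X q"
  shows "\<psi> = \<psi>'"
proof -
  note f = cellsD[OF assms(1)] cellsD[OF assms(2)] cellsD[OF assms(3)]
  have "\<psi> = \<psi> \<diamondop> [\<phi> \<diamondop> [\<psi>']]"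
    using f assms(5) by simp
  also have "\<dots> = \<psi> \<diamondop> [\<phi>] \<diamondop> [\<psi>']"
    using f by (intro vcomp_assoc1[symmetric]) simp_all
  also have "\<dots> = \<psi>'"
    using f assms(4) by simp
  finally show ?thesis .
qed

text \<open>An isomorphism determines its inverse, so forgetting the second component loses
  nothing.\<close>

lemma bij_betw_inverse_pairs:
  "bij_betw (\<lambda>(\<phi>, \<psi>). \<phi>)
    {(\<phi>, \<psi>). \<phi> \<in> cells X [p] q \<and> \<psi> \<in> cells X [q] p \<and> \<psi> \<diamondop> [\<phi>] = cid X p \<and> \<phi> \<diamondop> [\<psi>] = cid X q}
    {\<phi> \<in> cells X [p] q. opcartesian X \<phi>}"
  unfolding bij_betw_def
proof
  show "inj_on (\<lambda>(\<phi>, \<psi>). \<phi>)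
    {(\<phi>, \<psi>). \<phi> \<in> cells X [p] q \<and> \<psi> \<in> cells X [q] p \<and> \<psi> \<diamondop> [\<phi>] = cid X p \<and> \<phi> \<diamondop> [\<psi>] = cid X q}"
    by (auto simp: inj_on_def intro: inverse_unique)
qed (use opcart_iff_iso[of _ p q] in \<open>fastforce simp: image_iff\<close>)

lemma opcart2_objects:
  assumes "opcartesian X m" "src X m = [q, p]"
  shows "m \<in> Cell X" "q \<in> Loose X" "p \<in> Loose X" "ldom X q = lcod X p" "tgt X m \<in> Loose X"
    "lcod X (tgt X m) = lcod X q" "ldom X (tgt X m) = ldom X p"
    "lft X m = tid X (lcod X q)" "rgt X m = tid X (ldom X p)"
proof -
  obtain A B where AB: "A \<in> Obj X" "B \<in> Obj X" "lcod X (tgt X m) = A" "ldom X (tgt X m) = B"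
    "lft X m = tid X A" "rgt X m = tid X B"
    by (rule opcart_objects[OF assms(1)])
  have m: "m \<in> Cell X" using opcart_frame[OF assms(1)] by simp
  have ch: "lcod X q = A" "ldom X q = lcod X p" "ldom X p = B" "q \<in> Loose X" "p \<in> Loose X"
    using cell_chain[OF m] assms(2) AB by auto
  show "m \<in> Cell X" "q \<in> Loose X" "p \<in> Loose X" "ldom X q = lcod X p" "tgt X m \<in> Loose X"
    "lcod X (tgt X m) = lcod X q" "ldom X (tgt X m) = ldom X p"
    "lft X m = tid X (lcod X q)" "rgt X m = tid X (ldom X p)"
    using m ch AB by auto
qed

text \<open>Each opcartesian 2-cell factors through the other, and the two factorisations are
  mutually inverse because opcartesian 2-cells can be cancelled.\<close>

lemma opcart_comparison:
  assumes m: "opcartesian X m" "src X m = [q, p]" and m': "opcartesian X m'" "src X m' = [q, p]"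
  defines "\<theta> \<equiv> desc X m [] [] m'"
  shows "\<theta> \<in> cells X [tgt X m] (tgt X m')" "\<theta> \<diamondop> [m] = m'"
    "\<exists>\<theta>'\<in>cells X [tgt X m'] (tgt X m). \<theta>' \<diamondop> [\<theta>] = cid X (tgt X m) \<and> \<theta> \<diamondop> [\<theta>'] = cid X (tgt X m')"
proof -
  have cmp: "desc X m [] [] m' \<in> cells X [tgt X m] (tgt X m')" "desc X m [] [] m' \<diamondop> [m] = m'"
    if m: "opcartesian X m" "src X m = [q, p]" and m': "opcartesian X m'" "src X m' = [q, p]" for m m'
  proof -
    note o = opcart2_objects[OF m] and o' = opcart2_objects[OF m']
    note d = opcart_desc1[OF m(1) o'(1)]
    have "lcod X (tgt X m) = tdom X (lft X m')" "ldom X (tgt X m) = tdom X (rgt X m')"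
      unfolding o(6,7) o'(8,9) using o by simp_all
    note d = d[unfolded m(2) m'(2), OF refl this]
    show "desc X m [] [] m' \<in> cells X [tgt X m] (tgt X m')"
      using d o' by (intro cellsI) (simp_all del: cell_simps(4,5))
    show "desc X m [] [] m' \<diamondop> [m] = m'"
      by (rule d(6))
  qed
  note o = opcart2_objects[OF m] and o' = opcart2_objects[OF m']
  note t = cmp[OF m m', folded \<theta>_def] and t' = cmp[OF m' m]
  show "\<theta> \<in> cells X [tgt X m] (tgt X m')" "\<theta> \<diamondop> [m] = m'" by (rule t)+
  let ?\<theta>' = "desc X m' [] [] m"
  have inv: "\<tau>' \<diamondop> [\<tau>] = cid X (tgt X n)"
    if n: "opcartesian X n" "src X n = [q, p]" and n': "opcartesian X n'" "src X n' = [q, p]"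
    and \<tau>: "\<tau> \<in> cells X [tgt X n] (tgt X n')" "\<tau> \<diamondop> [n] = n'"
    and \<tau>': "\<tau>' \<in> cells X [tgt X n'] (tgt X n)" "\<tau>' \<diamondop> [n'] = n" for n n' \<tau> \<tau>'
  proof (rule opcart_cancel1[OF n(1)])
    note o = opcart2_objects[OF n] and o' = opcart2_objects[OF n']
    note f = cellsD[OF \<tau>(1), unfolded o'(6,7)] cellsD[OF \<tau>'(1), unfolded o(6,7)]
    show "\<tau>' \<diamondop> [\<tau>] \<diamondop> [n] = cid X (tgt X n) \<diamondop> [n]"
      using f o(1) \<tau> \<tau>' by (simp add: vcomp_assoc1)
    show "\<tau>' \<diamondop> [\<tau>] \<in> Cell X" "src X (\<tau>' \<diamondop> [\<tau>]) = [tgt X n]" "cid X (tgt X n) \<in> Cell X"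
      "src X (cid X (tgt X n)) = [tgt X n]" "tgt X (cid X (tgt X n)) = tgt X (\<tau>' \<diamondop> [\<tau>])"
      using f o(1) by simp_all
    show "lft X (cid X (tgt X n)) = lft X (\<tau>' \<diamondop> [\<tau>])" "rgt X (cid X (tgt X n)) = rgt X (\<tau>' \<diamondop> [\<tau>])"
      using f o by simp_all
  qed
  show "\<exists>\<theta>'\<in>cells X [tgt X m'] (tgt X m). \<theta>' \<diamondop> [\<theta>] = cid X (tgt X m) \<and> \<theta> \<diamondop> [\<theta>'] = cid X (tgt X m')"
    using inv[OF m m' t t'] inv[OF m' m t' t] t'(1) by blast
qed

lemma bij_betw_postcompose_iso:
  assumes "\<theta> \<in> cells X [p] q" "\<theta>' \<in> cells X [q] p" "\<theta>' \<diamondop> [\<theta>] = cid X p" "\<theta> \<diamondop> [\<theta>'] = cid X q"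
  shows "bij_betw (\<lambda>\<eta>. \<theta> \<diamondop> [\<eta>]) (cells X ps p) (cells X ps q)"
proof (rule bij_betw_byWitness[where f'="\<lambda>\<eta>. \<theta>' \<diamondop> [\<eta>]"])
  note o = cells_unary[OF assms(1)]
  note f = cellsD[OF assms(1), unfolded o(3,4)] cellsD[OF assms(2)]
  show "\<forall>\<eta>\<in>cells X ps p. \<theta>' \<diamondop> [\<theta> \<diamondop> [\<eta>]] = \<eta>"
  proof
    fix \<eta> assume "\<eta> \<in> cells X ps p"
    note e = cellsD[OF this]
    show "\<theta>' \<diamondop> [\<theta> \<diamondop> [\<eta>]] = \<eta>"
      using vcomp_assoc1[of \<theta>' \<theta> \<eta>] f e assms(3) by simp
  qed
  show "\<forall>\<eta>\<in>cells X ps q. \<theta> \<diamondop> [\<theta>' \<diamondop> [\<eta>]] = \<eta>"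
  proof
    fix \<eta> assume "\<eta> \<in> cells X ps q"
    note e = cellsD[OF this]
    show "\<theta> \<diamondop> [\<theta>' \<diamondop> [\<eta>]] = \<eta>"
      using vcomp_assoc1[of \<theta> \<theta>' \<eta>] f e assms(4) by simp
  qed
  show "(\<lambda>\<eta>. \<theta> \<diamondop> [\<eta>]) ` cells X ps p \<subseteq> cells X ps q"
  proof clarify
    fix \<eta> assume "\<eta> \<in> cells X ps p"
    note e = cellsD[OF this]
    show "\<theta> \<diamondop> [\<eta>] \<in> cells X ps q"
      using f e o by (intro cellsI) simp_all
  qed
  show "(\<lambda>\<eta>. \<theta>' \<diamondop> [\<eta>]) ` cells X ps q \<subseteq> cells X ps p"
  proof clarify
    fix \<eta> assume "\<eta> \<in> cells X ps q"
    note e = cellsD[OF this]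
    show "\<theta>' \<diamondop> [\<eta>] \<in> cells X ps p"
      using f e o by (intro cellsI) simp_all
  qed
qed

end

section \<open>Independence of loose-adjunctions from the chosen composite\<close>

context virtual_equipment
begin

text \<open>Factoring through \<open>m'\<close> and then composing with the comparison is factoring
  through \<open>m\<close>. The zig-zag composites of the two units are therefore equal, not merely
  isomorphic.\<close>

lemma loose_adjunction_comparison:
  assumes m: "opcartesian X m" "src X m = [q, p]" and m': "opcartesian X m'" "src X m' = [q, p]"
    and \<eta>: "\<eta> \<in> cells X [] (tgt X m)"
  shows "loose_adjunction X p q m' (desc X m [] [] m' \<diamondop> [\<eta>]) \<epsilon> \<longleftrightarrow> loose_adjunction X p q m \<eta> \<epsilon>"
proof (cases "lcod X q = ldom X p \<and> \<epsilon> \<in> cells X [p, q] (lid X (lcod X p))")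
  case True
  define \<theta> where "\<theta> = desc X m [] [] m'"
  note o = opcart2_objects[OF m] and o' = opcart2_objects[OF m']
  note \<theta> = opcart_comparison[OF m m', folded \<theta>_def]
  note t = cellsD[OF \<theta>(1), unfolded o'(6,7)]
  note e = cellsD[OF \<eta>, unfolded o(6,7)]
  have pq: "lcod X q = ldom X p" "lcod X p \<in> Obj X" "ldom X p \<in> Obj X"
    using True o by auto
  have "\<epsilon> \<in> cells X [p, q] (lid X (lcod X p))" using True by simp
  from cellsD[OF this] have \<epsilon>: "\<epsilon> \<in> Cell X" "src X \<epsilon> = [p, q]" "tgt X \<epsilon> = lid X (lcod X p)"
    "lft X \<epsilon> = tid X (lcod X p)" "rgt X \<epsilon> = tid X (lcod X p)"
    using pq by simp_all
  have \<theta>\<eta>: "\<theta> \<diamondop> [\<eta>] \<in> cells X [] (tgt X m')"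
  proof (rule cellsI)
    show "lft X (\<theta> \<diamondop> [\<eta>]) = tid X (lcod X (tgt X m'))" "rgt X (\<theta> \<diamondop> [\<eta>]) = tid X (ldom X (tgt X m'))"
      unfolding o'(6,7) using t e o(2,3) by simp_all
  qed (use t e in simp_all)
  have "desc X m' [p] [] \<chi> \<diamondop> [cid X p, \<theta> \<diamondop> [\<eta>]] = desc X m [p] [] \<chi> \<diamondop> [cid X p, \<eta>]"
    if \<chi>: "\<chi> \<in> Cell X" "src X \<chi> = [p, q, p]" "rgt X \<chi> = tid X (ldom X p)" for \<chi>
  proof -
    have d: "desc X m [p] [] \<chi> \<in> Cell X" "src X (desc X m [p] [] \<chi>) = [p, tgt X m]"
      "tgt X (desc X m [p] [] \<chi>) = tgt X \<chi>" "lft X (desc X m [p] [] \<chi>) = lft X \<chi>"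
      "rgt X (desc X m [p] [] \<chi>) = rgt X \<chi>" "desc X m [p] [] \<chi> \<diamondop> [cid X p, m] = \<chi>"
      if "opcartesian X m" "src X m = [q, p]" for m
      by (rule opcart_desc_right;
          use that opcart2_objects[OF that] \<chi> pq in \<open>simp del: cell_simps(4,5)\<close>)+
    note d' = d[OF m'] and d = d[OF m]
    have "desc X m' [p] [] \<chi> \<diamondop> [cid X p, \<theta>] = desc X m [p] [] \<chi>"
    proof (rule opcart_cancel_right[OF m(1)])
      show "desc X m' [p] [] \<chi> \<diamondop> [cid X p, \<theta>] \<diamondop> [cid X p, m] = desc X m [p] [] \<chi> \<diamondop> [cid X p, m]"
        using d d' t o(1,3,8) pq \<theta>(2) by (simp add: vcomp_assoc2)
    qed (use d d' t o(2,3) pq \<chi> ccomp_frame_hd[OF \<chi>(1,2)] in simp_all)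
    then show ?thesis
      using vcomp_assoc2[of "desc X m' [p] [] \<chi>" "cid X p" \<theta> "cid X p" \<eta>] d' t e o(3) pq by simp
  qed
  from this[of "lmul \<epsilon> (cid X p)"]
  have 1: "desc X m' [p] [] (lmul \<epsilon> (cid X p)) \<diamondop> [cid X p, \<theta> \<diamondop> [\<eta>]] =
      desc X m [p] [] (lmul \<epsilon> (cid X p)) \<diamondop> [cid X p, \<eta>]"
    using \<epsilon> o(3) pq by simp
  have "desc X m' [] [q] \<chi> \<diamondop> [\<theta> \<diamondop> [\<eta>], cid X q] = desc X m [] [q] \<chi> \<diamondop> [\<eta>, cid X q]"
    if \<chi>: "\<chi> \<in> Cell X" "src X \<chi> = [q, p, q]" "lft X \<chi> = tid X (lcod X q)" for \<chi>
  proof -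
    have d: "desc X m [] [q] \<chi> \<in> Cell X" "src X (desc X m [] [q] \<chi>) = [tgt X m, q]"
      "tgt X (desc X m [] [q] \<chi>) = tgt X \<chi>" "lft X (desc X m [] [q] \<chi>) = lft X \<chi>"
      "rgt X (desc X m [] [q] \<chi>) = rgt X \<chi>" "desc X m [] [q] \<chi> \<diamondop> [m, cid X q] = \<chi>"
      if "opcartesian X m" "src X m = [q, p]" for m
      by (rule opcart_desc_left;
          use that opcart2_objects[OF that] \<chi> pq in \<open>simp del: cell_simps(4,5)\<close>)+
    note d' = d[OF m'] and d = d[OF m]
    have "desc X m' [] [q] \<chi> \<diamondop> [\<theta>, cid X q] = desc X m [] [q] \<chi>"
    proof (rule opcart_cancel_left[OF m(1)])
      show "desc X m' [] [q] \<chi> \<diamondop> [\<theta>, cid X q] \<diamondop> [m, cid X q] = desc X m [] [q] \<chi> \<diamondop> [m, cid X q]"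
        using d d' t o(1,2,9) pq \<theta>(2) by (simp add: vcomp_assoc2)
    qed (use d d' t o(2,3) pq \<chi> tdom_rgt[of \<chi> "[q, p]" q] in simp_all)
    then show ?thesis
      using vcomp_assoc2[of "desc X m' [] [q] \<chi>" \<theta> "cid X q" \<eta> "cid X q"] d' t e o(2) pq by simp
  qed
  from this[of "cid X q \<cdot> \<epsilon>"]
  have 2: "desc X m' [] [q] (cid X q \<cdot> \<epsilon>) \<diamondop> [\<theta> \<diamondop> [\<eta>], cid X q] =
      desc X m [] [q] (cid X q \<cdot> \<epsilon>) \<diamondop> [\<eta>, cid X q]"
    using \<epsilon> o(2,4) pq by simp
  have c: "tgt X (cid X p) = p" "tgt X (cid X q) = q" using o(2,3) by simp_all
  show ?thesis
    using 1 2 \<theta>\<eta> \<eta> m m' unfolding loose_adjunction_def lmul_def mul_def c \<theta>_def[symmetric] by simp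
qed (auto simp: loose_adjunction_def)

end

theorem lemma5p5:
  fixes X :: "('o, 't, 'l, 'c, 'z) equipment_scheme" (structure)
    and A C E :: 'o and j l r :: 't
  assumes "virtual_equipment X"
    and "A \<in> Obj X" and "C \<in> Obj X" and "E \<in> Obj X"
    and "j \<in> Tight X" and "tdom X j = A" and "tcod X j = E"
    and "l \<in> Tight X" and "tdom X l = A" and "tcod X l = C"
    and "r \<in> Tight X" and "tdom X r = C" and "tcod X r = E"
  shows
    "bij_betw (\<lambda>(sharp, flat). (unit_of X j l r sharp, flat))
       {(sharp, flat). relative_adjunction X j l r sharp flat}
       {(\<eta>, flat). universal_arrow X j l r \<eta> flat} \<and>
     bij_betw (\<lambda>(sharp, flat). (unit_of X j l r sharp, counit_of X l flat))
       {(sharp, flat). relative_adjunction X j l r sharp flat}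
       {(\<eta>, \<epsilon>). unit_counit X j l r \<eta> \<epsilon>} \<and>
     bij_betw (\<lambda>(sharp, flat). (sharp, counit_of X l flat))
       {(sharp, flat). relative_adjunction X j l r sharp flat}
       {(sharp, \<epsilon>). couniversal_arrow X j l r sharp \<epsilon>} \<and>
     bij_betw (\<lambda>(sharp, flat). sharp)
       {(sharp, flat). relative_adjunction X j l r sharp flat}
       (representations X j (conjoint X l) r) \<and>
     bij_betw (\<lambda>(sharp, flat). flat)
       {(sharp, flat). relative_adjunction X j l r sharp flat}
       (corepresentations X (tid X C) (hom X j r) l) \<and>
     bij_betw (\<lambda>(sharp, flat). (unit_of X j l r sharp, counit_of X l flat))
       {(sharp, flat). relative_adjunction X j l r sharp flat}
       {(\<eta>, \<epsilon>). loose_adjunction X (companion X l) (hom X j r) (hom_comp X j r l) \<eta> \<epsilon>} \<and>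
     (\<forall>m. opcartesian X m \<and> src X m = [hom X j r, companion X l] \<longrightarrow>
       bij_betw
         (\<lambda>(sharp, flat).
           (vcomp X (desc X (hom_comp X j r l) [] [] m) [unit_of X j l r sharp], counit_of X l flat))
         {(sharp, flat). relative_adjunction X j l r sharp flat}
         {(\<eta>, \<epsilon>). loose_adjunction X (companion X l) (hom X j r) m \<eta> \<epsilon>})"
proof -
  interpret relative_adjunction_data X A C E j l r
    using assms by (simp add: relative_adjunction_data_def relative_adjunction_data_axioms_def)
  let ?RA = "relative_adjunction X j l r"
  have RA: "?RA s f \<Longrightarrow> s \<in> cells X [K] P \<and> f \<in> cells X [P] K" for s f
    by (simp add: relative_adjunction_iff)
  note pairs = bij_betw_pairs[OF _ _ RA]
  have id: "bij_betw (\<lambda>x. x) S S" for S :: "'c set"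
    by (simp add: bij_betw_def)
  have 2: "bij_betw (\<lambda>(s, f). (unit_of X j l r s, f)) {(s, f). ?RA s f} {(\<eta>, f). universal_arrow X j l r \<eta> f}"
    by (rule pairs[OF bij_unit_of id])
      (auto simp: universal_arrow_iff relative_adjunction_laws intro: unit_of(1))
  have 3: "bij_betw (\<lambda>(s, f). (unit_of X j l r s, counit_of X l f)) {(s, f). ?RA s f}
      {(\<eta>, \<epsilon>). unit_counit X j l r \<eta> \<epsilon>}"
  proof (rule pairs[OF bij_unit_of bij_counit_of])
    show "unit_counit X j l r \<eta> \<epsilon> \<Longrightarrow> \<eta> \<in> tight_cells X j (r \<bullet> l) \<and> \<epsilon> \<in> cells X [L, P] (lid X C)" for \<eta> \<epsilon>
      by (simp add: unit_counit_def Let_def)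
  qed (auto simp: unit_counit_iff relative_adjunction_laws intro: unit_of(1))
  have 4: "bij_betw (\<lambda>(s, f). (s, counit_of X l f)) {(s, f). ?RA s f}
      {(s, \<epsilon>). couniversal_arrow X j l r s \<epsilon>}"
  proof (rule pairs[OF id bij_counit_of])
    show "couniversal_arrow X j l r s \<epsilon> \<Longrightarrow> s \<in> cells X [K] P \<and> \<epsilon> \<in> cells X [L, P] (lid X C)" for s \<epsilon>
      by (simp add: couniversal_arrow_def Let_def)
  qed (auto simp: couniversal_arrow_iff relative_adjunction_laws)
  have 5: "bij_betw (\<lambda>(s, f). s) {(s, f). ?RA s f} (representations X j (conjoint X l) r)"
    using bij_betw_inverse_pairs[of K P] by (simp add: relative_adjunction_iff representations_def)
  have 6: "bij_betw (\<lambda>(s, f). f) {(s, f). ?RA s f} (corepresentations X (tid X C) P l)"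
  proof -
    \<comment> \<open>The opcartesian 2-cell of a corepresentation is \<open>flat\<close>, so
      inverse pairs are taken in the opposite order.\<close>
    have "bij_betw prod.swap {(s, f). ?RA s f}
        {(f, s). f \<in> cells X [P] K \<and> s \<in> cells X [K] P \<and> s \<diamondop> [f] = cid X P \<and> f \<diamondop> [s] = cid X K}"
      by (rule bij_betw_byWitness[where f'=prod.swap]) (auto simp: relative_adjunction_iff)
    from bij_betw_trans[OF this bij_betw_inverse_pairs] show ?thesis
      by (simp add: corepresentations_def representations_def o_def split_def)
  qed
  let ?m = "hom_comp X j r l"
  have mo: "opcartesian X ?m"
    by (rule hom_comp_opcartesian; simp)
  have msrc: "src X ?m = [P, L]" "tgt X ?m = hom X j (r \<bullet> l)"
    by simp_all
  have 7: "bij_betw (\<lambda>(s, f). (unit_of X j l r s, counit_of X l f)) {(s, f). ?RA s f}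
      {(\<eta>, \<epsilon>). loose_adjunction X (companion X l) P ?m \<eta> \<epsilon>}"
  proof (rule pairs[OF bij_unit_of bij_counit_of])
    show "loose_adjunction X (companion X l) P ?m \<eta> \<epsilon> \<Longrightarrow>
        \<eta> \<in> tight_cells X j (r \<bullet> l) \<and> \<epsilon> \<in> cells X [L, P] (lid X C)" for \<eta> \<epsilon>
      by (simp add: loose_adjunction_def tight_cells_def)
  qed (auto simp: loose_adjunction_iff relative_adjunction_laws intro: unit_of(1))
  \<comment> \<open>Another composite is reached from \<open>hom_comp\<close> along the comparison
    isomorphism, which changes the unit and leaves the counit as it is.\<close>
  have 8: "bij_betw (\<lambda>(s, f). (desc X ?m [] [] m \<diamondop> [unit_of X j l r s], counit_of X l f)) {(s, f). ?RA s f}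
      {(\<eta>, \<epsilon>). loose_adjunction X (companion X l) P m \<eta> \<epsilon>}"
    if m: "opcartesian X m" "src X m = [P, companion X l]" for m
  proof -
    note m = m[unfolded companion_eq]
    note cmp = opcart_comparison[OF mo msrc(1) m]
    have bij: "bij_betw (\<lambda>s. desc X ?m [] [] m \<diamondop> [unit_of X j l r s]) (cells X [K] P) (cells X [] (tgt X m))"
    proof -
      have "bij_betw (\<lambda>\<eta>. desc X ?m [] [] m \<diamondop> [\<eta>]) (tight_cells X j (r \<bullet> l)) (cells X [] (tgt X m))"
        using cmp(3) bij_betw_postcompose_iso[OF cmp(1)] unfolding tight_cells_def msrc(2) by blast
      from bij_betw_trans[OF bij_unit_of this] show ?thesis
        by (simp add: o_def)
    qed
    show ?thesis
    proof (rule pairs[OF bij bij_counit_of])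
      show "loose_adjunction X (companion X l) P m \<eta> \<epsilon> \<Longrightarrow>
          \<eta> \<in> cells X [] (tgt X m) \<and> \<epsilon> \<in> cells X [L, P] (lid X C)" for \<eta> \<epsilon>
        by (simp add: loose_adjunction_def)
      fix s f
      assume sf: "s \<in> cells X [K] P" "f \<in> cells X [P] K"
      have "unit_of X j l r s \<in> cells X [] (tgt X ?m)"
        using unit_of(1)[OF sf(1)] by (simp add: tight_cells_def)
      from loose_adjunction_comparison[OF mo msrc(1) m this]
      show "loose_adjunction X (companion X l) P m (desc X ?m [] [] m \<diamondop> [unit_of X j l r s]) (counit_of X l f) \<longleftrightarrow> ?RA s f"
        using sf unit_of(1)[OF sf(1)] by (simp add: loose_adjunction_iff relative_adjunction_laws)
    qed
  qed
  show ?thesis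
    using 2 3 4 5 6 7 8 by blast
qed

end
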